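(* Let $V$ be a simple vertex operator algebra, $G\le\mathrm{Aut}(V)$ a finite group, and suppose that for each $g\in G$ there is given a simple $g$-twisted $V$-module $(M(g),Y_g)$ such that $(M(g),Y_g)\circ h\cong (M(h^{-1}gh),Y_{h^{-1}gh})$ for all $g,h\in G$. Let $V^*=\bigoplus_{g\in G}M(g)$ and let $D_\alpha(G)$ be the twisted quantum double determined by this family. Then the following hold. (i) $V^*$ is a module over $D_\alpha(G)$, with action $(a\otimes e(x))\cdot m=\delta_{x,g}\,\phi_x(a)m$ for $m\in M(g)$ and $a,x,g\in G$. (ii) Every simple $D_\alpha(G)$-module occurs as a submodule of $V^*$. (iii) If $V^G$ is the sub VOA of $G$-invariants of $V$, then $V^*$ is a $V^G$-module and the actions of $D_\alpha(G)$ and $V^G$ on $V^*$ commute.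
   Context: All spaces are over $\mathbb C$. A vertex operator algebra (VOA) $(V,Y,\mathbf 1,\omega)$ is understood in the standard sense: $V=\bigoplus_{n\in\mathbb Z}V_n$, $\dim V_n<\infty$, $V_n=0$ for $n$ sufficiently small, $Y(v,z)=\sum_{n\in\mathbb Z}v_nz^{-n-1}$, Jacobi identity, vacuum $\mathbf 1$, Virasoro vector $\omega$ with $Y(\omega,z)=\sum_n L(n)z^{-n-2}$, $V_n$ the $n$-eigenspace of $L(0)$, rank in $\mathbb Q$. $\mathrm{Aut}(V)$ is the group of linear automorphisms $g$ of $V$ with $gY(v,z)g^{-1}=Y(gv,z)$, $g\mathbf 1=\mathbf 1$, $g\omega=\omega$. Twisted modules. Let $g\in \mathrm{Aut}(V)$ have finite order $N$ and let $V^j=\{v\in V: gv=e^{2\pi i j/N}v\}$. A weak $g$-twisted $V$-module is a $\mathbb C$-graded space $M=\bigoplus_{n\in\mathbb C}M_n$ such that for each $\lambda\in\mathbb C$, $M_{n+\lambda}=0$ for $n\in\frac1N\mathbb Z$ sufficiently small, with a linear map $v\mapsto Y_g(v,z)=\sum_{n\in\frac1N\mathbb Z}v_nz^{-n-1}$, $v_n\in\mathrm{End}(M)$, such that: $Y_g(v,z)=\sum_{n\in j/N+\mathbb Z}v_nz^{-n-1}$ for $v\in V^j$; $u_nw=0$ for $n$ sufficiently large; $Y_g(\mathbf 1,z)=1$; for $u\in V^k$, $$z_0^{-1}\delta\!\left(\tfrac{z_1-z_2}{z_0}\right)Y_g(u,z_1)Y_g(v,z_2)-z_0^{-1}\delta\!\left(\tfrac{z_2-z_1}{-z_0}\right)Y_g(v,z_2)Y_g(u,z_1)=z_2^{-1}\left(\tfrac{z_1-z_0}{z_2}\right)^{-k/N}\delta\!\left(\tfrac{z_1-z_0}{z_2}\right)Y_g(Y(u,z_0)v,z_2);$$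 the Virasoro relations hold for the components $L(n)$ of $\omega$, $L(0)w=nw$ for $w\in M_n$, and $\frac{d}{dz}Y_g(v,z)=Y_g(L(-1)v,z)$. It is a $g$-twisted $V$-module if moreover every $M_n$ is finite-dimensional; for $g=1$ these are the (weak) $V$-modules. For a $g$-twisted module $(M,Y_M)$ and $h\in \mathrm{Aut}(V)$, $(M,Y_M)\circ h$ is the $h^{-1}gh$-twisted module with the same space $M$ and vertex operators $v\mapsto Y_M(hv,z)$. The twisted quantum double. By hypothesis, for all $g,h\in G$ there is a linear isomorphism $\phi_g(h):M(g)\to M(hgh^{-1})$ with $\phi_g(h)Y_g(v,z)\phi_g(h)^{-1}=Y_{hgh^{-1}}(hv,z)$ for all $v\in V$; it is unique up to a nonzero scalar. Fix a choice of these. Then there are $\alpha_g(h,k)\in\mathbb C^\times$ with $\phi_g(hk)=\alpha_g(h,k)^{-1}\phi_{kgk^{-1}}(h)\phi_g(k)$, and they satisfy $\alpha_g(hk,l)\alpha_{lgl^{-1}}(h,k)=\alpha_g(h,kl)\alpha_g(k,l)$. Let $\mathbb C[G]^*$ have basis $e(g)$, $g\in G$, with $e(g)e(h)=\delta_{g,h}e(g)$. $D_\alpha(G)$ is the associative algebra with underlying space $\mathbb C[G]\otimes\mathbb C[G]^*$ and multiplication $$(a\otimes e(x))\cdot(b\otimes e(y))=\alpha_y(a,b)\,ab\otimes e(b^{-1}xb)e(y)\qquad(a,b,x,y\in G).$$ In (iii), $v\in V^G$ acts on $V^*$ through the operators that act on each $M(g)$ as $Y_g(v,z)$. *)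

theory Defs
  imports
    Complex_Main
    "HOL-Algebra.Bij"
    "HOL-Algebra.Multiplicative_Group"
    "HOL-Library.Function_Algebras"
    "HOL-Library.Groups_Big_Fun"
begin

section \<open>Complex vector spaces\<close>

class complex_vector = ab_group_add +
  fixes scaleC :: "complex \<Rightarrow> 'a \<Rightarrow> 'a" (infixr "*\<^sub>C" 75)
  assumes scaleC_add_right: "a *\<^sub>C (x + y) = a *\<^sub>C x + a *\<^sub>C y"
    and scaleC_add_left: "(a + b) *\<^sub>C x = a *\<^sub>C x + b *\<^sub>C x"
    and scaleC_scaleC: "a *\<^sub>C (b *\<^sub>C x) = (a * b) *\<^sub>C x"
    and scaleC_one: "1 *\<^sub>C x = x"

global_interpretation complex_vector:
  vector_space "scaleC :: complex \<Rightarrow> 'a \<Rightarrow> 'a :: complex_vector"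
  defines csubspace = complex_vector.subspace
    and cspan = complex_vector.span
  by unfold_locales
    (rule scaleC_add_right scaleC_add_left scaleC_scaleC scaleC_one)+

instantiation complex :: complex_vector
begin
definition scaleC_complex :: "complex \<Rightarrow> complex \<Rightarrow> complex"
  where "scaleC_complex c z = c * z"
instance by standard (simp_all add: scaleC_complex_def algebra_simps)
end

instantiation "fun" :: (type, complex_vector) complex_vector
begin
definition scaleC_fun :: "complex \<Rightarrow> ('a \<Rightarrow> 'b) \<Rightarrow> 'a \<Rightarrow> 'b"
  where "scaleC_fun c f = (\<lambda>x. c *\<^sub>C f x)"
instance
  by standard (simp_all add: scaleC_fun_def fun_eq_iff
      scaleC_add_right scaleC_add_left scaleC_scaleC scaleC_one)
end

text \<open>Vector spaces are carried by subspaces of an ambient type, so maps between them are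
  constrained on their domain only.\<close>

definition clinear_betw ::
    "'a::complex_vector set \<Rightarrow> 'b::complex_vector set \<Rightarrow> ('a \<Rightarrow> 'b) \<Rightarrow> bool"
  where "clinear_betw A B f \<longleftrightarrow>
    (\<forall>x\<in>A. f x \<in> B) \<and>
    (\<forall>x\<in>A. \<forall>y\<in>A. f (x + y) = f x + f y) \<and>
    (\<forall>c. \<forall>x\<in>A. f (c *\<^sub>C x) = c *\<^sub>C f x)"

definition clinear_iso ::
    "'a::complex_vector set \<Rightarrow> 'b::complex_vector set \<Rightarrow> ('a \<Rightarrow> 'b) \<Rightarrow> bool"
  where "clinear_iso A B f \<longleftrightarrow> clinear_betw A B f \<and> bij_betw f A B"

definition finite_dim :: "'a::complex_vector set \<Rightarrow> bool"
  where "finite_dim W \<longleftrightarrow> (\<exists>B. finite B \<and> cspan B = W)"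

definition direct_sum_of :: "'a::complex_vector set \<Rightarrow> ('i \<Rightarrow> 'a set) \<Rightarrow> bool"
  where "direct_sum_of W U \<longleftrightarrow>
    csubspace W \<and> (\<forall>i. csubspace (U i) \<and> U i \<subseteq> W) \<and>
    (\<forall>w\<in>W. \<exists>!c. (\<forall>i. c i \<in> U i) \<and> finite {i. c i \<noteq> 0} \<and> w = (\<Sum>i. c i))"


section \<open>Vertex operator algebras\<close>

text \<open>\<open>vmode V v n\<close> is the operator $v_n$ in $Y(v,z) = \sum_n v_n z^{-n-1}$, \<open>vac\<close> and \<open>conf\<close> are
  the vacuum and Virasoro vectors.\<close>

record 'v voa = "'v partial_object" +
  vgrade :: "int \<Rightarrow> 'v set"
  vmode :: "'v \<Rightarrow> int \<Rightarrow> 'v \<Rightarrow> 'v"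
  vac :: 'v
  conf :: 'v
  vrank :: rat

definition vir :: "'v voa \<Rightarrow> int \<Rightarrow> 'v \<Rightarrow> 'v"
  where "vir V n = vmode V (conf V) (n + 1)"

text \<open>The Jacobi identity is stated by comparing the coefficients of
  $z_0^{-l-1} z_1^{-m-1} z_2^{-n-1}$, where $\delta(z) = \sum_{r} z^r$ and binomials are expanded in
  nonnegative powers of their second variable. On the right-hand side this coefficient first
  appears with the factor $(-1)^i \binom{i-m-1}{i}$, which is $\binom{m}{i}$ by
  \<open>gbinomial_negated_upper\<close>. By truncation every sum has only finitely many nonzero terms.\<close>

locale vertex_operator_algebra =
  fixes V :: "'v::complex_vector voa"
  assumes grading: "direct_sum_of (carrier V) (vgrade V)"
    and grade_finite_dim: "finite_dim (vgrade V n)"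
    and grade_bounded_below: "\<exists>K. \<forall>n<K. vgrade V n = {0}"
    and mode_linear_left:
      "w \<in> carrier V \<Longrightarrow> clinear_betw (carrier V) (carrier V) (\<lambda>v. vmode V v n w)"
    and mode_linear:
      "v \<in> carrier V \<Longrightarrow> clinear_betw (carrier V) (carrier V) (vmode V v n)"
    and truncation:
      "\<lbrakk>u \<in> carrier V; v \<in> carrier V\<rbrakk> \<Longrightarrow> \<exists>K. \<forall>n\<ge>K. vmode V u n v = 0"
    and vac_closed: "vac V \<in> carrier V"
    and vac_mode:
      "v \<in> carrier V \<Longrightarrow> vmode V (vac V) n v = (if n = -1 then v else 0)"
    and creation_regular:
      "\<lbrakk>v \<in> carrier V; n \<ge> 0\<rbrakk> \<Longrightarrow> vmode V v n (vac V) = 0"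
    and creation: "v \<in> carrier V \<Longrightarrow> vmode V v (-1) (vac V) = v"
    and jacobi:
      "\<lbrakk>u \<in> carrier V; v \<in> carrier V; w \<in> carrier V\<rbrakk> \<Longrightarrow>
        (\<Sum>i::nat. ((-1) ^ i * (of_int l gchoose i)) *\<^sub>C
            vmode V u (m + l - int i) (vmode V v (n + int i) w))
        - (\<Sum>i::nat. ((-1) powi l * (-1) ^ i * (of_int l gchoose i)) *\<^sub>C
            vmode V v (n + l - int i) (vmode V u (m + int i) w))
        = (\<Sum>i::nat. (of_int m gchoose i) *\<^sub>C
            vmode V (vmode V u (l + int i) v) (m + n - int i) w)"
    and conf_closed: "conf V \<in> carrier V"
    and virasoro:
      "v \<in> carrier V \<Longrightarrow>
        vir V m (vir V n v) - vir V n (vir V m v)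
        = of_int (m - n) *\<^sub>C vir V (m + n) v
          + (if m + n = 0 then of_int (m ^ 3 - m) / 12 * of_rat (vrank V) else 0) *\<^sub>C v"
    and grade_eq: "vgrade V n = {v \<in> carrier V. vir V 0 v = of_int n *\<^sub>C v}"
    and derivative:
      "\<lbrakk>v \<in> carrier V; w \<in> carrier V\<rbrakk> \<Longrightarrow>
        vmode V (vir V (-1) v) n w = - of_int n *\<^sub>C vmode V v (n - 1) w"

text \<open>Simplicity is irreducibility of the adjoint module.\<close>

locale simple_voa = vertex_operator_algebra +
  assumes nonzero: "carrier V \<noteq> {0}"
    and irreducible:
      "\<lbrakk>csubspace I; I \<subseteq> carrier V; \<And>v n x. \<lbrakk>v \<in> carrier V; x \<in> I\<rbrakk> \<Longrightarrow> vmode V v n x \<in> I\<rbrakk>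
        \<Longrightarrow> I = {0} \<or> I = carrier V"

text \<open>Automorphisms are extensional functions on the carrier, as in \<open>BijGroup\<close>.\<close>

definition voa_Aut :: "'v::complex_vector voa \<Rightarrow> ('v \<Rightarrow> 'v) monoid"
  where "voa_Aut V = BijGroup (carrier V)
    \<lparr>carrier := {g \<in> Bij (carrier V).
        clinear_betw (carrier V) (carrier V) g \<and>
        (\<forall>v\<in>carrier V. \<forall>w\<in>carrier V. \<forall>n. g (vmode V v n w) = vmode V (g v) n (g w)) \<and>
        g (vac V) = vac V \<and> g (conf V) = conf V}\<rparr>"

definition fixed_voa :: "('v \<Rightarrow> 'v) set \<Rightarrow> 'v voa \<Rightarrow> 'v voa"
  where "fixed_voa G V = V
    \<lparr>carrier := {v \<in> carrier V. \<forall>g\<in>G. g v = v},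
     vgrade := \<lambda>n. {v \<in> vgrade V n. \<forall>g\<in>G. g v = v}\<rparr>"


section \<open>Twisted modules\<close>

text \<open>The modes $v_n$ of $Y_g(v,z) = \sum_{n \in \frac1N \mathbb{Z}} v_n z^{-n-1}$ are indexed by all
  rational \<open>n\<close> and vanish outside $\frac1N \mathbb{Z}$.\<close>

record ('v, 'm) tmodule = "'m partial_object" +
  tgrade :: "complex \<Rightarrow> 'm set"
  tmode :: "'v \<Rightarrow> rat \<Rightarrow> 'm \<Rightarrow> 'm"

definition tvir :: "'v voa \<Rightarrow> ('v, 'm) tmodule \<Rightarrow> int \<Rightarrow> 'm \<Rightarrow> 'm"
  where "tvir V M n = tmode M (conf V) (of_int n + 1)"

abbreviation aut_order :: "'v::complex_vector voa \<Rightarrow> ('v \<Rightarrow> 'v) \<Rightarrow> nat"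
  where "aut_order V g \<equiv> group.ord (voa_Aut V) g"

definition aut_eigenspace :: "'v::complex_vector voa \<Rightarrow> ('v \<Rightarrow> 'v) \<Rightarrow> int \<Rightarrow> 'v set"
  where "aut_eigenspace V g j = {v \<in> carrier V.
    g v = exp (2 * of_real pi * \<i> * of_int j / of_nat (aut_order V g)) *\<^sub>C v}"

text \<open>\<open>group.ord\<close> is \<open>0\<close> on elements of infinite order. The twisted Jacobi identity again compares
  coefficients of $z_0^{-l-1} z_1^{-m-1} z_2^{-n-1}$; only $m \in k/N + \mathbb{Z}$ occurs
  for $u \in V^k$.\<close>

locale weak_twisted_module = vertex_operator_algebra V
  for V :: "'v::complex_vector voa" +
  fixes g :: "'v \<Rightarrow> 'v" and M :: "('v, 'm::complex_vector) tmodule"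
  assumes aut: "g \<in> carrier (voa_Aut V)"
    and finite_order: "aut_order V g > 0"
    and tgrading: "direct_sum_of (carrier M) (tgrade M)"
    and tgrade_bounded_below:
      "\<exists>K. \<forall>n<K. of_nat (aut_order V g) * n \<in> \<int> \<longrightarrow> tgrade M (of_rat n + s) = {0}"
    and tmode_linear_left:
      "w \<in> carrier M \<Longrightarrow> clinear_betw (carrier V) (carrier M) (\<lambda>v. tmode M v n w)"
    and tmode_linear:
      "v \<in> carrier V \<Longrightarrow> clinear_betw (carrier M) (carrier M) (tmode M v n)"
    and tmode_support:
      "\<lbrakk>v \<in> carrier V; w \<in> carrier M; of_nat (aut_order V g) * n \<notin> \<int>\<rbrakk> \<Longrightarrow> tmode M v n w = 0"
    and tmode_support_eigen:
      "\<lbrakk>v \<in> aut_eigenspace V g j; w \<in> carrier M; n - of_int j / of_nat (aut_order V g) \<notin> \<int>\<rbrakk>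
        \<Longrightarrow> tmode M v n w = 0"
    and ttruncation:
      "\<lbrakk>v \<in> carrier V; w \<in> carrier M\<rbrakk> \<Longrightarrow> \<exists>K. \<forall>n\<ge>K. tmode M v n w = 0"
    and tvac_mode:
      "w \<in> carrier M \<Longrightarrow> tmode M (vac V) n w = (if n = -1 then w else 0)"
    and tjacobi:
      "\<lbrakk>u \<in> aut_eigenspace V g k; v \<in> carrier V; w \<in> carrier M;
        m - of_int k / of_nat (aut_order V g) \<in> \<int>\<rbrakk> \<Longrightarrow>
        (\<Sum>i::nat. ((-1) ^ i * (of_int l gchoose i)) *\<^sub>C
            tmode M u (m + of_int l - of_nat i) (tmode M v (n + of_nat i) w))
        - (\<Sum>i::nat. ((-1) powi l * (-1) ^ i * (of_int l gchoose i)) *\<^sub>C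
            tmode M v (n + of_int l - of_nat i) (tmode M u (m + of_nat i) w))
        = (\<Sum>i::nat. (of_rat m gchoose i) *\<^sub>C
            tmode M (vmode V u (l + int i) v) (m + n - of_nat i) w)"
    and tvirasoro:
      "w \<in> carrier M \<Longrightarrow>
        tvir V M p (tvir V M q w) - tvir V M q (tvir V M p w)
        = of_int (p - q) *\<^sub>C tvir V M (p + q) w
          + (if p + q = 0 then of_int (p ^ 3 - p) / 12 * of_rat (vrank V) else 0) *\<^sub>C w"
    and tgrade_eigen: "w \<in> tgrade M s \<Longrightarrow> tvir V M 0 w = s *\<^sub>C w"
    and tderivative:
      "\<lbrakk>v \<in> carrier V; w \<in> carrier M\<rbrakk> \<Longrightarrow>
        tmode M (vir V (-1) v) n w = - of_rat n *\<^sub>C tmode M v (n - 1) w"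

locale twisted_module = weak_twisted_module +
  assumes tgrade_finite_dim: "finite_dim (tgrade M s)"

abbreviation voa_module ::
    "'v::complex_vector voa \<Rightarrow> ('v, 'm::complex_vector) tmodule \<Rightarrow> bool"
  where "voa_module V M \<equiv> twisted_module V \<one>\<^bsub>voa_Aut V\<^esub> M"

text \<open>A subspace stable under all modes is stable under $L(0)$, hence automatically graded.\<close>

locale simple_twisted_module = twisted_module +
  assumes tnonzero: "carrier M \<noteq> {0}"
    and tirreducible:
      "\<lbrakk>csubspace U; U \<subseteq> carrier M; \<And>v n x. \<lbrakk>v \<in> carrier V; x \<in> U\<rbrakk> \<Longrightarrow> tmode M v n x \<in> U\<rbrakk>
        \<Longrightarrow> U = {0} \<or> U = carrier M"

definition tmodule_comp :: "('v, 'm) tmodule \<Rightarrow> ('v \<Rightarrow> 'v) \<Rightarrow> ('v, 'm) tmodule" (infixl "\<circ>\<^sub>M" 70)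
  where "M \<circ>\<^sub>M h = M\<lparr>tmode := \<lambda>v. tmode M (h v)\<rparr>"

definition tmodule_iso ::
    "'v voa \<Rightarrow> ('v, 'm::complex_vector) tmodule \<Rightarrow> ('v, 'n::complex_vector) tmodule \<Rightarrow> ('m \<Rightarrow> 'n) \<Rightarrow> bool"
  where "tmodule_iso V M M' f \<longleftrightarrow> clinear_iso (carrier M) (carrier M') f \<and>
    (\<forall>v\<in>carrier V. \<forall>n. \<forall>w\<in>carrier M. f (tmode M v n w) = tmode M' v n (f w))"

text \<open>The direct sum of a family of modules over a finite index set \<open>I\<close>, realised as functions
  vanishing outside \<open>I\<close>, with componentwise grading and modes.\<close>

definition tmodule_sum ::
    "'i set \<Rightarrow> ('i \<Rightarrow> ('v, 'm::complex_vector) tmodule) \<Rightarrow> ('v, 'i \<Rightarrow> 'm) tmodule"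
  where "tmodule_sum I M =
    \<lparr>carrier = {f. (\<forall>i\<in>I. f i \<in> carrier (M i)) \<and> (\<forall>i. i \<notin> I \<longrightarrow> f i = 0)},
     tgrade = \<lambda>s. {f. (\<forall>i\<in>I. f i \<in> tgrade (M i) s) \<and> (\<forall>i. i \<notin> I \<longrightarrow> f i = 0)},
     tmode = \<lambda>v n f i. if i \<in> I then tmode (M i) v n (f i) else 0\<rparr>"

definition summand :: "'i \<Rightarrow> 'm::zero \<Rightarrow> 'i \<Rightarrow> 'm"
  where "summand i m = (\<lambda>j. if j = i then m else 0)"


section \<open>Associative algebras and their modules\<close>

locale complex_algebra = monoid A
  for A :: "'a::complex_vector monoid" (structure) +
  assumes carrier_subspace: "csubspace (carrier A)"
    and mult_linear_left: "y \<in> carrier A \<Longrightarrow> clinear_betw (carrier A) (carrier A) (\<lambda>x. x \<otimes> y)"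
    and mult_linear_right: "x \<in> carrier A \<Longrightarrow> clinear_betw (carrier A) (carrier A) (\<lambda>y. x \<otimes> y)"

locale algebra_module = complex_algebra A
  for A :: "'a::complex_vector monoid" (structure) +
  fixes W :: "'w::complex_vector set" and act :: "'a \<Rightarrow> 'w \<Rightarrow> 'w"
  assumes module_subspace: "csubspace W"
    and act_linear_left: "w \<in> W \<Longrightarrow> clinear_betw (carrier A) W (\<lambda>x. act x w)"
    and act_linear: "x \<in> carrier A \<Longrightarrow> clinear_betw W W (act x)"
    and act_mult: "\<lbrakk>x \<in> carrier A; y \<in> carrier A; w \<in> W\<rbrakk> \<Longrightarrow> act (x \<otimes> y) w = act x (act y w)"
    and act_one: "w \<in> W \<Longrightarrow> act \<one> w = w"

definition algebra_submodule ::
    "'a monoid \<Rightarrow> 'w::complex_vector set \<Rightarrow> ('a \<Rightarrow> 'w \<Rightarrow> 'w) \<Rightarrow> 'w set \<Rightarrow> bool"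
  where "algebra_submodule A W act U \<longleftrightarrow>
    csubspace U \<and> U \<subseteq> W \<and> (\<forall>x\<in>carrier A. \<forall>u\<in>U. act x u \<in> U)"

locale simple_algebra_module = algebra_module +
  assumes module_nonzero: "W \<noteq> {0}"
    and module_irreducible: "algebra_submodule A W act U \<Longrightarrow> U = {0} \<or> U = W"

definition algebra_module_iso ::
    "'a monoid \<Rightarrow> 'w::complex_vector set \<Rightarrow> ('a \<Rightarrow> 'w \<Rightarrow> 'w) \<Rightarrow>
      'u::complex_vector set \<Rightarrow> ('a \<Rightarrow> 'u \<Rightarrow> 'u) \<Rightarrow> ('w \<Rightarrow> 'u) \<Rightarrow> bool"
  where "algebra_module_iso A W act U act' f \<longleftrightarrow> clinear_iso W U f \<and>
    (\<forall>x\<in>carrier A. \<forall>w\<in>W. f (act x w) = act' x (f w))"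


section \<open>The twisted quantum double\<close>

text \<open>\<open>K\<close> is an ambient group and \<open>G\<close> a finite subgroup of it; \<open>conjugate K h g\<close> is $hgh^{-1}$.\<close>

definition conjugate :: "('g, 'b) monoid_scheme \<Rightarrow> 'g \<Rightarrow> 'g \<Rightarrow> 'g"
  where "conjugate K h g = h \<otimes>\<^bsub>K\<^esub> g \<otimes>\<^bsub>K\<^esub> inv\<^bsub>K\<^esub> h"

text \<open>The scalars $\alpha_g(h,k)$ with
  $\phi_g(hk) = \alpha_g(h,k)^{-1} \phi_{kgk^{-1}}(h) \phi_g(k)$; they exist
  and are unique because \<open>M g\<close> is simple.\<close>

definition intertwiner_cocycle ::
    "('g, 'b) monoid_scheme \<Rightarrow> ('g \<Rightarrow> ('v, 'm::complex_vector) tmodule) \<Rightarrow>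
      ('g \<Rightarrow> 'g \<Rightarrow> 'm \<Rightarrow> 'm) \<Rightarrow> 'g \<Rightarrow> 'g \<Rightarrow> 'g \<Rightarrow> complex"
  where "intertwiner_cocycle K M \<phi> g h k = (THE c. c \<noteq> 0 \<and>
    (\<forall>m\<in>carrier (M g). \<phi> g (h \<otimes>\<^bsub>K\<^esub> k) m = inverse c *\<^sub>C \<phi> (conjugate K k g) h (\<phi> g k m)))"

text \<open>Elements of $\mathbb{C}[G] \otimes \mathbb{C}[G]^*$ are coefficient functions on $G \times G$, extended by
  zero; \<open>qd_basis a x\<close> is $a \otimes e(x)$. The product extends
  $(a \otimes e(x)) (b \otimes e(y)) = \alpha_y(a,b)\, ab \otimes e(b^{-1}xb) e(y)$ bilinearly, and
  the unit element is $\sum_x \alpha_x(1,1)^{-1}\, 1 \otimes e(x)$.\<close>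

definition qd_basis :: "'g \<Rightarrow> 'g \<Rightarrow> 'g \<times> 'g \<Rightarrow> complex"
  where "qd_basis a x = summand (a, x) 1"

definition quantum_double ::
    "('g, 'b) monoid_scheme \<Rightarrow> 'g set \<Rightarrow> ('g \<Rightarrow> 'g \<Rightarrow> 'g \<Rightarrow> complex) \<Rightarrow> ('g \<times> 'g \<Rightarrow> complex) monoid"
  where "quantum_double K G \<alpha> =
    \<lparr>carrier = {d. \<forall>p. p \<notin> G \<times> G \<longrightarrow> d p = 0},
     mult = \<lambda>d d'. \<Sum>(a, x)\<in>G \<times> G. \<Sum>(b, y)\<in>G \<times> G.
       (d (a, x) * d' (b, y) * \<alpha> y a b) *\<^sub>C
         (if inv\<^bsub>K\<^esub> b \<otimes>\<^bsub>K\<^esub> x \<otimes>\<^bsub>K\<^esub> b = y then qd_basis (a \<otimes>\<^bsub>K\<^esub> b) y else 0),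
     one = \<Sum>x\<in>G. inverse (\<alpha> x \<one>\<^bsub>K\<^esub> \<one>\<^bsub>K\<^esub>) *\<^sub>C qd_basis \<one>\<^bsub>K\<^esub> x\<rparr>"

text \<open>The linear extension of $(a \otimes e(x)) \cdot m = \delta_{x,g}\, \phi_x(a) m$ for
  \<open>m \<in> M(g)\<close>; the result lies in the summand $M(axa^{-1})$.\<close>

definition qd_action ::
    "('g, 'b) monoid_scheme \<Rightarrow> 'g set \<Rightarrow> ('g \<Rightarrow> 'g \<Rightarrow> 'm \<Rightarrow> 'm) \<Rightarrow>
      ('g \<times> 'g \<Rightarrow> complex) \<Rightarrow> ('g \<Rightarrow> 'm::complex_vector) \<Rightarrow> 'g \<Rightarrow> 'm"
  where "qd_action K G \<phi> d f =
    (\<Sum>(a, x)\<in>G \<times> G. d (a, x) *\<^sub>C summand (conjugate K a x) (\<phi> x a (f x)))"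

end

theory Submission
  imports Defs "HOL-Computational_Algebra.Fundamental_Theorem_Algebra"
begin

text \<open>The key point is that the operators \<open>\<phi>\<close> between two fixed summands of \<open>V\<^sup>*\<close> are linearly
  independent, that is, $D_\alpha(G)$ acts faithfully. Schur's lemma and simplicity of \<open>V\<close> make
  $V \otimes M(g) \to M(g)((z))$ injective, so applying a relation $\sum_a c_a \phi_x(a) = 0$ to the
  modes of \<open>v\<close> gives the relations with coefficients $c_a f(av)$ for all functionals \<open>f\<close> on \<open>V\<close>.
  These functions separate the elements of \<open>G\<close>, and Dedekind's argument applies. Faithfulness
  yields the algebra axioms. For a simple module \<open>S\<close>, averaging a rank-one map
  $S \to V^*$ gives a homomorphism, which is nonzero for a suitable choice by the independence of
  the inverse operators.\<close>

section \<open>Linear algebra\<close>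

text \<open>A simple module over \<open>D\<close> lives on an arbitrary space and the summands of
  \<open>Vstar\<close> may be infinite-dimensional, so the embedding comes from a single nonzero
  homomorphism, whose kernel vanishes by simplicity. Its component at \<open>x\<close> sends s to
  the sum of l((a \<otimes> e(x))s) times the inverse of \<phi>_x(a) applied to a fixed m in M(z),
  over all a that conjugate x to z. Reindexing a to ak makes it commute with k \<otimes> e(y), the
  two factors \<alpha> cancelling. For this reason the inverse operators have to be independent as
  well. They twist modes by the inverse of a instead of a, so independence is proved once for an
  arbitrary family of twists \<sigma>.

  Two obstacles shape the part on twisted modules. The twisted Jacobi identity is available only if
  its first vector is an eigenvector of g, so arbitrary vectors are decomposed into eigenvectors.
  Schur's lemma on a possibly infinite-dimensional module needs an eigenvector, which is found in a
  nonzero graded piece, a finite-dimensional eigenspace of L(0).\<close>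

lemma clinear_betw_mem: "clinear_betw A B f \<Longrightarrow> x \<in> A \<Longrightarrow> f x \<in> B"
  and clinear_betw_add: "clinear_betw A B f \<Longrightarrow> x \<in> A \<Longrightarrow> y \<in> A \<Longrightarrow> f (x + y) = f x + f y"
  and clinear_betw_scale: "clinear_betw A B f \<Longrightarrow> x \<in> A \<Longrightarrow> f (c *\<^sub>C x) = c *\<^sub>C f x"
  by (auto simp: clinear_betw_def)

lemma clinear_betw_zero: "clinear_betw A B f \<Longrightarrow> csubspace A \<Longrightarrow> f 0 = 0"
  using clinear_betw_scale[of A B f 0 0] complex_vector.subspace_0[of A] by simp

lemma clinear_betw_sum:
  assumes f: "clinear_betw A B f" and A: "csubspace A" and h: "\<And>i. i \<in> I \<Longrightarrow> h i \<in> A"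
  shows "f (\<Sum>i\<in>I. h i) = (\<Sum>i\<in>I. f (h i))"
  using h
proof (induction I rule: infinite_finite_induct)
  case (insert i I)
  then show ?case
    using clinear_betw_add[OF f, of "h i" "sum h I"] complex_vector.subspace_sum[OF A, of I h] by simp
qed (simp_all add: clinear_betw_zero[OF f A])

lemma clinear_betw_diff:
  assumes "clinear_betw A B f" "csubspace A" "x \<in> A" "y \<in> A"
  shows "f (x - y) = f x - f y"
  using clinear_betw_add[OF assms(1), of "x - y" y] assms complex_vector.subspace_diff[of A x y] by simp

lemma clinear_betw_comp:
  "clinear_betw A B f \<Longrightarrow> clinear_betw B C g \<Longrightarrow> clinear_betw A C (\<lambda>x. g (f x))"
  by (simp add: clinear_betw_def)

lemma clinear_iso_inv:
  assumes "clinear_iso A B f" and "csubspace A"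
  shows "clinear_iso B A (inv_into A f)"
proof -
  have f: "clinear_betw A B f" and bij: "bij_betw f A B"
    using assms(1) by (auto simp: clinear_iso_def)
  have mem: "inv_into A f y \<in> A" if "y \<in> B" for y
    using bij that by (metis bij_betw_imp_surj_on inv_into_into)
  have r: "f (inv_into A f y) = y" if "y \<in> B" for y
    using bij that by (metis bij_betw_inv_into_right)
  have l: "inv_into A f (f x) = x" if "x \<in> A" for x
    using bij that by (metis bij_betw_inv_into_left)
  have "inv_into A f (x + y) = inv_into A f x + inv_into A f y" if "x \<in> B" "y \<in> B" for x y
    using l[of "inv_into A f x + inv_into A f y"] clinear_betw_add[OF f mem mem, OF that] r that
      complex_vector.subspace_add[OF assms(2) mem mem, OF that] by simp
  moreover have "inv_into A f (c *\<^sub>C x) = c *\<^sub>C inv_into A f x" if "x \<in> B" for c x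
    using l[of "c *\<^sub>C inv_into A f x"] clinear_betw_scale[OF f mem, OF that] r that
      complex_vector.subspace_scale[OF assms(2) mem, OF that] by simp
  ultimately show ?thesis
    using mem bij by (simp add: clinear_iso_def clinear_betw_def bij_betw_inv_into)
qed

text \<open>Taken on the whole ambient type rather than on a carrier: functionals on a subspace
  extend, so enough of them exist, and linearity carries no membership conditions.\<close>

definition cfunctional :: "('a::complex_vector \<Rightarrow> complex) \<Rightarrow> bool"
  where "cfunctional f \<longleftrightarrow> (\<forall>x y. f (x + y) = f x + f y) \<and> (\<forall>c x. f (c *\<^sub>C x) = c * f x)"

lemma cfunctional_add: "cfunctional f \<Longrightarrow> f (x + y) = f x + f y"
  and cfunctional_scale: "cfunctional f \<Longrightarrow> f (c *\<^sub>C x) = c * f x"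
  by (simp_all add: cfunctional_def)

lemma cfunctional_zero: "cfunctional f \<Longrightarrow> f 0 = 0"
  using cfunctional_scale[of f 0 0] by simp

lemma cfunctional_sum: "cfunctional f \<Longrightarrow> f (\<Sum>i\<in>I. h i) = (\<Sum>i\<in>I. f (h i))"
  by (induction I rule: infinite_finite_induct) (auto simp: cfunctional_zero cfunctional_add)

lemma cfunctional_diff: "cfunctional f \<Longrightarrow> f (x - y) = f x - f y"
  using cfunctional_add[of f "x - y" y] by simp

lemma cfunctional_nonzero:
  fixes s :: "'a::complex_vector"
  assumes "s \<noteq> 0"
  obtains f where "cfunctional f" and "f s \<noteq> 0"
proof -
  have s: "complex_vector.independent {s}"
    using assms complex_vector.dependent_single by blast
  define B where "B = complex_vector.extend_basis {s}"
  have B: "complex_vector.independent B" "cspan B = UNIV" "s \<in> B"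
    using complex_vector.independent_extend_basis[OF s] complex_vector.span_extend_basis[OF s]
      complex_vector.extend_basis_superset[OF s] by (auto simp: B_def)
  define f where "f x = complex_vector.representation B x s" for x
  have "cfunctional f"
    using B complex_vector.representation_add[OF B(1)] complex_vector.representation_scale[OF B(1)]
    by (simp add: cfunctional_def f_def)
  moreover have "f s = 1"
    using complex_vector.representation_basis[OF B(1,3)] by (simp add: f_def)
  ultimately show ?thesis using that by simp
qed

lemma finite_dim_subspace:
  assumes "finite_dim W" and "csubspace U" and "U \<subseteq> W"
  shows "finite_dim U"
proof -
  obtain B where B: "finite B" "cspan B = W" using assms(1) by (auto simp: finite_dim_def)
  obtain C where C: "C \<subseteq> U" "complex_vector.independent C" "U \<subseteq> cspan C"
    using complex_vector.basis_exists[of U] by metis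
  have "finite C"
    using complex_vector.independent_span_bound[OF B(1) C(2)] C(1) assms(3) B(2) by blast
  moreover have "cspan C = U"
    using C assms(2) complex_vector.span_minimal by blast
  ultimately show ?thesis by (auto simp: finite_dim_def)
qed

text \<open>Let \<open>p\<close> be a nonzero polynomial of least degree with p(T)w = 0 for a fixed
  nonzero \<open>w\<close>. It is not constant, so it has a root \<open>c\<close>. The cofactor
  \<open>q\<close> of X - c has smaller degree, hence q(T)w is nonzero, and T - c kills it.\<close>

lemma finite_dim_eigenvector:
  assumes fd: "finite_dim W" and nz: "W \<noteq> {0}" and T: "clinear_betw W W T"
  obtains x c where "x \<in> W" and "x \<noteq> 0" and "T x = c *\<^sub>C x"
proof -
  obtain B where B: "finite B" "cspan B = W" using fd by (auto simp: finite_dim_def)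
  have W: "csubspace W" using B complex_vector.subspace_span by blast
  note W0 = complex_vector.subspace_0[OF W]
  note T0 = clinear_betw_zero[OF T W]
  obtain w where w: "w \<in> W" "w \<noteq> 0" using nz W0 by auto
  \<comment> \<open>The vector p(T)w by Horner's rule. Only values of \<open>T\<close> on
    \<open>W\<close> enter, where \<open>T\<close> is known to be linear.\<close>
  define ev where "ev p = fold_coeffs (\<lambda>a x. a *\<^sub>C w + T x) p 0" for p
  have ev0: "ev 0 = 0" by (simp add: ev_def)
  have ev_pCons: "ev (pCons a p) = a *\<^sub>C w + T (ev p)" for a p
    by (cases "p = 0"; cases "a = 0") (simp_all add: ev_def T0)
  have evW: "ev p \<in> W" for p
    by (induction p) (auto simp: ev0 ev_pCons W0 intro!: complex_vector.subspace_add[OF W]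
        complex_vector.subspace_scale[OF W] w clinear_betw_mem[OF T])
  have ev_add: "ev (p + q) = ev p + ev q" for p q
    by (induction p q rule: poly_induct2)
      (simp_all add: ev0 ev_pCons clinear_betw_add[OF T] evW scaleC_add_left)
  have ev_smult: "ev (smult c p) = c *\<^sub>C ev p" for c p
    by (induction p) (simp_all add: ev0 ev_pCons clinear_betw_scale[OF T] evW scaleC_add_right scaleC_scaleC)
  have ev_sum: "ev (\<Sum>i\<in>I. h i) = (\<Sum>i\<in>I. ev (h i))" for I :: "nat set" and h
    by (induction I rule: infinite_finite_induct) (simp_all add: ev0 ev_add)
  \<comment> \<open>If \<open>ev\<close> had trivial kernel, the images of the monomials of degree 0
    up to \<open>card B\<close> would be \<open>card B + 1\<close> independent vectors in the span
    of \<open>B\<close>.\<close>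
  have "\<exists>p. p \<noteq> 0 \<and> ev p = 0"
  proof (rule ccontr)
    assume "\<not> ?thesis"
    then have inj: "p = 0" if "ev p = 0" for p using that by blast
    define e where "e i = ev (monom 1 i)" for i :: nat
    have inje: "inj e"
    proof (rule injI)
      fix i j assume "e i = e j"
      then have "ev (monom 1 i + smult (-1) (monom 1 j)) = 0"
        unfolding ev_add ev_smult e_def[symmetric]
        by (simp add: complex_vector.scale_minus_left scaleC_one)
      then have *: "monom 1 i + smult (-1) (monom 1 j) = (0 :: complex poly)" by (rule inj)
      show "i = j" using arg_cong[OF *, of "\<lambda>p. coeff p i"] by (simp split: if_splits)
    qed
    define S where "S = e ` {..card B}"
    have "complex_vector.independent S"
    proof
      assume "complex_vector.dependent S"
      then obtain u v where u: "v \<in> S" "u v \<noteq> 0" "(\<Sum>v\<in>S. u v *\<^sub>C v) = 0"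
        using complex_vector.dependent_finite[of S] by (auto simp: S_def)
      have "ev (\<Sum>i\<le>card B. smult (u (e i)) (monom 1 i)) = (\<Sum>i\<le>card B. u (e i) *\<^sub>C e i)"
        by (simp only: ev_sum ev_smult e_def)
      also have "\<dots> = 0"
        using u(3) inje by (simp add: S_def sum.reindex inj_on_def)
      finally have *: "(\<Sum>i\<le>card B. smult (u (e i)) (monom 1 i)) = 0" by (rule inj)
      obtain j where j: "j \<le> card B" "v = e j" using u(1) by (auto simp: S_def)
      show False
        using arg_cong[OF *, of "\<lambda>p. coeff p j"] j u(2) by (simp add: coeff_sum if_distrib cong: if_cong)
    qed
    moreover have "S \<subseteq> cspan B" using evW by (auto simp: S_def e_def B)
    ultimately have "card S \<le> card B"
      using complex_vector.independent_span_bound[OF B(1)] by blast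
    moreover have "card S = Suc (card B)"
      using inje by (simp add: S_def card_image inj_on_def)
    ultimately show False by simp
  qed
  then obtain p where p: "p \<noteq> 0" "ev p = 0"
    and min: "\<And>q. q \<noteq> 0 \<Longrightarrow> ev q = 0 \<Longrightarrow> degree p \<le> degree q"
    using ex_has_least_nat[of "\<lambda>p. p \<noteq> 0 \<and> ev p = 0" _ degree] by blast
  have "degree p \<noteq> 0"
  proof
    assume "degree p = 0"
    then obtain a where a: "p = [:a:]" by (metis degree_eq_zeroE)
    then show False using p w by (simp add: ev_pCons ev0 T0)
  qed
  then obtain c where "poly p c = 0"
    using fundamental_theorem_of_algebra[of p] by (auto simp: constant_degree)
  then obtain q where q: "p = [:-c, 1:] * q" by (auto simp: poly_eq_0_iff_dvd)
  have q0: "q \<noteq> 0" using p q by auto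
  have deg: "degree q < degree p"
    using q q0 by (simp add: degree_mult_eq del: mult_pCons_left)
  have "ev p = (- c) *\<^sub>C ev q + T (ev q)"
    by (simp add: q ev_add ev_pCons ev_smult del: smult_minus_left)
  then have "T (ev q) = c *\<^sub>C ev q"
    using p by (simp add: complex_vector.scale_minus_left eq_neg_iff_add_eq_0 add.commute)
  moreover have "ev q \<noteq> 0" using min[OF q0] deg by auto
  ultimately show ?thesis using that evW by blast
qed

section \<open>Automorphisms\<close>

context vertex_operator_algebra
begin

lemma carrier_subspace: "csubspace (carrier V)"
  using grading by (simp add: direct_sum_of_def)

lemma mode_closed: "v \<in> carrier V \<Longrightarrow> w \<in> carrier V \<Longrightarrow> vmode V v n w \<in> carrier V"
  using mode_linear clinear_betw_mem by blast

lemma group_Aut: "group (voa_Aut V)"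
proof -
  let ?S = "carrier V"
  let ?H = "{g \<in> Bij ?S. clinear_betw ?S ?S g \<and>
    (\<forall>v\<in>?S. \<forall>w\<in>?S. \<forall>n. g (vmode V v n w) = vmode V (g v) n (g w)) \<and>
    g (vac V) = vac V \<and> g (conf V) = conf V}"
  interpret B: group "BijGroup ?S" by (rule group_BijGroup)
  have inv: "inv\<^bsub>BijGroup ?S\<^esub> g \<in> ?H" if g: "g \<in> ?H" for g
  proof -
    \<comment> \<open>Members of \<open>Bij\<close> are extensional, so the group inverse is
      \<open>inv_into\<close> restricted to the carrier. The carrier is closed under all operations,
      so the restriction does not disturb the identities.\<close>
    let ?i = "\<lambda>x \<in> ?S. inv_into ?S g x"
    have iB: "inv\<^bsub>BijGroup ?S\<^esub> g = ?i" using g by (simp add: inv_BijGroup)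
    have bij: "bij_betw g ?S ?S" using g by (simp add: Bij_def)
    have "clinear_iso ?S ?S (inv_into ?S g)"
      using clinear_iso_inv[of ?S ?S g] g bij carrier_subspace by (simp add: clinear_iso_def)
    then have lin: "clinear_betw ?S ?S (inv_into ?S g)" by (simp add: clinear_iso_def)
    have l: "inv_into ?S g (g x) = x" if "x \<in> ?S" for x
      using bij that by (metis bij_betw_inv_into_left)
    have r: "g (inv_into ?S g x) = x" "inv_into ?S g x \<in> ?S" if "x \<in> ?S" for x
      using bij that clinear_betw_mem[OF lin that] by (auto simp: bij_betw_inv_into_right)
    have "clinear_betw ?S ?S ?i"
      using lin carrier_subspace
      by (simp add: clinear_betw_def complex_vector.subspace_add complex_vector.subspace_scale)
    moreover have "?i (vmode V v n w) = vmode V (?i v) n (?i w)" if "v \<in> ?S" "w \<in> ?S" for v n w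
      using l[OF mode_closed[OF r(2) r(2), OF that]] r that g by (simp add: mode_closed)
    moreover have "?i (vac V) = vac V" "?i (conf V) = conf V"
      using l[OF vac_closed] l[OF conf_closed] g vac_closed conf_closed by auto
    ultimately show ?thesis
      using g iB restrict_inv_into_Bij[of g ?S] by simp
  qed
  have "subgroup ?H (BijGroup ?S)"
  proof (rule B.subgroupI)
    show "?H \<subseteq> carrier (BijGroup ?S)" by (auto simp: BijGroup_def)
    have "(\<lambda>x\<in>?S. x) \<in> ?H"
      using id_Bij carrier_subspace vac_closed conf_closed
      by (auto simp: clinear_betw_def complex_vector.subspace_add complex_vector.subspace_scale mode_closed)
    then show "?H \<noteq> {}" by blast
    show "inv\<^bsub>BijGroup ?S\<^esub> g \<in> ?H" if "g \<in> ?H" for g using inv that .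
    show "g \<otimes>\<^bsub>BijGroup ?S\<^esub> h \<in> ?H" if g: "g \<in> ?H" and h: "h \<in> ?H" for g h
    proof -
      have "clinear_betw ?S ?S (compose ?S g h)"
        using g h carrier_subspace
        by (simp add: clinear_betw_def compose_eq complex_vector.subspace_add complex_vector.subspace_scale)
      then show ?thesis
        using g h vac_closed conf_closed clinear_betw_mem[of ?S ?S h]
        by (auto simp: BijGroup_def compose_eq compose_Bij mode_closed)
    qed
  qed
  then show ?thesis
    unfolding voa_Aut_def by (rule subgroup.subgroup_is_group[OF _ B.is_group])
qed

lemma
  assumes "g \<in> carrier (voa_Aut V)"
  shows Aut_linear: "clinear_betw (carrier V) (carrier V) g"
    and Aut_mode: "v \<in> carrier V \<Longrightarrow> w \<in> carrier V \<Longrightarrow> g (vmode V v n w) = vmode V (g v) n (g w)"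
    and Aut_vac: "g (vac V) = vac V"
    and Aut_conf: "g (conf V) = conf V"
    and Aut_closed: "v \<in> carrier V \<Longrightarrow> g v \<in> carrier V"
  using assms by (auto simp: voa_Aut_def clinear_betw_def)

text \<open>Extensionality of automorphisms turns agreement on the carrier into equality. Distinct
  elements of \<open>G\<close> therefore differ at some vector of \<open>V\<close>, which is the
  separation that Dedekind's argument asks for.\<close>

lemma Aut_ext:
  assumes "g \<in> carrier (voa_Aut V)" "h \<in> carrier (voa_Aut V)" "\<And>v. v \<in> carrier V \<Longrightarrow> g v = h v"
  shows "g = h"
  using assms by (auto simp: voa_Aut_def Bij_def intro: extensionalityI)

lemma Aut_one: "v \<in> carrier V \<Longrightarrow> \<one>\<^bsub>voa_Aut V\<^esub> v = v"
  by (simp add: voa_Aut_def BijGroup_def)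

lemma Aut_mult:
  assumes "g \<in> carrier (voa_Aut V)" "h \<in> carrier (voa_Aut V)" "v \<in> carrier V"
  shows "(g \<otimes>\<^bsub>voa_Aut V\<^esub> h) v = g (h v)"
  using assms by (simp add: voa_Aut_def BijGroup_def compose_eq)

lemma Aut_inv:
  assumes "g \<in> carrier (voa_Aut V)" "v \<in> carrier V"
  shows "(inv\<^bsub>voa_Aut V\<^esub> g) (g v) = v"
proof -
  interpret A: group "voa_Aut V" by (rule group_Aut)
  show ?thesis
    using Aut_mult[of "inv\<^bsub>voa_Aut V\<^esub> g" g v] Aut_one[of v] assms by simp
qed

lemma Aut_funpow_closed:
  assumes "g \<in> carrier (voa_Aut V)" and "v \<in> carrier V"
  shows "(g ^^ j) v \<in> carrier V"
  using assms by (induction j) (auto simp: Aut_closed)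

lemma Aut_funpow_order:
  assumes "g \<in> carrier (voa_Aut V)" and "v \<in> carrier V"
  shows "(g ^^ aut_order V g) v = v"
proof -
  interpret A: group "voa_Aut V" by (rule group_Aut)
  have "(g [^]\<^bsub>voa_Aut V\<^esub> j) v = (g ^^ j) v" for j
    using assms(2)
  proof (induction j arbitrary: v)
    case (Suc j)
    then show ?case
      using assms(1) by (simp add: Aut_mult Aut_closed funpow_swap1)
  qed (simp add: Aut_one)
  from this[of "aut_order V g"] show ?thesis
    using assms by (simp add: A.pow_ord_eq_1 Aut_one)
qed

text \<open>The projections onto the eigenspaces are the averages $\frac1N \sum_j \zeta^{-jk} g^j$.\<close>

lemma aut_eigenspace_decomposition:
  assumes g: "g \<in> carrier (voa_Aut V)" and N: "aut_order V g > 0" and v: "v \<in> carrier V"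
  obtains a :: "nat \<Rightarrow> 'v"
  where "\<And>k. a k \<in> aut_eigenspace V g (int k)" and "v = (\<Sum>k<aut_order V g. a k)"
proof -
  define N where "N = aut_order V g"
  have Npos: "N > 0" using assms by (simp add: N_def)
  define z where "z = cis (2 * pi / real N)"
  have z0: "z \<noteq> 0" by (simp add: z_def)
  have zk: "z ^ k = cis (2 * pi * real k / real N)" for k
    by (simp add: z_def DeMoivre mult_ac)
  have zN: "z ^ N = 1" using Npos by (simp add: zk)
  have zj: "z ^ j \<noteq> 1" if "0 < j" "j < N" for j
  proof
    assume "z ^ j = 1"
    then have "cis (2 * pi * real j / real N) = cis (2 * pi * real (0::nat) / real N)"
      by (simp add: zk)
    moreover have "inj_on (\<lambda>k. cis (2 * pi * real k / real N)) {..<N}"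
      using bij_betw_roots_unity[OF Npos] by (rule bij_betw_imp_inj_on)
    ultimately have "j = 0"
      using that by (metis (no_types, lifting) inj_onD lessThan_iff gr0I not_less_zero)
    then show False using that by simp
  qed
  define h where "h k j = inverse z ^ (k * j) *\<^sub>C (g ^^ j) v" for k j
  define a where "a k = (1 / of_nat N) *\<^sub>C (\<Sum>j<N. h k j)" for k
  note sub = carrier_subspace and lin = Aut_linear[OF g]
  have hV: "h k j \<in> carrier V" for k j
    by (simp add: h_def complex_vector.subspace_scale[OF sub] Aut_funpow_closed[OF g v])
  have sV: "(\<Sum>j<N. h k j) \<in> carrier V" for k
    by (simp add: complex_vector.subspace_sum[OF sub] hV)
  have "g (a k) = z ^ k *\<^sub>C a k" for k
  proof -
    have gh: "g (h k j) = z ^ k *\<^sub>C h k (Suc j)" for j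
      using z0 by (simp add: h_def clinear_betw_scale[OF lin] Aut_funpow_closed[OF g v]
          scaleC_scaleC power_add power_inverse)
    \<comment> \<open>The term at \<open>N\<close> returns to the term at 0 because the
      \<open>N\<close>-th powers of \<open>z\<close> and \<open>g\<close> are trivial. Shifting
      \<open>j\<close> thus preserves the sum, and \<open>g\<close> multiplies it by z^k.\<close>
    have h0: "h k N = h k 0"
      using zN Aut_funpow_order[OF g v]
      by (simp add: h_def power_inverse power_mult mult.commute[of k] N_def)
    have "(\<Sum>j<N. h k (Suc j)) = (\<Sum>j<N. h k j)"
      using sum.lessThan_Suc_shift[of "h k" N] h0 by (simp add: add.commute)
    then show ?thesis
      by (simp add: a_def clinear_betw_scale[OF lin sV] clinear_betw_sum[OF lin sub hV] gh
          scaleC_scaleC mult.commute flip: complex_vector.scale_sum_right)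
  qed
  moreover have "z ^ k = exp (2 * of_real pi * \<i> * of_int (int k) / of_nat N)" for k
    by (simp add: zk cis_conv_exp mult_ac)
  ultimately have "a k \<in> aut_eigenspace V g (int k)" for k
    using sV by (simp add: aut_eigenspace_def N_def a_def complex_vector.subspace_scale[OF sub])
  moreover have "(\<Sum>k<N. a k) = v"
  proof -
    \<comment> \<open>Orthogonality of characters: for nonzero \<open>j\<close> this is a full
      geometric sum over the powers of a nontrivial \<open>N\<close>-th root of unity.\<close>
    have *: "(\<Sum>k<N. inverse z ^ (k * j)) = (if j = 0 then of_nat N else 0)" if "j < N" for j
    proof (cases "j = 0")
      case False
      define y where "y = inverse z ^ j"
      have "y \<noteq> 1" using zj[of j] False that by (simp add: y_def power_inverse)
      moreover have "y ^ N = 1" using zN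
        by (simp add: y_def power_inverse mult.commute flip: power_mult) (simp add: power_mult)
      ultimately have "(\<Sum>k<N. y ^ k) = 0" by (simp add: geometric_sum)
      then show ?thesis using False by (simp add: y_def mult.commute flip: power_mult)
    qed simp
    have "(\<Sum>k<N. a k) = (1 / of_nat N) *\<^sub>C (\<Sum>j<N. \<Sum>k<N. h k j)"
      by (simp add: a_def sum.swap[of "\<lambda>j k. h k j"] flip: complex_vector.scale_sum_right)
    also have "(\<Sum>j<N. \<Sum>k<N. h k j) = (\<Sum>j<N. (if j = 0 then of_nat N else 0) *\<^sub>C (g ^^ j) v)"
      by (intro sum.cong refl) (simp add: h_def * flip: complex_vector.scale_sum_left)
    also have "\<dots> = of_nat N *\<^sub>C v"
      using Npos by (subst sum.remove[of _ 0]) auto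
    finally show ?thesis using Npos by (simp add: scaleC_scaleC scaleC_one)
  qed
  ultimately show ?thesis using that N_def by metis
qed

end

section \<open>Twisted modules\<close>

context weak_twisted_module
begin

lemma tcarrier_subspace: "csubspace (carrier M)"
  using tgrading by (simp add: direct_sum_of_def)

lemma tmode_closed: "v \<in> carrier V \<Longrightarrow> w \<in> carrier M \<Longrightarrow> tmode M v n w \<in> carrier M"
  using tmode_linear clinear_betw_mem by blast

lemma tmode_zero_right: "v \<in> carrier V \<Longrightarrow> tmode M v n 0 = 0"
  using clinear_betw_zero[OF tmode_linear tcarrier_subspace] .

lemma tmode_zero_left: "w \<in> carrier M \<Longrightarrow> tmode M 0 n w = 0"
  using clinear_betw_zero[OF tmode_linear_left carrier_subspace] .

text \<open>The twisted Jacobi identity speaks only of eigenvectors of \<open>g\<close> in its first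
  argument. Properties that pass to finite sums are reduced to that case here.\<close>

lemma eigenvector_induct [consumes 1, case_names eigen sum]:
  assumes v: "v \<in> carrier V"
    and eigen: "\<And>k v. v \<in> aut_eigenspace V g (int k) \<Longrightarrow> v \<in> carrier V \<Longrightarrow> P v"
    and sum: "\<And>(a :: nat \<Rightarrow> 'v) N. (\<And>k. a k \<in> carrier V) \<Longrightarrow> (\<And>k. P (a k)) \<Longrightarrow> P (\<Sum>k<N. a k)"
  shows "P v"
proof -
  obtain a where a: "\<And>k. a k \<in> aut_eigenspace V g (int k)" "v = (\<Sum>k<aut_order V g. a k)"
    using aut_eigenspace_decomposition[OF aut finite_order v] by metis
  have "a k \<in> carrier V" for k using a(1)[of k] by (simp add: aut_eigenspace_def)
  then show ?thesis unfolding a(2) using eigen sum a(1) by blast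
qed

lemma tmode_sum_left:
  "w \<in> carrier M \<Longrightarrow> (\<And>i. i \<in> I \<Longrightarrow> a i \<in> carrier V) \<Longrightarrow>
    tmode M (\<Sum>i\<in>I. a i) n w = (\<Sum>i\<in>I. tmode M (a i) n w)"
  using clinear_betw_sum[OF tmode_linear_left carrier_subspace] .

lemma tmode_sum_right:
  "v \<in> carrier V \<Longrightarrow> (\<And>i. i \<in> I \<Longrightarrow> h i \<in> carrier M) \<Longrightarrow>
    tmode M v n (\<Sum>i\<in>I. h i) = (\<Sum>i\<in>I. tmode M v n (h i))"
  using clinear_betw_sum[OF tmode_linear tcarrier_subspace] .

text \<open>Weak commutativity: with \<open>l\<close> so large that $a_{l+i}u = 0$ for all $i \<ge> 0$, the Jacobi identity
  reads $\sum_i (-1)^i \binom{l}{i} u_{n+l-i} a_{p+i} w = 0$ on the relation, which determines the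
  term with the lowest mode of \<open>a\<close> from those with higher modes.\<close>

lemma relation_stable:
  assumes U: "finite I" "\<And>i. i \<in> I \<Longrightarrow> u i \<in> carrier V" "\<And>i. i \<in> I \<Longrightarrow> w i \<in> carrier M"
    and rel: "\<And>n. (\<Sum>i\<in>I. tmode M (u i) n (w i)) = 0"
    and a: "a \<in> carrier V"
  shows "(\<Sum>i\<in>I. tmode M (u i) n (tmode M a p (w i))) = 0"
proof -
  have "\<forall>n p. (\<Sum>i\<in>I. tmode M (u i) n (tmode M a p (w i))) = 0"
    using a
  proof (induction rule: eigenvector_induct)
    case (eigen k a)
    note a = eigen
    define Z where "Z n p = (\<Sum>i\<in>I. tmode M (u i) n (tmode M a p (w i)))" for n p
    \<comment> \<open>Finiteness of \<open>I\<close> yields one truncation bound for all indices.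
      The inserted 0 keeps \<open>Max\<close> meaningful when \<open>I\<close> is empty.\<close>
    have "\<exists>K. \<forall>i\<in>I. \<forall>p\<ge>K. tmode M a p (w i) = 0"
    proof -
      have "\<forall>i\<in>I. \<exists>K. \<forall>p\<ge>K. tmode M a p (w i) = 0" using ttruncation a U by blast
      then obtain K where K: "\<forall>i\<in>I. \<forall>p\<ge>K i. tmode M a p (w i) = 0" by metis
      have "K i \<le> Max (insert 0 (K ` I))" if "i \<in> I" for i using that U(1) by auto
      then show ?thesis using K by (meson order_trans)
    qed
    then obtain K where K: "\<And>i p. i \<in> I \<Longrightarrow> p \<ge> K \<Longrightarrow> tmode M a p (w i) = 0" by blast
    have "\<exists>L. \<forall>i\<in>I. \<forall>l\<ge>L. vmode V a l (u i) = 0"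
    proof -
      have "\<forall>i\<in>I. \<exists>K. \<forall>l\<ge>K. vmode V a l (u i) = 0" using truncation a U by blast
      then obtain K where K: "\<forall>i\<in>I. \<forall>l\<ge>K i. vmode V a l (u i) = 0" by metis
      have "K i \<le> Max (insert 0 (K ` I))" if "i \<in> I" for i using that U(1) by auto
      then show ?thesis using K by (meson order_trans)
    qed
    then obtain L0 where L0: "\<And>i l. i \<in> I \<Longrightarrow> l \<ge> L0 \<Longrightarrow> vmode V a l (u i) = 0" by blast
    define L where "L = nat L0"
    have L: "vmode V a (int L + int j) (u i) = 0" if "i \<in> I" for i j
      using L0[OF that, of "int L + int j"] by (simp add: L_def)
    have gc: "(of_int (int L) :: complex) gchoose i = of_nat (L choose i)" for i
      by (simp add: binomial_gbinomial)
    \<comment> \<open>For a natural number in place of \<open>l\<close> the binomials vanish beyond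
      \<open>L\<close>, so both formal sums on the left of the Jacobi identity stop at
      \<open>L\<close>.\<close>
    have fin: "Sum_any (\<lambda>i. f i) = (\<Sum>i\<le>L. f i)"
      if "\<And>i. i > L \<Longrightarrow> f i = 0" for f :: "nat \<Rightarrow> 'm"
      by (rule Sum_any.expand_superset, simp, rule subsetI, rule ccontr) (use that in auto)
    have step: "(\<Sum>j\<le>L. ((-1) ^ j * of_nat (L choose j)) *\<^sub>C Z (n + of_nat L - of_nat j) (p + of_nat j)) = 0"
      if p: "p - of_int (int k) / of_nat (aut_order V g) \<in> \<int>" for n p
    proof -
      have "(\<Sum>j\<le>L. ((-1) ^ j * of_nat (L choose j)) *\<^sub>C
              tmode M a (p + of_nat L - of_nat j) (tmode M (u i) (n + of_nat j) (w i)))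
          - (\<Sum>j\<le>L. ((-1) ^ L * (-1) ^ j * of_nat (L choose j)) *\<^sub>C
              tmode M (u i) (n + of_nat L - of_nat j) (tmode M a (p + of_nat j) (w i))) = 0"
        (is "?A i - ?B i = 0") if i: "i \<in> I" for i
        using tjacobi[OF a(1) U(2)[OF i] U(3)[OF i] p, of "int L" n]
        by (simp only: gc L[OF i] tmode_zero_left[OF U(3)[OF i]])
           (simp add: fin binomial_eq_0)
      then have "?A i = ?B i" if "i \<in> I" for i using that by (simp only: right_minus_eq)
      then have "(\<Sum>i\<in>I. ?A i) = (\<Sum>i\<in>I. ?B i)" by (rule sum.cong[OF refl])
      \<comment> \<open>In these terms the mode of \<open>a\<close> acts last and can be pulled out
        of the sum over \<open>I\<close>; what remains inside is the given relation.\<close>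
      moreover have "(\<Sum>i\<in>I. ?A i) = 0"
      proof -
        have "(\<Sum>i\<in>I. ?A i) = (\<Sum>j\<le>L. ((-1) ^ j * of_nat (L choose j)) *\<^sub>C
            tmode M a (p + of_nat L - of_nat j) (\<Sum>i\<in>I. tmode M (u i) (n + of_nat j) (w i)))"
          by (subst sum.swap) (simp add: tmode_sum_right[OF a(2)] U tmode_closed complex_vector.scale_sum_right)
        then show ?thesis by (simp add: rel tmode_zero_right[OF a(2)])
      qed
      moreover have "(\<Sum>i\<in>I. ?B i) = (-1) ^ L *\<^sub>C
          (\<Sum>j\<le>L. ((-1) ^ j * of_nat (L choose j)) *\<^sub>C Z (n + of_nat L - of_nat j) (p + of_nat j))"
        by (subst sum.swap) (simp add: Z_def complex_vector.scale_sum_right scaleC_scaleC mult.assoc)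
      ultimately show ?thesis by simp
    qed
    have Z: "Z n p = 0" for n p
    proof (cases "p - of_int (int k) / of_nat (aut_order V g) \<in> \<int>")
      case False
      have "tmode M a p (w i) = 0" if "i \<in> I" for i
        using tmode_support_eigen[OF a(1) U(3)[OF that] False] .
      then show ?thesis using U by (simp add: Z_def tmode_zero_right)
    next
      case True
      \<comment> \<open>Induction on the distance of \<open>p\<close> below the truncation bound
        \<open>K\<close>, within the coset k/N + Z. Replacing \<open>n\<close> by n - L in
        \<open>step\<close> makes Z n p the term with j = 0; all other terms have larger
        \<open>p\<close> and vanish by induction.\<close>
      have "\<forall>n. \<forall>p. p + of_nat d \<ge> K \<longrightarrow> p - of_int (int k) / of_nat (aut_order V g) \<in> \<int> \<longrightarrow> Z n p = 0" for d
      proof (induction d)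
        case 0
        then show ?case using K U by (simp add: Z_def tmode_zero_right)
      next
        case (Suc d)
        show ?case
        proof (intro allI impI)
          fix n p
          assume p: "p + of_nat (Suc d) \<ge> K" "p - of_int (int k) / of_nat (aut_order V g) \<in> \<int>"
          have "Z (n - of_nat L + of_nat L - of_nat j) (p + of_nat j) = 0" if "j > 0" for j
          proof -
            have "p + of_nat j - of_int (int k) / of_nat (aut_order V g) \<in> \<int>"
              using Ints_add[OF p(2) Ints_of_nat[of j]] by (simp add: algebra_simps)
            moreover have "p + of_nat j + of_nat d \<ge> K"
              using p(1) that by (cases j) auto
            ultimately show ?thesis using Suc by blast
          qed
          then have "(\<Sum>j\<le>L. ((-1) ^ j * of_nat (L choose j)) *\<^sub>C
              Z (n - of_nat L + of_nat L - of_nat j) (p + of_nat j)) = Z n p"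
            by (subst sum.remove[of _ 0]) (auto simp: scaleC_one)
          with step[OF p(2), of "n - of_nat L"] show "Z n p = 0" by simp
        qed
      qed
      moreover obtain d :: nat where "p + of_nat d \<ge> K"
      proof -
        have "\<exists>d::nat. K - p \<le> of_nat d" by (rule real_arch_simple)
        then show ?thesis using that by (auto simp: algebra_simps)
      qed
      ultimately show ?thesis using True by blast
    qed
    then show ?case by (simp add: Z_def)
  next
    case (sum a N)
    then show ?case
      by (simp add: tmode_sum_left tmode_sum_right U tmode_closed sum.swap[of _ "{..<N}"])
  qed
  then show ?thesis by blast
qed

text \<open>If \<open>u\<close> acts by zero, the left-hand side of the Jacobi identity for
  \<open>a\<close> and \<open>u\<close> vanishes. The right-hand side is a sum over the vectors
  \<open>vmode V a (l + int j) u\<close>, and descending induction on \<open>l\<close> leaves only j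
  = 0, whose binomial is 1.\<close>

lemma annihilator_stable:
  assumes u: "u \<in> carrier V" "\<And>n w. w \<in> carrier M \<Longrightarrow> tmode M u n w = 0"
    and a: "a \<in> carrier V" and w: "w \<in> carrier M"
  shows "tmode M (vmode V a l u) n w = 0"
proof -
  have "\<forall>l n. tmode M (vmode V a l u) n w = 0"
    using a
  proof (induction rule: eigenvector_induct)
    case (eigen k a)
    note a = eigen
    obtain K where K: "\<And>l. l \<ge> K \<Longrightarrow> vmode V a l u = 0" using truncation[OF a(2) u(1)] by blast
    have closed: "vmode V a l u \<in> carrier V" for l using a(2) u(1) by (rule mode_closed)
    have "\<forall>l n. l + int d \<ge> K \<longrightarrow> tmode M (vmode V a l u) n w = 0" for d
    proof (induction d)
      case 0
      then show ?case using K w by (simp add: tmode_zero_left)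
    next
      case (Suc d)
      show ?case
      proof (intro allI impI)
        fix l n
        assume l: "l + int (Suc d) \<ge> K"
        \<comment> \<open>A representative of the coset in which the modes of \<open>a\<close> live.
          Pairing it with n - p makes the total mode index on the right equal to
          \<open>n\<close>.\<close>
        define p where "p = (of_nat k / of_nat (aut_order V g) :: rat)"
        have p: "p - of_int (int k) / of_nat (aut_order V g) \<in> \<int>" by (simp add: p_def)
        have z: "tmode M (vmode V a (l + int j) u) q w = 0" if "j > 0" for j q
          using Suc l that by (cases j) auto
        have "(\<Sum>j::nat. (of_rat p gchoose j) *\<^sub>C
              tmode M (vmode V a (l + int j) u) (p + (n - p) - of_nat j) w) = 0"
          using tjacobi[OF a(1) u(1) w p, of l "n - p"] u(2) w a(2)
          by (simp add: tmode_closed tmode_zero_right)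
        moreover have "(\<Sum>j::nat. (of_rat p gchoose j) *\<^sub>C
              tmode M (vmode V a (l + int j) u) (p + (n - p) - of_nat j) w)
            = (\<Sum>j\<in>{0::nat}. (of_rat p gchoose j) *\<^sub>C
              tmode M (vmode V a (l + int j) u) (p + (n - p) - of_nat j) w)"
          by (rule Sum_any.expand_superset) (use z in force)+
        ultimately show "tmode M (vmode V a l u) n w = 0" by (simp add: scaleC_one)
      qed
    qed
    moreover have "l + int (nat (K - l)) \<ge> K" for l by simp
    ultimately show ?case by blast
  next
    case (sum a N)
    have "vmode V (\<Sum>k<N. a k) l u = (\<Sum>k<N. vmode V (a k) l u)" for l
      using clinear_betw_sum[OF mode_linear_left[OF u(1)] carrier_subspace, of "{..<N}" a] sum(1) by simp
    then show ?case using sum u(1) w by (simp add: tmode_sum_left mode_closed)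
  qed
  then show ?thesis by blast
qed

text \<open>\<open>L(0)\<close> acts on each summand of the grading by a different scalar.\<close>

lemma tgrade_eq: "tgrade M s = {w \<in> carrier M. tvir V M 0 w = s *\<^sub>C w}"
proof (rule subset_antisym; rule subsetI)
  have sub: "csubspace (tgrade M r)" "tgrade M r \<subseteq> carrier M" for r
    using tgrading by (auto simp: direct_sum_of_def)
  fix w assume "w \<in> tgrade M s"
  then show "w \<in> {w \<in> carrier M. tvir V M 0 w = s *\<^sub>C w}"
    using sub tgrade_eigen by blast
next
  have sub: "csubspace (tgrade M r)" "tgrade M r \<subseteq> carrier M" for r
    using tgrading by (auto simp: direct_sum_of_def)
  fix w assume w: "w \<in> {w \<in> carrier M. tvir V M 0 w = s *\<^sub>C w}"
  obtain c where c: "\<And>r. c r \<in> tgrade M r" "finite {r. c r \<noteq> 0}" "w = Sum_any c"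
    using tgrading w unfolding direct_sum_of_def by blast
  define F where "F = {r. c r \<noteq> 0}"
  have wF: "w = (\<Sum>r\<in>F. c r)" using c(3) by (simp add: Sum_any.expand_set F_def)
  have cM: "c r \<in> carrier M" for r using c(1) sub by blast
  have "tvir V M 0 w = (\<Sum>r\<in>F. r *\<^sub>C c r)"
    using tgrade_eigen[OF c(1)] tmode_sum_right[OF conf_closed, of F c 1] cM unfolding wF tvir_def by simp
  also have "tvir V M 0 w = (\<Sum>r\<in>F. s *\<^sub>C c r)"
    using w unfolding wF by (simp add: complex_vector.scale_sum_right)
  finally have eq: "(\<Sum>r\<in>F. s *\<^sub>C c r) = (\<Sum>r\<in>F. r *\<^sub>C c r)" .
  \<comment> \<open>Both \<open>d\<close> and \<open>e\<close> decompose the same vector L(0)w = sw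
    into graded pieces. Uniqueness forces s c_r = r c_r, so only the component at \<open>s\<close>
    can be nonzero.\<close>
  define d where "d r = s *\<^sub>C c r" for r
  define e where "e r = r *\<^sub>C c r" for r
  have supp: "{r. d r \<noteq> 0} \<subseteq> F" "{r. e r \<noteq> 0} \<subseteq> F" by (auto simp: d_def e_def F_def)
  have F: "finite F" using c(2) by (simp add: F_def)
  have sums: "Sum_any d = (\<Sum>r\<in>F. d r)" "Sum_any e = (\<Sum>r\<in>F. e r)"
    using supp F by (auto intro: Sum_any.expand_superset)
  have de: "\<forall>r. d r \<in> tgrade M r" "\<forall>r. e r \<in> tgrade M r"
    using c(1) sub(1) by (auto simp: d_def e_def complex_vector.subspace_scale)
  have "Sum_any d \<in> carrier M"
    unfolding sums using de sub(2) by (intro complex_vector.subspace_sum[OF tcarrier_subspace]) blast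
  then have "\<exists>!c. (\<forall>r. c r \<in> tgrade M r) \<and> finite {r. c r \<noteq> 0} \<and> Sum_any d = Sum_any c"
    using tgrading unfolding direct_sum_of_def by blast
  moreover have "finite {r. d r \<noteq> 0}" "finite {r. e r \<noteq> 0}"
    using supp F finite_subset by blast+
  moreover have "Sum_any d = Sum_any e" using eq unfolding sums d_def[symmetric] e_def[symmetric] .
  ultimately have "d = e" using de by blast
  have "r = s" if "r \<in> F" for r
    using that fun_cong[OF \<open>d = e\<close>, of r] by (auto simp: d_def e_def F_def)
  then have "F = {} \<or> F = {s}" by blast
  then have "w = (\<Sum>r\<in>{s}. c r)" using wF c(2) F_def by (auto simp: F_def)
  then show "w \<in> tgrade M s" using c(1) by simp
qed

end

section \<open>Consequences of simplicity: Schur's lemma and injectivity of vertex operators\<close>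

locale simple_twisted_module_simple_voa = simple_voa V + simple_twisted_module V g M
  for V :: "'v::complex_vector voa" and g and M :: "('v, 'm::complex_vector) tmodule"

context simple_twisted_module
begin

text \<open>An endomorphism commutes with L(0) and so preserves its eigenspaces, which are
  finite-dimensional graded pieces of \<open>M\<close>. A nonzero one contains an eigenvector of
  \<open>T\<close>, and the full eigenspace of \<open>T\<close> for that eigenvalue is a nonzero
  submodule.\<close>

lemma schur:
  assumes T: "clinear_betw (carrier M) (carrier M) T"
    and comm: "\<And>v n w. v \<in> carrier V \<Longrightarrow> w \<in> carrier M \<Longrightarrow> T (tmode M v n w) = tmode M v n (T w)"
  obtains c where "\<And>w. w \<in> carrier M \<Longrightarrow> T w = c *\<^sub>C w"
proof -
  note sub = tcarrier_subspace
  have "\<exists>s. tgrade M s \<noteq> {0}"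
  proof (rule ccontr)
    assume *: "\<not> ?thesis"
    have "w = 0" if "w \<in> carrier M" for w
    proof -
      obtain c where c: "\<And>r. c r \<in> tgrade M r" "w = Sum_any c"
        using tgrading \<open>w \<in> carrier M\<close> unfolding direct_sum_of_def by blast
      have "c r = 0" for r using c(1)[of r] * by auto
      then show ?thesis using c(2) by simp
    qed
    then have "carrier M = {0}" using complex_vector.subspace_0[OF sub] by blast
    then show False using tnonzero by blast
  qed
  then obtain s where s: "tgrade M s \<noteq> {0}" by blast
  have "clinear_betw (tgrade M s) (tgrade M s) T"
    using T comm[OF conf_closed, symmetric] by (auto simp: clinear_betw_def tgrade_eq tvir_def)
  then obtain x c where x: "x \<in> tgrade M s" "x \<noteq> 0" "T x = c *\<^sub>C x"
    using finite_dim_eigenvector[OF tgrade_finite_dim s] by blast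
  define U where "U = {w \<in> carrier M. T w = c *\<^sub>C w}"
  have "U = {0} \<or> U = carrier M"
  proof (rule tirreducible)
    show "csubspace U"
      using sub clinear_betw_zero[OF T sub]
      by (auto simp: U_def complex_vector.subspace_def clinear_betw_add[OF T] clinear_betw_scale[OF T]
          scaleC_add_right scaleC_scaleC mult.commute)
    show "tmode M v n w \<in> U" if "v \<in> carrier V" "w \<in> U" for v n w
      using that clinear_betw_scale[OF tmode_linear] by (simp add: U_def tmode_closed comm)
  qed (auto simp: U_def)
  moreover have "x \<in> U" using x by (simp add: U_def tgrade_eq)
  ultimately have "U = carrier M" using x(2) by blast
  then show ?thesis using that by (auto simp: U_def)
qed

end

context simple_twisted_module_simple_voa
begin

text \<open>The vectors of \<open>V\<close> acting by zero form an ideal. It misses the vacuum,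
  whose mode -1 is the identity on the nonzero space \<open>M\<close>, so simplicity of
  \<open>V\<close> leaves only 0.\<close>

lemma tmode_faithful:
  assumes u: "u \<in> carrier V" and "\<And>n w. w \<in> carrier M \<Longrightarrow> tmode M u n w = 0"
  shows "u = 0"
proof -
  define A where "A = {u \<in> carrier V. \<forall>n. \<forall>w\<in>carrier M. tmode M u n w = 0}"
  have "A = {0} \<or> A = carrier V"
  proof (rule irreducible)
    show "csubspace A"
      using carrier_subspace
      by (auto simp: A_def complex_vector.subspace_def tmode_zero_left
          clinear_betw_add[OF tmode_linear_left] clinear_betw_scale[OF tmode_linear_left])
    show "vmode V v n x \<in> A" if "v \<in> carrier V" "x \<in> A" for v n x
      using that annihilator_stable[of x v] by (auto simp: A_def mode_closed)
  qed (auto simp: A_def)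
  moreover have "vac V \<notin> A"
  proof
    assume *: "vac V \<in> A"
    have "w = 0" if "w \<in> carrier M" for w
      using * that tvac_mode[OF that, of "-1"] by (simp add: A_def)
    then show False using tnonzero complex_vector.subspace_0[OF tcarrier_subspace] by blast
  qed
  ultimately have "A = {0}" using vac_closed by blast
  then show ?thesis using assms by (auto simp: A_def)
qed

text \<open>The map $V \otimes M \to M((z))$ is injective. In the induction step the relations
  form a \<open>V\<close>-submodule of a power of \<open>M\<close>, which by the induction hypothesis is the graph of
  module endomorphisms, that is of scalars by Schur's lemma.\<close>

lemma relation_trivial:
  assumes "finite B" "B \<subseteq> carrier V" "complex_vector.independent B"
    and "\<And>u. u \<in> B \<Longrightarrow> w u \<in> carrier M"
    and "\<And>n. (\<Sum>u\<in>B. tmode M u n (w u)) = 0" and "u \<in> B"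
  shows "w u = 0"
  using assms
proof (induction B arbitrary: w u rule: finite_induct)
  case empty
  then show ?case by simp
next
  case (insert u0 B)
  have B: "u0 \<in> carrier V" "B \<subseteq> carrier V" using insert.prems by auto
  have indep: "complex_vector.independent B" "u0 \<notin> cspan B"
    using insert.prems(2) insert.hyps complex_vector.independent_insert[of u0 B] by auto
  note sub = tcarrier_subspace
  define X where "X = {w. (\<forall>u\<in>insert u0 B. w u \<in> carrier M) \<and> (\<forall>u. u \<notin> insert u0 B \<longrightarrow> w u = 0) \<and>
    (\<forall>n. (\<Sum>u\<in>insert u0 B. tmode M u n (w u)) = 0)}"
  have X_add: "(\<lambda>u. w u + w' u) \<in> X" if "w \<in> X" "w' \<in> X" for w w'
  proof -
    have "(\<Sum>u\<in>insert u0 B. tmode M u n (w u + w' u)) =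
        (\<Sum>u\<in>insert u0 B. tmode M u n (w u)) + (\<Sum>u\<in>insert u0 B. tmode M u n (w' u))" for n
      unfolding sum.distrib[symmetric]
      by (rule sum.cong) (use that insert.prems(1) in \<open>auto simp: X_def intro!: clinear_betw_add[OF tmode_linear]\<close>)
    then show ?thesis using that by (auto simp: X_def complex_vector.subspace_add[OF sub])
  qed
  have X_scale: "(\<lambda>u. c *\<^sub>C w u) \<in> X" if "w \<in> X" for w c
  proof -
    have "(\<Sum>u\<in>insert u0 B. tmode M u n (c *\<^sub>C w u)) = c *\<^sub>C (\<Sum>u\<in>insert u0 B. tmode M u n (w u))" for n
      unfolding complex_vector.scale_sum_right
      by (rule sum.cong) (use that insert.prems(1) in \<open>auto simp: X_def intro!: clinear_betw_scale[OF tmode_linear]\<close>)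
    then show ?thesis using that by (auto simp: X_def complex_vector.subspace_scale[OF sub])
  qed
  have X_mode: "(\<lambda>u. tmode M a p (w u)) \<in> X" if "w \<in> X" "a \<in> carrier V" for w a p
    using that relation_stable[of "insert u0 B" "\<lambda>u. u" w a] insert.hyps insert.prems(1)
    by (auto simp: X_def tmode_closed tmode_zero_right)
  \<comment> \<open>With zero at \<open>u0\<close>, the remaining coordinates solve a relation over
    \<open>B\<close>, which is trivial by the induction hypothesis. The coordinate at
    \<open>u0\<close> therefore determines a solution.\<close>
  have X_zero: "w = (\<lambda>_. 0)" if "w \<in> X" "w u0 = 0" for w
  proof
    fix u
    have "(\<Sum>u\<in>B. tmode M u n (w u)) = 0" for n
      using that insert.hyps B by (auto simp: X_def tmode_zero_right)
    then have "u \<in> B \<Longrightarrow> w u = 0"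
      using insert.IH[OF B(2) indep(1), of w u] that by (auto simp: X_def)
    then show "w u = 0"
      using that by (cases "u = u0"; cases "u \<in> B") (auto simp: X_def)
  qed
  have X_unique: "w = w'" if "w \<in> X" "w' \<in> X" "w u0 = w' u0" for w w'
  proof -
    have "(\<lambda>u. w u - w' u) \<in> X"
      using X_add[OF that(1) X_scale[OF that(2), of "-1"]]
      by (simp add: complex_vector.scale_minus_left scaleC_one)
    from X_zero[OF this] that(3) show ?thesis by (auto simp: fun_eq_iff)
  qed
  define P where "P = (\<lambda>w. w u0) ` X"
  have "P = {0} \<or> P = carrier M"
  proof (rule tirreducible)
    have "(\<lambda>_. 0) \<in> X"
      using insert.prems(1)
      by (auto simp: X_def complex_vector.subspace_0[OF sub] tmode_zero_right intro!: sum.neutral)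
    then have "0 \<in> P" unfolding P_def by (metis image_eqI)
    moreover have "x + y \<in> P" if "x \<in> P" "y \<in> P" for x y
    proof -
      from that obtain w w' where "w \<in> X" "x = w u0" "w' \<in> X" "y = w' u0" by (auto simp: P_def)
      then show ?thesis using imageI[OF X_add, of w w' "\<lambda>w. w u0"] by (simp add: P_def)
    qed
    moreover have "c *\<^sub>C x \<in> P" if "x \<in> P" for x c
    proof -
      from that obtain w where "w \<in> X" "x = w u0" by (auto simp: P_def)
      then show ?thesis using imageI[OF X_scale, of w "\<lambda>w. w u0"] by (simp add: P_def)
    qed
    ultimately show "csubspace P" by (simp add: complex_vector.subspace_def)
    show "P \<subseteq> carrier M" by (auto simp: P_def X_def)
    show "tmode M v n x \<in> P" if "v \<in> carrier V" "x \<in> P" for v n x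
    proof -
      from that obtain w where "w \<in> X" "x = w u0" by (auto simp: P_def)
      then show ?thesis using imageI[OF X_mode, of w v "\<lambda>w. w u0"] that(1) by (simp add: P_def)
    qed
  qed
  \<comment> \<open>Otherwise every vector of \<open>M\<close> is the \<open>u0\<close>-coordinate
    of exactly one solution. This gives the map \<open>T\<close> whose other coordinates are module
    endomorphisms.\<close>
  moreover have "P \<noteq> carrier M"
  proof
    assume P: "P = carrier M"
    have "\<forall>m\<in>carrier M. \<exists>w. w \<in> X \<and> w u0 = m" using P unfolding P_def by (metis (no_types, lifting) imageE)
    then obtain T where T: "\<And>m. m \<in> carrier M \<Longrightarrow> T m \<in> X \<and> T m u0 = m" by metis
    have T_eq: "T m = w" if "w \<in> X" "w u0 = m" "m \<in> carrier M" for w m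
      using X_unique[of "T m" w] T that by simp
    have T_add: "T (x + y) = (\<lambda>u. T x u + T y u)" if "x \<in> carrier M" "y \<in> carrier M" for x y
      using that T by (intro T_eq X_add) (auto simp: complex_vector.subspace_add[OF sub])
    have T_scale: "T (c *\<^sub>C x) = (\<lambda>u. c *\<^sub>C T x u)" if "x \<in> carrier M" for x c
      using that T by (intro T_eq X_scale) (auto simp: complex_vector.subspace_scale[OF sub])
    have T_mode: "T (tmode M a p x) = (\<lambda>u. tmode M a p (T x u))" if "x \<in> carrier M" "a \<in> carrier V" for x a p
      using that T by (intro T_eq X_mode) (auto simp: tmode_closed)
    have "\<exists>c. \<forall>m\<in>carrier M. T m u = c *\<^sub>C m" if u: "u \<in> B" for u
    proof -
      have "clinear_betw (carrier M) (carrier M) (\<lambda>m. T m u)"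
        using T u by (auto simp: clinear_betw_def T_add T_scale X_def)
      then show ?thesis
        using schur[of "\<lambda>m. T m u"] T_mode by (metis (no_types, lifting))
    qed
    then obtain c where c: "\<And>u m. u \<in> B \<Longrightarrow> m \<in> carrier M \<Longrightarrow> T m u = c u *\<^sub>C m" by metis
    \<comment> \<open>With the scalars from Schur's lemma the relation says that this one vector of
      \<open>V\<close> acts by zero on all of \<open>M\<close>. Hence it is 0, which would put
      \<open>u0\<close> in the span of \<open>B\<close>.\<close>
    define b where "b = u0 + (\<Sum>u\<in>B. c u *\<^sub>C u)"
    have cu: "c u *\<^sub>C u \<in> carrier V" if "u \<in> B" for u
      using that B(2) complex_vector.subspace_scale[OF carrier_subspace] by blast
    have sV: "(\<Sum>u\<in>B. c u *\<^sub>C u) \<in> carrier V"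
      using cu by (rule complex_vector.subspace_sum[OF carrier_subspace])
    have "tmode M b n m = 0" if m: "m \<in> carrier M" for n m
    proof -
      have "tmode M b n m = tmode M u0 n m + (\<Sum>u\<in>B. c u *\<^sub>C tmode M u n m)"
        unfolding b_def using m B sV cu
        by (simp add: clinear_betw_add[OF tmode_linear_left] tmode_sum_left subset_eq
            clinear_betw_scale[OF tmode_linear_left])
      also have "\<dots> = tmode M u0 n (T m u0) + (\<Sum>u\<in>B. tmode M u n (T m u))"
        using T[OF m] m B by (simp add: c subset_eq clinear_betw_scale[OF tmode_linear])
      also have "\<dots> = 0" using conjunct1[OF T[OF m]] insert.hyps by (simp add: X_def)
      finally show ?thesis .
    qed
    then have "b = 0"
      using tmode_faithful[of b] B(1) sV complex_vector.subspace_add[OF carrier_subspace] by (simp add: b_def)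
    then have "u0 = (\<Sum>u\<in>B. (- c u) *\<^sub>C u)"
      by (simp add: b_def complex_vector.scale_minus_left sum_negf eq_neg_iff_add_eq_0)
    moreover have "(\<Sum>u\<in>B. (- c u) *\<^sub>C u) \<in> cspan B"
      by (intro complex_vector.span_sum complex_vector.span_scale complex_vector.span_base)
    ultimately show False using indep(2) by simp
  qed
  ultimately have P0: "P = {0}" by blast
  \<comment> \<open>The given solution is unconstrained outside \<open>insert u0 B\<close>; cutting
    it off there makes it an element of \<open>X\<close>.\<close>
  define w' where "w' u = (if u \<in> insert u0 B then w u else 0)" for u
  have "w' \<in> X" using insert.prems(3,4) by (simp add: X_def w'_def insert.hyps cong: sum.cong)
  then have "w' = (\<lambda>_. 0)" using X_zero[of w'] P0 by (auto simp: P_def)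
  then show ?case using insert.prems(5) by (auto simp: w'_def fun_eq_iff split: if_splits)
qed

text \<open>By injectivity of V \<otimes> M \<rightarrow> M((z)) the tensor sum_i u_i \<otimes> w_i
  is zero, and the claim is its image under f \<otimes> id. Tensors are avoided by expanding the
  \<open>u i\<close> in a basis \<open>B\<close> of their span: \<open>y b\<close> is the
  coefficient of \<open>b\<close>, and the relation becomes one over independent vectors.\<close>

lemma relation_functional:
  assumes I: "finite I" "\<And>i. i \<in> I \<Longrightarrow> u i \<in> carrier V" "\<And>i. i \<in> I \<Longrightarrow> w i \<in> carrier M"
    and rel: "\<And>n. (\<Sum>i\<in>I. tmode M (u i) n (w i)) = 0" and f: "cfunctional f"
  shows "(\<Sum>i\<in>I. f (u i) *\<^sub>C w i) = 0"
proof -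
  obtain B where B: "B \<subseteq> u ` I" "complex_vector.independent B" "u ` I \<subseteq> cspan B"
    using complex_vector.basis_exists[of "u ` I"] by metis
  have finB: "finite B" using B(1) I(1) by (meson finite_imageI finite_subset)
  have BV: "B \<subseteq> carrier V" using B(1) I(2) by blast
  define r where "r i b = complex_vector.representation B (u i) b" for i b
  have r: "u i = (\<Sum>b\<in>B. r i b *\<^sub>C b)" if "i \<in> I" for i
    using complex_vector.sum_representation_eq[OF B(2), of "u i" B] B(3) that finB by (auto simp: r_def)
  define y where "y b = (\<Sum>i\<in>I. r i b *\<^sub>C w i)" for b
  have "tmode M (u i) n (w i) = (\<Sum>b\<in>B. r i b *\<^sub>C tmode M b n (w i))" if i: "i \<in> I" for i n
    using BV I(3)[OF i] unfolding r[OF i]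
    by (subst tmode_sum_left)
      (auto simp: subset_eq complex_vector.subspace_scale[OF carrier_subspace]
        clinear_betw_scale[OF tmode_linear_left] intro!: sum.cong)
  then have "(\<Sum>i\<in>I. tmode M (u i) n (w i)) = (\<Sum>b\<in>B. \<Sum>i\<in>I. r i b *\<^sub>C tmode M b n (w i))" for n
    by (simp add: sum.swap[of _ B])
  moreover have "tmode M b n (y b) = (\<Sum>i\<in>I. r i b *\<^sub>C tmode M b n (w i))" if "b \<in> B" for b n
    using BV I(3) that unfolding y_def
    by (subst tmode_sum_right)
      (auto simp: subset_eq complex_vector.subspace_scale[OF tcarrier_subspace]
        clinear_betw_scale[OF tmode_linear] intro!: sum.cong)
  ultimately have "(\<Sum>b\<in>B. tmode M b n (y b)) = 0" for n
    using rel[of n] by simp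
  moreover have "y b \<in> carrier M" for b
    unfolding y_def using I(3)
    by (intro complex_vector.subspace_sum[OF tcarrier_subspace] complex_vector.subspace_scale[OF tcarrier_subspace])
  ultimately have y0: "y b = 0" if "b \<in> B" for b
    using relation_trivial[OF finB BV B(2), of y b] that by blast
  have "(\<Sum>i\<in>I. f (u i) *\<^sub>C w i) = (\<Sum>i\<in>I. \<Sum>b\<in>B. f b *\<^sub>C r i b *\<^sub>C w i)"
    by (intro sum.cong refl, subst r)
      (simp_all add: cfunctional_sum[OF f] cfunctional_scale[OF f] complex_vector.scale_sum_left scaleC_scaleC mult.commute)
  also have "\<dots> = (\<Sum>b\<in>B. f b *\<^sub>C y b)"
    by (subst sum.swap) (simp add: y_def complex_vector.scale_sum_right)
  also have "\<dots> = 0" by (simp add: y0)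
  finally show ?thesis .
qed

text \<open>Dedekind's argument: by the injectivity above the relations between the \<open>\<psi> i\<close> are
  stable under multiplication of the coefficients by $f(\sigma_i v)$, and these functions separate
  the indices.\<close>

lemma twisted_intertwiners_independent:
  assumes "finite I"
    and C: "\<And>v n m. v \<in> carrier V \<Longrightarrow> m \<in> C \<Longrightarrow> act v n m \<in> C"
    and \<sigma>: "\<And>i v. i \<in> I \<Longrightarrow> v \<in> carrier V \<Longrightarrow> \<sigma> i v \<in> carrier V"
    and inj: "\<And>i j. i \<in> I \<Longrightarrow> j \<in> I \<Longrightarrow> (\<And>v. v \<in> carrier V \<Longrightarrow> \<sigma> i v = \<sigma> j v) \<Longrightarrow> i = j"
    and \<psi>: "\<And>i m. i \<in> I \<Longrightarrow> m \<in> C \<Longrightarrow> \<psi> i m \<in> carrier M"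
    and inter: "\<And>i v n m. i \<in> I \<Longrightarrow> v \<in> carrier V \<Longrightarrow> m \<in> C \<Longrightarrow>
      \<psi> i (act v n m) = tmode M (\<sigma> i v) n (\<psi> i m)"
    and nz: "\<And>i. i \<in> I \<Longrightarrow> \<exists>m\<in>C. \<psi> i m \<noteq> 0"
    and rel: "\<And>m. m \<in> C \<Longrightarrow> (\<Sum>i\<in>I. c i *\<^sub>C \<psi> i m) = 0"
    and i: "i \<in> I"
  shows "c i = 0"
proof -
  have "\<forall>c. (\<forall>m\<in>C. (\<Sum>i\<in>J. c i *\<^sub>C \<psi> i m) = 0) \<longrightarrow> (\<forall>i\<in>J. c i = 0)" if "J \<subseteq> I" for J
    using finite_subset[OF that assms(1)] that
  proof (induction J rule: finite_induct)
    case empty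
    then show ?case by simp
  next
    case (insert k J)
    have IJ: "J \<subseteq> I" "k \<in> I" using insert.prems by auto
    show ?case
    proof (intro allI impI)
      fix c assume rel: "\<forall>m\<in>C. (\<Sum>i\<in>insert k J. c i *\<^sub>C \<psi> i m) = 0"
      have cJ: "c i = 0" if i: "i \<in> J" for i
      proof -
        have "i \<noteq> k" "i \<in> I" using insert.hyps i IJ by auto
        then obtain v where v: "v \<in> carrier V" "\<sigma> i v \<noteq> \<sigma> k v" using inj IJ by blast
        obtain f where f: "cfunctional f" "f (\<sigma> i v - \<sigma> k v) \<noteq> 0"
          using cfunctional_nonzero[of "\<sigma> i v - \<sigma> k v"] v by auto
        have "(\<Sum>j\<in>insert k J. f (\<sigma> j v) *\<^sub>C (c j *\<^sub>C \<psi> j m)) = 0" if m: "m \<in> C" for m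
        proof (rule relation_functional)
          fix n
          have "(\<Sum>j\<in>insert k J. tmode M (\<sigma> j v) n (c j *\<^sub>C \<psi> j m))
              = (\<Sum>j\<in>insert k J. c j *\<^sub>C \<psi> j (act v n m))"
            by (rule sum.cong) (use insert.prems m v in \<open>auto simp: inter \<sigma> \<psi> subset_eq clinear_betw_scale[OF tmode_linear]\<close>)
          then show "(\<Sum>j\<in>insert k J. tmode M (\<sigma> j v) n (c j *\<^sub>C \<psi> j m)) = 0"
            using rel C v m by simp
        qed (use insert.hyps insert.prems v m f in \<open>auto intro!: \<sigma> \<psi> complex_vector.subspace_scale[OF tcarrier_subspace]\<close>)
        \<comment> \<open>Subtracting f(\<sigma>_k v) times the original relation cancels the term
          of \<open>k\<close>, so the induction hypothesis for \<open>J\<close> applies. The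
          coefficient at \<open>i\<close> is multiplied by f(\<sigma>_i v) - f(\<sigma>_k v), which
          is nonzero by the choice of \<open>v\<close> and \<open>f\<close>.\<close>
        then have "(\<Sum>j\<in>insert k J. f (\<sigma> j v) *\<^sub>C (c j *\<^sub>C \<psi> j m))
            - f (\<sigma> k v) *\<^sub>C (\<Sum>j\<in>insert k J. c j *\<^sub>C \<psi> j m) = 0" if "m \<in> C" for m
          using that rel by simp
        then have "(\<Sum>j\<in>J. ((f (\<sigma> j v) - f (\<sigma> k v)) * c j) *\<^sub>C \<psi> j m) = 0" if "m \<in> C" for m
          using that insert.hyps
          by (simp add: complex_vector.scale_sum_right scaleC_scaleC scaleC_add_right algebra_simps
              complex_vector.scale_left_diff_distrib sum_subtractf)
        then have "(f (\<sigma> i v) - f (\<sigma> k v)) * c i = 0"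
          using insert.IH[OF IJ(1)] i by fast
        then show ?thesis using f by (simp add: cfunctional_diff)
      qed
      obtain m where m: "m \<in> C" "\<psi> k m \<noteq> 0" using nz IJ by blast
      have "(\<Sum>i\<in>J. c i *\<^sub>C \<psi> i m) = 0" using cJ by simp
      then have "c k *\<^sub>C \<psi> k m = 0"
        using bspec[OF rel m(1)] insert.hyps by simp
      then have "c k = 0" using m(2) by simp
      then show "\<forall>i\<in>insert k J. c i = 0" using cJ by auto
    qed
  qed
  then show ?thesis using rel i by blast
qed

end

section \<open>The twisted quantum double\<close>

lemma sum_fun_apply: "(\<Sum>i\<in>I. h i) x = (\<Sum>i\<in>I. h i x)"
  for h :: "'i \<Rightarrow> 'a \<Rightarrow> 'b::comm_monoid_add"
  by (induction I rule: infinite_finite_induct) simp_all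

lemma scaleC_fun_apply: "(c *\<^sub>C f) x = c *\<^sub>C f x"
  by (simp add: scaleC_fun_def)

lemma conjugate_mult:
  assumes "group K" "a \<in> carrier K" "b \<in> carrier K" "x \<in> carrier K"
  shows "conjugate K (a \<otimes>\<^bsub>K\<^esub> b) x = conjugate K a (conjugate K b x)"
proof -
  interpret group K by fact
  show ?thesis using assms by (simp add: conjugate_def inv_mult_group m_assoc)
qed

lemma conjugate_closed_subgroup:
  assumes "group K" "subgroup G K" "a \<in> G" "x \<in> G"
  shows "conjugate K a x \<in> G"
  using assms by (simp add: conjugate_def subgroup.m_closed subgroup.m_inv_closed)

section \<open>Homomorphisms out of simple modules\<close>

lemma algebra_submodule_range:
  assumes S: "algebra_module A S actS" and W: "algebra_module A W act"
    and F: "clinear_betw S W F"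
    and hom: "\<And>x s. x \<in> carrier A \<Longrightarrow> s \<in> S \<Longrightarrow> F (actS x s) = act x (F s)"
  shows "algebra_submodule A W act (F ` S)"
    and "algebra_submodule A S actS {s \<in> S. F s = 0}"
proof -
  interpret S: algebra_module A S actS by fact
  interpret W: algebra_module A W act by fact
  note F0 = clinear_betw_zero[OF F S.module_subspace]
  have act0: "act x 0 = 0" if "x \<in> carrier A" for x
    using clinear_betw_zero[OF W.act_linear[OF that] W.module_subspace] .
  have cl: "actS x s \<in> S" if "x \<in> carrier A" "s \<in> S" for x s
    using clinear_betw_mem[OF S.act_linear] that .
  have "0 \<in> F ` S"
    using complex_vector.subspace_0[OF S.module_subspace] F0 by (metis imageI)
  moreover have "u + v \<in> F ` S" if uv: "u \<in> F ` S" "v \<in> F ` S" for u v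
  proof -
    from uv obtain s t where "s \<in> S" "u = F s" "t \<in> S" "v = F t" by blast
    then show ?thesis
      using complex_vector.subspace_add[OF S.module_subspace, of s t] clinear_betw_add[OF F, of s t]
      by (metis imageI)
  qed
  moreover have "c *\<^sub>C u \<in> F ` S" if u: "u \<in> F ` S" for u c
  proof -
    from u obtain s where "s \<in> S" "u = F s" by blast
    then show ?thesis
      using complex_vector.subspace_scale[OF S.module_subspace, of s c] clinear_betw_scale[OF F, of s c]
      by (metis imageI)
  qed
  ultimately have "csubspace (F ` S)" by (simp add: complex_vector.subspace_def)
  moreover have "act x u \<in> F ` S" if x: "x \<in> carrier A" and u: "u \<in> F ` S" for x u
  proof -
    from u obtain s where "s \<in> S" "u = F s" by blast
    then show ?thesis using hom[OF x] cl[OF x] by (metis imageI)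
  qed
  ultimately show "algebra_submodule A W act (F ` S)"
    using clinear_betw_mem[OF F] by (auto simp: algebra_submodule_def)
  have "csubspace {s \<in> S. F s = 0}"
    using S.module_subspace F0
    by (auto simp: complex_vector.subspace_def clinear_betw_add[OF F] clinear_betw_scale[OF F])
  then show "algebra_submodule A S actS {s \<in> S. F s = 0}"
    using cl by (auto simp: algebra_submodule_def hom act0)
qed

text \<open>The kernel is a submodule missing \<open>s\<close>, so simplicity makes it zero and
  \<open>F\<close> is an isomorphism onto its image.\<close>

lemma simple_module_embedding:
  assumes S: "simple_algebra_module A S actS" and W: "algebra_module A W act"
    and F: "clinear_betw S W F"
    and hom: "\<And>x s. x \<in> carrier A \<Longrightarrow> s \<in> S \<Longrightarrow> F (actS x s) = act x (F s)"
    and nz: "s \<in> S" "F s \<noteq> 0"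
  shows "algebra_submodule A W act (F ` S) \<and> algebra_module_iso A S actS (F ` S) act F"
proof -
  interpret S: simple_algebra_module A S actS by fact
  note sub = algebra_submodule_range[OF S.algebra_module_axioms W F, OF hom]
  have ker: "{s \<in> S. F s = 0} = {0}"
    using S.module_irreducible[OF sub(2)] nz by blast
  have "inj_on F S"
  proof (rule inj_onI)
    fix s t assume st: "s \<in> S" "t \<in> S" "F s = F t"
    then have "s - t \<in> {s \<in> S. F s = 0}"
      using clinear_betw_diff[OF F S.module_subspace st(1,2)]
        complex_vector.subspace_diff[OF S.module_subspace st(1,2)] by simp
    then show "s = t" unfolding ker by simp
  qed
  then show ?thesis
    using sub(1) F hom by (auto simp: algebra_module_iso_def clinear_iso_def clinear_betw_def bij_betw_def)
qed

text \<open>Isolates what the module theory of \<open>D\<close> takes from the vertex operators: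
  isomorphisms that compose up to the scalars \<alpha>, and their independence. Independence is
  asked for one source \<open>x\<close> and one target \<open>z\<close> at a time, because operators
  with different targets land in different summands and cannot cancel.\<close>

locale projective_family = group K
  for K :: "('g, 'b) monoid_scheme" (structure) +
  fixes G :: "'g set" and C :: "'g \<Rightarrow> 'm::complex_vector set"
    and \<phi> :: "'g \<Rightarrow> 'g \<Rightarrow> 'm \<Rightarrow> 'm" and \<alpha> :: "'g \<Rightarrow> 'g \<Rightarrow> 'g \<Rightarrow> complex"
  assumes subgroup: "subgroup G K" and finite: "finite G"
    and subspace: "g \<in> G \<Longrightarrow> csubspace (C g)"
    and \<phi>_iso: "g \<in> G \<Longrightarrow> h \<in> G \<Longrightarrow> clinear_iso (C g) (C (conjugate K h g)) (\<phi> g h)"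
    and \<alpha>_nonzero: "g \<in> G \<Longrightarrow> h \<in> G \<Longrightarrow> k \<in> G \<Longrightarrow> \<alpha> g h k \<noteq> 0"
    and \<phi>_mult: "g \<in> G \<Longrightarrow> h \<in> G \<Longrightarrow> k \<in> G \<Longrightarrow> m \<in> C g \<Longrightarrow>
      \<phi> g (h \<otimes> k) m = inverse (\<alpha> g h k) *\<^sub>C \<phi> (conjugate K k g) h (\<phi> g k m)"
    and \<phi>_independent: "x \<in> G \<Longrightarrow> z \<in> G \<Longrightarrow>
      \<forall>m\<in>C x. (\<Sum>a | a \<in> G \<and> conjugate K a x = z. c a *\<^sub>C \<phi> x a m) = 0 \<Longrightarrow>
      \<forall>a\<in>G. conjugate K a x = z \<longrightarrow> c a = 0"
    and \<phi>_inv_independent: "x \<in> G \<Longrightarrow> z \<in> G \<Longrightarrow>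
      \<forall>m\<in>C z. (\<Sum>a | a \<in> G \<and> conjugate K a x = z. c a *\<^sub>C inv_into (C x) (\<phi> x a) m) = 0 \<Longrightarrow>
      \<forall>a\<in>G. conjugate K a x = z \<longrightarrow> c a = 0"
begin

definition W :: "('g \<Rightarrow> 'm) set"
  where "W = {f. (\<forall>g\<in>G. f g \<in> C g) \<and> (\<forall>g. g \<notin> G \<longrightarrow> f g = 0)}"

abbreviation "D \<equiv> quantum_double K G \<alpha>"
abbreviation "act \<equiv> qd_action K G \<phi>"
abbreviation "cj \<equiv> conjugate K"
abbreviation "basis \<equiv> \<lambda>(a, x). qd_basis a x"

definition basis_op :: "'g \<times> 'g \<Rightarrow> ('g \<Rightarrow> 'm) \<Rightarrow> 'g \<Rightarrow> 'm"
  where "basis_op = (\<lambda>(a, x) f. summand (cj a x) (\<phi> x a (f x)))"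

text \<open>The product of two basis elements, with the condition that the inverse conjugate of
  \<open>x\<close> by \<open>k\<close> is \<open>y\<close> solved for \<open>x\<close>. In this form
  it says that the target of (k, y) is the source of (a, x).\<close>

definition basis_prod :: "'g \<times> 'g \<Rightarrow> 'g \<times> 'g \<Rightarrow> 'g \<times> 'g \<Rightarrow> complex"
  where "basis_prod = (\<lambda>(a, x) (k, y). if x = cj k y then \<alpha> y a k *\<^sub>C qd_basis (a \<otimes> k) y else 0)"

lemma G_carrier: "g \<in> G \<Longrightarrow> g \<in> carrier K"
  by (rule subgroup.mem_carrier[OF subgroup])

lemma G_one: "\<one> \<in> G" and G_mult: "g \<in> G \<Longrightarrow> h \<in> G \<Longrightarrow> g \<otimes> h \<in> G"
  and G_inv: "g \<in> G \<Longrightarrow> inv g \<in> G"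
  using subgroup by (simp_all add: subgroup.one_closed subgroup.m_closed subgroup.m_inv_closed)

lemma cj_closed: "a \<in> G \<Longrightarrow> x \<in> G \<Longrightarrow> cj a x \<in> G"
  using conjugate_closed_subgroup[OF is_group subgroup] .

lemma cj_mult: "a \<in> G \<Longrightarrow> k \<in> G \<Longrightarrow> x \<in> G \<Longrightarrow> cj (a \<otimes> k) x = cj a (cj k x)"
  using conjugate_mult[OF is_group] G_carrier by blast

lemma cj_one: "x \<in> G \<Longrightarrow> cj \<one> x = x"
  by (simp add: conjugate_def G_carrier)

lemma cj_iff: "k \<in> G \<Longrightarrow> x \<in> G \<Longrightarrow> y \<in> G \<Longrightarrow> inv k \<otimes> x \<otimes> k = y \<longleftrightarrow> x = cj k y"
  by (metis G_carrier G_inv cj_mult cj_one conjugate_def inv_inv l_inv r_inv)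

lemma \<phi>_linear: "g \<in> G \<Longrightarrow> h \<in> G \<Longrightarrow> clinear_betw (C g) (C (cj h g)) (\<phi> g h)"
  and \<phi>_bij: "g \<in> G \<Longrightarrow> h \<in> G \<Longrightarrow> bij_betw (\<phi> g h) (C g) (C (cj h g))"
  using \<phi>_iso by (auto simp: clinear_iso_def)

lemma \<phi>_zero: "g \<in> G \<Longrightarrow> h \<in> G \<Longrightarrow> \<phi> g h 0 = 0"
  using clinear_betw_zero[OF \<phi>_linear subspace] .

lemma subspace_W: "csubspace W"
  by (auto simp: W_def complex_vector.subspace_def complex_vector.subspace_0[OF subspace]
      complex_vector.subspace_add[OF subspace] complex_vector.subspace_scale[OF subspace] scaleC_fun_def)

lemma W_mem: "f \<in> W \<Longrightarrow> g \<in> G \<Longrightarrow> f g \<in> C g"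
  by (simp add: W_def)

lemma summand_W: "g \<in> G \<Longrightarrow> m \<in> C g \<Longrightarrow> summand g m \<in> W"
  by (auto simp: W_def summand_def complex_vector.subspace_0[OF subspace])

lemma basis_op_linear: "p \<in> G \<times> G \<Longrightarrow> clinear_betw W W (basis_op p)"
  by (auto simp: clinear_betw_def basis_op_def W_mem clinear_betw_add[OF \<phi>_linear] clinear_betw_scale[OF \<phi>_linear]
      scaleC_fun_def fun_eq_iff summand_def cj_closed
      intro!: summand_W[unfolded summand_def] clinear_betw_mem[OF \<phi>_linear])

lemma act_eq: "act d f = (\<Sum>p\<in>G \<times> G. d p *\<^sub>C basis_op p f)"
  by (simp add: qd_action_def basis_op_def case_prod_beta')

lemma act_add: "act (d + d') f = act d f + act d' f"
  by (simp add: act_eq scaleC_add_left sum.distrib)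

lemma act_scale: "act (c *\<^sub>C d) f = c *\<^sub>C act d f"
  by (simp add: act_eq scaleC_fun_def[of c d] scaleC_complex_def complex_vector.scale_sum_right scaleC_scaleC)

lemma act_zero: "act 0 f = 0"
  by (simp add: act_eq)

lemma act_diff: "act (d - d') f = act d f - act d' f"
  using act_add[of "d - d'" d' f] by simp

lemma act_sum: "act (\<Sum>i\<in>I. h i) f = (\<Sum>i\<in>I. act (h i) f)"
  by (induction I rule: infinite_finite_induct) (simp_all only: sum.infinite sum.empty sum.insert act_zero act_add simp_thms)

lemma qd_basis_apply: "qd_basis a x q = (if q = (a, x) then 1 else 0)"
  by (simp add: qd_basis_def summand_def)

lemma basis_apply: "basis p q = (if q = p then 1 else 0)"
  by (simp add: qd_basis_def summand_def split: prod.split)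

lemma act_basis: "p \<in> G \<times> G \<Longrightarrow> act (basis p) f = basis_op p f"
  unfolding act_eq using finite by (subst sum.remove[of _ p]) (auto simp: basis_apply scaleC_one intro!: sum.neutral)

lemma act_linear_right: "clinear_betw W W (act d)"
proof -
  note l = basis_op_linear
  have "act d f \<in> W" if "f \<in> W" for f
    unfolding act_eq using that clinear_betw_mem[OF l]
    by (intro complex_vector.subspace_sum[OF subspace_W] complex_vector.subspace_scale[OF subspace_W]) auto
  moreover have "act d (f + f') = act d f + act d f'" if "f \<in> W" "f' \<in> W" for f f'
    unfolding act_eq sum.distrib[symmetric]
    by (rule sum.cong) (simp_all add: clinear_betw_add[OF l] that scaleC_add_right)
  moreover have "act d (c *\<^sub>C f) = c *\<^sub>C act d f" if "f \<in> W" for f c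
    unfolding act_eq complex_vector.scale_sum_right
    by (rule sum.cong) (simp_all add: clinear_betw_scale[OF l] that scaleC_scaleC mult.commute)
  ultimately show ?thesis by (simp add: clinear_betw_def)
qed

lemma carrier_D: "carrier D = {d. \<forall>p. p \<notin> G \<times> G \<longrightarrow> d p = 0}"
  by (simp add: quantum_double_def)

lemma subspace_D: "csubspace (carrier D)"
  by (auto simp: carrier_D complex_vector.subspace_def scaleC_fun_def scaleC_complex_def)

lemma basis_D: "p \<in> G \<times> G \<Longrightarrow> basis p \<in> carrier D"
  by (auto simp: carrier_D basis_apply simp del: split_paired_All)

lemma D_expand: "d \<in> carrier D \<Longrightarrow> d = (\<Sum>p\<in>G \<times> G. d p *\<^sub>C basis p)"
proof
  fix q assume d: "d \<in> carrier D"
  have "(\<Sum>p\<in>G \<times> G. d p *\<^sub>C basis p) q = (\<Sum>p\<in>G \<times> G. if p = q then d q else 0)"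
    by (simp add: sum_fun_apply scaleC_fun_def scaleC_complex_def qd_basis_apply case_prod_beta')
       (auto intro!: sum.cong)
  then show "d q = (\<Sum>p\<in>G \<times> G. d p *\<^sub>C basis p) q"
    using d finite by (auto simp: carrier_D simp del: split_paired_All)
qed

lemma basis_prod_D: "p \<in> G \<times> G \<Longrightarrow> q \<in> G \<times> G \<Longrightarrow> basis_prod p q \<in> carrier D"
  using basis_D complex_vector.subspace_0[OF subspace_D]
  by (auto simp: basis_prod_def G_mult intro!: complex_vector.subspace_scale[OF subspace_D])

lemma mult_eq: "d \<otimes>\<^bsub>D\<^esub> d' = (\<Sum>p\<in>G \<times> G. \<Sum>q\<in>G \<times> G. (d p * d' q) *\<^sub>C basis_prod p q)"
proof -
  have "(d p * d' q * \<alpha> (snd q) (fst p) (fst q)) *\<^sub>C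
      (if inv (fst q) \<otimes> snd p \<otimes> fst q = snd q then qd_basis (fst p \<otimes> fst q) (snd q) else 0)
    = (d p * d' q) *\<^sub>C basis_prod p q" if "p \<in> G \<times> G" "q \<in> G \<times> G" for p q
    using that by (auto simp: basis_prod_def cj_iff scaleC_scaleC)
  then show ?thesis
    by (simp add: quantum_double_def case_prod_beta' cong: sum.cong)
qed

lemma one_eq: "\<one>\<^bsub>D\<^esub> = (\<Sum>x\<in>G. inverse (\<alpha> x \<one> \<one>) *\<^sub>C basis (\<one>, x))"
  by (simp add: quantum_double_def)

lemma D_mult_closed: "d \<otimes>\<^bsub>D\<^esub> d' \<in> carrier D"
  unfolding mult_eq
  by (intro complex_vector.subspace_sum[OF subspace_D] complex_vector.subspace_scale[OF subspace_D] basis_prod_D)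

lemma one_D: "\<one>\<^bsub>D\<^esub> \<in> carrier D"
  unfolding one_eq
  by (intro complex_vector.subspace_sum[OF subspace_D] complex_vector.subspace_scale[OF subspace_D] basis_D)
    (simp add: G_one)

lemma basis_mult: "p \<in> G \<times> G \<Longrightarrow> q \<in> G \<times> G \<Longrightarrow> basis p \<otimes>\<^bsub>D\<^esub> basis q = basis_prod p q"
proof -
  assume p: "p \<in> G \<times> G" and q: "q \<in> G \<times> G"
  have "basis p \<otimes>\<^bsub>D\<^esub> basis q = (\<Sum>p'\<in>G \<times> G. \<Sum>q'\<in>G \<times> G. if q' = q then (if p' = p then basis_prod p q else 0) else 0)"
    unfolding mult_eq by (intro sum.cong refl) (auto simp: basis_apply scaleC_one simp del: split_paired_All)
  also have "\<dots> = (\<Sum>p'\<in>G \<times> G. if p' = p then basis_prod p q else 0)"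
    using q finite by (subst sum.delta) auto
  also have "\<dots> = basis_prod p q"
    using p finite by (subst sum.delta) auto
  finally show ?thesis .
qed

text \<open>The defining relation of \<alpha>, read as \<alpha>_y(a,k) \<phi>_y(ak) = \<phi>_x(a)
  \<phi>_y(k) with x the conjugate of y by k, supplies exactly the scalar in the product of
  \<open>D\<close>. If \<open>x\<close> is another element, e(x) meets a vector of a different
  summand and both sides vanish.\<close>

lemma act_basis_prod:
  assumes p: "p \<in> G \<times> G" and q: "q \<in> G \<times> G" and f: "f \<in> W"
  shows "act (basis_prod p q) f = basis_op p (basis_op q f)"
proof -
  obtain a x k y where pq: "p = (a, x)" "q = (k, y)" by fastforce
  have G: "a \<in> G" "x \<in> G" "k \<in> G" "y \<in> G" using p q pq by auto
  show ?thesis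
  proof (cases "x = cj k y")
    case True
    have "act (basis_prod p q) f = \<alpha> y a k *\<^sub>C basis_op (a \<otimes> k, y) f"
      using act_basis[of "(a \<otimes> k, y)" f] G by (simp add: pq basis_prod_def True act_scale G_mult)
    also have "\<dots> = basis_op p (basis_op q f)"
      using G \<phi>_mult[OF G(4,1,3) W_mem[OF f G(4)]] \<alpha>_nonzero[OF G(4,1,3)]
      by (simp add: pq basis_op_def True cj_mult summand_def scaleC_fun_def fun_eq_iff scaleC_scaleC scaleC_one)
    finally show ?thesis .
  next
    case False
    then show ?thesis
      using G by (auto simp: pq basis_prod_def act_zero basis_op_def summand_def \<phi>_zero fun_eq_iff)
  qed
qed

lemma act_mult: "f \<in> W \<Longrightarrow> act (d \<otimes>\<^bsub>D\<^esub> d') f = act d (act d' f)"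
proof -
  assume f: "f \<in> W"
  have o: "basis_op q f \<in> W" if "q \<in> G \<times> G" for q
    using clinear_betw_mem[OF basis_op_linear[OF that] f] .
  have "basis_op p (\<Sum>q\<in>G \<times> G. d' q *\<^sub>C basis_op q f) = (\<Sum>q\<in>G \<times> G. d' q *\<^sub>C basis_op p (basis_op q f))"
    if p: "p \<in> G \<times> G" for p
    by (subst clinear_betw_sum[OF basis_op_linear[OF p] subspace_W])
      (simp_all add: clinear_betw_scale[OF basis_op_linear[OF p]] o complex_vector.subspace_scale[OF subspace_W])
  then have "act d (act d' f) = (\<Sum>p\<in>G \<times> G. \<Sum>q\<in>G \<times> G. (d p * d' q) *\<^sub>C basis_op p (basis_op q f))"
    by (simp add: act_eq complex_vector.scale_sum_right scaleC_scaleC)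
  then show ?thesis
    by (simp add: mult_eq act_sum act_scale act_basis_prod f)
qed

text \<open>Applying \<open>\<phi>_mult\<close> to 1 = 1 times 1 gives \<phi>(1)n = \<alpha>^(-1)
  \<phi>(1)\<phi>(1)n, and \<phi>(1) is surjective. This scalar is the origin of the coefficients in
  the unit element of \<open>D\<close>.\<close>

lemma \<phi>_one: "x \<in> G \<Longrightarrow> m \<in> C x \<Longrightarrow> \<phi> x \<one> m = \<alpha> x \<one> \<one> *\<^sub>C m"
proof -
  assume x: "x \<in> G" and m: "m \<in> C x"
  have "m \<in> \<phi> x \<one> ` C x"
    using \<phi>_bij[OF x G_one] m by (simp add: cj_one x bij_betw_def)
  then obtain n where n: "n \<in> C x" "m = \<phi> x \<one> n" by blast
  have "m = inverse (\<alpha> x \<one> \<one>) *\<^sub>C \<phi> x \<one> m"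
    using \<phi>_mult[OF x G_one G_one n(1)] n(2) x by (simp add: cj_one)
  then have "\<alpha> x \<one> \<one> *\<^sub>C m = \<alpha> x \<one> \<one> *\<^sub>C inverse (\<alpha> x \<one> \<one>) *\<^sub>C \<phi> x \<one> m" by simp
  then show ?thesis using \<alpha>_nonzero[OF x G_one G_one] by (simp add: scaleC_scaleC scaleC_one)
qed

lemma act_one: "f \<in> W \<Longrightarrow> act \<one>\<^bsub>D\<^esub> f = f"
proof -
  assume f: "f \<in> W"
  have "act \<one>\<^bsub>D\<^esub> f = (\<Sum>x\<in>G. inverse (\<alpha> x \<one> \<one>) *\<^sub>C basis_op (\<one>, x) f)"
    unfolding one_eq act_sum act_scale by (intro sum.cong refl) (subst act_basis, simp_all add: G_one)
  also have "\<dots> = (\<Sum>x\<in>G. summand x (f x))"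
    using f by (intro sum.cong refl)
      (simp add: basis_op_def cj_one \<phi>_one W_mem summand_def scaleC_fun_def fun_eq_iff scaleC_scaleC
        \<alpha>_nonzero G_one scaleC_one)
  also have "\<dots> = f"
    using f finite by (auto simp: fun_eq_iff sum_fun_apply summand_def W_def)
  finally show ?thesis .
qed

text \<open>On a vector of the summand at \<open>x\<close> only the elements a \<otimes> e(x) act,
  and reading off one component of the result keeps those with a fixed conjugate of
  \<open>x\<close>. What is left is a relation between operators with common source and
  target.\<close>

lemma act_faithful:
  assumes d: "d \<in> carrier D" and z: "\<And>f. f \<in> W \<Longrightarrow> act d f = 0"
  shows "d = 0"
proof
  fix p
  show "d p = 0 p"
  proof (cases "p \<in> G \<times> G")
    case False
    then show ?thesis using d by (simp add: carrier_D del: split_paired_All)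
  next
    case True
    then obtain a x where p: "p = (a, x)" "a \<in> G" "x \<in> G" by auto
    have "(\<Sum>k | k \<in> G \<and> cj k x = cj a x. d (k, x) *\<^sub>C \<phi> x k m) = 0" if m: "m \<in> C x" for m
    proof -
      have "act d (summand x m) (cj a x) =
          (\<Sum>(k, y)\<in>G \<times> G. if y = x then (if cj k x = cj a x then d (k, x) *\<^sub>C \<phi> x k m else 0) else 0)"
        unfolding act_eq sum_fun_apply
        by (intro sum.cong refl) (auto simp: basis_op_def summand_def scaleC_fun_def \<phi>_zero)
      also have "\<dots> = (\<Sum>k\<in>G. \<Sum>y\<in>G. if y = x then (if cj k x = cj a x then d (k, x) *\<^sub>C \<phi> x k m else 0) else 0)"
        by (rule sum.cartesian_product[symmetric])
      also have "\<dots> = (\<Sum>k\<in>G. if cj k x = cj a x then d (k, x) *\<^sub>C \<phi> x k m else 0)"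
        using finite p by (subst sum.delta) auto
      also have "\<dots> = (\<Sum>k | k \<in> G \<and> cj k x = cj a x. d (k, x) *\<^sub>C \<phi> x k m)"
        using finite by (simp add: sum.inter_filter)
      finally show ?thesis using z[OF summand_W[OF p(3) m]] by simp
    qed
    then have "d (a, x) = 0"
      using \<phi>_independent[of x "cj a x" "\<lambda>k. d (k, x)"] p by (simp add: cj_closed)
    then show ?thesis by (simp add: p)
  qed
qed

text \<open>The algebra axioms, in particular associativity, are inherited from the endomorphism
  algebra of \<open>W\<close> because the action is faithful.\<close>

lemma complex_algebra_D: "complex_algebra D"
proof -
  have eqI: "d = d'" if "d \<in> carrier D" "d' \<in> carrier D" "\<And>f. f \<in> W \<Longrightarrow> act d f = act d' f" for d d'
    using act_faithful[of "d - d'"] that complex_vector.subspace_diff[OF subspace_D, of d d']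
    by (simp add: act_diff)
  have cl: "act d f \<in> W" if "f \<in> W" for d f
    using clinear_betw_mem[OF act_linear_right that] .
  have "monoid D"
  proof
    show "x \<otimes>\<^bsub>D\<^esub> y \<in> carrier D" for x y by (rule D_mult_closed)
    show "x \<otimes>\<^bsub>D\<^esub> y \<otimes>\<^bsub>D\<^esub> z = x \<otimes>\<^bsub>D\<^esub> (y \<otimes>\<^bsub>D\<^esub> z)" for x y z
      by (rule eqI) (simp_all add: D_mult_closed act_mult cl)
    show "\<one>\<^bsub>D\<^esub> \<in> carrier D" by (rule one_D)
    show "\<one>\<^bsub>D\<^esub> \<otimes>\<^bsub>D\<^esub> x = x" "x \<otimes>\<^bsub>D\<^esub> \<one>\<^bsub>D\<^esub> = x" if "x \<in> carrier D" for x
      by (rule eqI; simp add: D_mult_closed act_mult cl act_one that)+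
  qed
  moreover have "clinear_betw (carrier D) (carrier D) (\<lambda>x. x \<otimes>\<^bsub>D\<^esub> y)"
    "clinear_betw (carrier D) (carrier D) (\<lambda>y. x \<otimes>\<^bsub>D\<^esub> y)" for x y
    by (auto simp: clinear_betw_def mult_eq distrib_left distrib_right scaleC_add_left
        scaleC_fun_apply scaleC_complex_def complex_vector.scale_sum_right scaleC_scaleC
        sum.distrib mult_ac intro!: complex_vector.subspace_sum[OF subspace_D]
        complex_vector.subspace_scale[OF subspace_D] basis_prod_D)
  ultimately show ?thesis
    using subspace_D by (simp add: complex_algebra_def complex_algebra_axioms_def)
qed

lemma algebra_module_W: "algebra_module D W act"
proof -
  have "clinear_betw (carrier D) W (\<lambda>x. act x w)" if "w \<in> W" for w
    using clinear_betw_mem[OF act_linear_right that] by (simp add: clinear_betw_def act_add act_scale)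
  then show ?thesis
    using complex_algebra_D subspace_W act_linear_right act_mult act_one
    by (simp add: algebra_module_def algebra_module_axioms_def)
qed

lemma module_action_expand:
  assumes "algebra_module D S actS" "d \<in> carrier D" "s \<in> S"
  shows "actS d s = (\<Sum>p\<in>G \<times> G. d p *\<^sub>C actS (basis p) s)"
proof -
  interpret S: algebra_module D S actS by fact
  note l = S.act_linear_left[OF assms(3)]
  have "actS d s = actS (\<Sum>p\<in>G \<times> G. d p *\<^sub>C basis p) s" using D_expand[OF assms(2)] by simp
  also have "\<dots> = (\<Sum>p\<in>G \<times> G. d p *\<^sub>C actS (basis p) s)"
    by (subst clinear_betw_sum[OF l subspace_D])
      (auto simp: clinear_betw_scale[OF l basis_D] complex_vector.subspace_scale[OF subspace_D basis_D] intro!: sum.cong)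
  finally show ?thesis .
qed

text \<open>A functional \<open>l\<close> on \<open>S\<close> and a vector \<open>m \<in> C z\<close> give the rank-one map
  $s \mapsto l(s)\,m$; the homomorphism below is its average over the basis of \<open>D\<close>.\<close>

lemma simple_module_occurs:
  assumes S: "simple_algebra_module D S actS"
  shows "\<exists>U F. algebra_submodule D W act U \<and> algebra_module_iso D S actS U act F"
proof -
  interpret S: simple_algebra_module D S actS by fact
  note Sm = S.algebra_module_axioms
  have cl: "actS d s \<in> S" if "d \<in> carrier D" "s \<in> S" for d s
    using clinear_betw_mem[OF S.act_linear] that .
  obtain s0 where s0: "s0 \<in> S" "s0 \<noteq> 0"
    using S.module_nonzero complex_vector.subspace_0[OF S.module_subspace] by blast
  \<comment> \<open>The unit is a combination of the elements 1 \<otimes> e(x), so one of them must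
    move \<open>s0\<close> to a nonzero vector.\<close>
  obtain z where z: "z \<in> G" "actS (basis (\<one>, z)) s0 \<noteq> 0"
  proof -
    have bD: "basis (\<one>, x) \<in> carrier D" if "x \<in> G" for x using that G_one by (intro basis_D) simp
    note l = S.act_linear_left[OF s0(1)]
    have "s0 = actS \<one>\<^bsub>D\<^esub> s0" using S.act_one s0 by simp
    also have "\<dots> = (\<Sum>x\<in>G. inverse (\<alpha> x \<one> \<one>) *\<^sub>C actS (basis (\<one>, x)) s0)"
      unfolding one_eq
      by (subst clinear_betw_sum[OF l subspace_D])
        (use bD in \<open>auto simp: clinear_betw_scale[OF l] complex_vector.subspace_scale[OF subspace_D] intro!: sum.cong\<close>)
    finally have "(\<Sum>x\<in>G. inverse (\<alpha> x \<one> \<one>) *\<^sub>C actS (basis (\<one>, x)) s0) \<noteq> 0" using s0 by simp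
    then obtain x where "x \<in> G" "inverse (\<alpha> x \<one> \<one>) *\<^sub>C actS (basis (\<one>, x)) s0 \<noteq> 0"
      by (rule sum.not_neutral_contains_not_neutral)
    then show ?thesis using that[of x] by (metis complex_vector.scale_zero_right)
  qed
  obtain l where l: "cfunctional l" "l (actS (basis (\<one>, z)) s0) \<noteq> 0"
    using cfunctional_nonzero z(2) by blast
  define \<phi>i where "\<phi>i x a = inv_into (C x) (\<phi> x a)" for x a
  have \<phi>i: "clinear_betw (C (cj a x)) (C x) (\<phi>i x a)" if "x \<in> G" "a \<in> G" for x a
    using clinear_iso_inv[OF \<phi>_iso subspace] that by (simp add: clinear_iso_def \<phi>i_def)
  have \<phi>i_left: "\<phi>i x a (\<phi> x a n) = n" if "x \<in> G" "a \<in> G" "n \<in> C x" for x a n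
    using bij_betw_inv_into_left[OF \<phi>_bij] that by (simp add: \<phi>i_def)
  have \<phi>i_right: "\<phi> x a (\<phi>i x a m) = m" if "x \<in> G" "a \<in> G" "m \<in> C (cj a x)" for x a m
    using bij_betw_inv_into_right[OF \<phi>_bij] that by (simp add: \<phi>i_def)
  define T where "T x = {a. a \<in> G \<and> cj a x = z}" for x
  \<comment> \<open>At a = 1 the coefficient is nonzero by the choice of \<open>l\<close>, so
    independence of the inverse operators keeps the sum from vanishing for every \<open>m\<close>.
    For the \<open>m\<close> chosen here the sum is the component of \<open>F s0\<close> at
    \<open>z\<close>.\<close>
  have "\<exists>m\<in>C z. (\<Sum>a\<in>T z. l (actS (basis (a, z)) s0) *\<^sub>C \<phi>i z a m) \<noteq> 0"
  proof (rule ccontr)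
    assume "\<not> ?thesis"
    then have "l (actS (basis (\<one>, z)) s0) = 0"
      using \<phi>_inv_independent[of z z "\<lambda>a. l (actS (basis (a, z)) s0)"] z G_one
      unfolding T_def \<phi>i_def by (simp add: cj_one)
    then show False using l by simp
  qed
  then obtain m where m: "m \<in> C z" "(\<Sum>a\<in>T z. l (actS (basis (a, z)) s0) *\<^sub>C \<phi>i z a m) \<noteq> 0" by blast
  \<comment> \<open>Component \<open>x\<close> sums over all \<open>a\<close> that carry the summand
    at \<open>x\<close> to the one at \<open>z\<close> containing \<open>m\<close>: the functional
    tests (a \<otimes> e(x))s, and the inverse of \<phi>_x(a) brings \<open>m\<close> back to the
    summand at \<open>x\<close>.\<close>
  define F where "F s x = (if x \<in> G then \<Sum>a\<in>T x. l (actS (basis (a, x)) s) *\<^sub>C \<phi>i x a m else 0)" for s x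
  have \<phi>im: "\<phi>i x a m \<in> C x" if "x \<in> G" "a \<in> T x" for x a
    using clinear_betw_mem[OF \<phi>i[of x a], of m] m that by (simp add: T_def)
  have FW: "F s \<in> W" for s
    using \<phi>im by (auto simp: W_def F_def intro!: complex_vector.subspace_sum[OF subspace]
        complex_vector.subspace_scale[OF subspace])
  have bS: "clinear_betw S S (actS (qd_basis a x))" if "x \<in> G" "a \<in> T x" for x a
    using S.act_linear[OF basis_D[of "(a, x)"]] that by (simp add: T_def)
  have F: "clinear_betw S W F"
  proof -
    have "F (s + t) = F s + F t" if "s \<in> S" "t \<in> S" for s t
      unfolding fun_eq_iff F_def plus_fun_def
      by (auto simp: sum.distrib[symmetric] clinear_betw_add[OF bS] that cfunctional_add[OF l(1)]
          scaleC_add_left intro!: sum.cong)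
    moreover have "F (c *\<^sub>C s) = c *\<^sub>C F s" if "s \<in> S" for c s
      unfolding fun_eq_iff F_def scaleC_fun_def
      by (auto simp: complex_vector.scale_sum_right clinear_betw_scale[OF bS] that
          cfunctional_scale[OF l(1)] scaleC_scaleC intro!: sum.cong)
    ultimately show ?thesis using FW by (simp add: clinear_betw_def)
  qed
  have hom_b: "F (actS (basis p) s) = basis_op p (F s)" if p: "p \<in> G \<times> G" and s: "s \<in> S" for p s
  proof
    fix x
    obtain k y where ky: "p = (k, y)" "k \<in> G" "y \<in> G" using p by auto
    have bb: "actS (basis (a, x)) (actS (basis p) s) = actS (basis_prod (a, x) p) s" if "x \<in> G" "a \<in> G" for a
      using S.act_mult[OF basis_D basis_D s, of "(a, x)" p] basis_mult[of "(a, x)" p] p that by simp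
    show "F (actS (basis p) s) x = basis_op p (F s) x"
    proof (cases "x = cj k y")
      case False
      have "l (actS (basis (a, x)) (actS (basis p) s)) = 0" if "x \<in> G" "a \<in> T x" for a
        using that False bb[of a] clinear_betw_zero[OF S.act_linear_left[OF s] subspace_D]
        by (simp add: T_def ky basis_prod_def cfunctional_zero[OF l(1)])
      then show ?thesis using False by (simp add: F_def ky basis_op_def summand_def)
    next
      case True
      have xG: "x \<in> G" using True ky cj_closed by simp
      \<comment> \<open>Since \<open>x\<close> is the conjugate of \<open>y\<close> by
        \<open>k\<close>, right multiplication by \<open>k\<close> turns the elements conjugating
        \<open>x\<close> to \<open>z\<close> into those conjugating \<open>y\<close> to
        \<open>z\<close>.\<close>
      have bij: "bij_betw (\<lambda>a. a \<otimes> k) (T x) (T y)"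
      proof (rule bij_betw_byWitness[where f' = "\<lambda>a. a \<otimes> inv k"])
        show "\<forall>a\<in>T x. a \<otimes> k \<otimes> inv k = a" "\<forall>a\<in>T y. a \<otimes> inv k \<otimes> k = a"
          using ky by (auto simp: T_def m_assoc G_carrier)
        show "(\<lambda>a. a \<otimes> k) ` T x \<subseteq> T y"
          using ky by (auto simp: T_def True G_mult cj_mult)
        have "cj (inv k) x = y"
          using ky cj_mult[of "inv k" k y] by (simp add: True G_inv G_carrier cj_one)
        then show "(\<lambda>a. a \<otimes> inv k) ` T y \<subseteq> T x"
          using ky xG by (auto simp: T_def G_mult G_inv)
            (metis G_carrier G_inv True cj_mult inv_solve_right l_inv cj_one cj_closed)
      qed
      \<comment> \<open>The scalar \<alpha>_y(a,k) from multiplying the basis elements cancels the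
        inverse scalar that appears when the inverse of \<phi>_x(a) is expressed through that of
        \<phi>_y(ak).\<close>
      have summand_eq: "l (actS (basis (a, x)) (actS (basis p) s)) *\<^sub>C \<phi>i x a m
          = \<phi> y k (l (actS (basis (a \<otimes> k, y)) s) *\<^sub>C \<phi>i y (a \<otimes> k) m)" if a: "a \<in> T x" for a
      proof -
        have aG: "a \<in> G" "cj a x = z" and ak: "a \<otimes> k \<in> G" "cj (a \<otimes> k) y = z"
          using a ky by (auto simp: T_def True G_mult cj_mult)
        define n where "n = \<phi>i y (a \<otimes> k) m"
        have n: "n \<in> C y" using \<phi>im[of y "a \<otimes> k"] ak ky by (simp add: T_def n_def)
        have \<phi>n: "\<phi> y k n \<in> C x" using clinear_betw_mem[OF \<phi>_linear n] ky by (simp add: True)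
        have "m = \<phi> y (a \<otimes> k) n" using \<phi>i_right[of y "a \<otimes> k" m] ak ky m(1) by (simp add: n_def)
        also have "\<dots> = inverse (\<alpha> y a k) *\<^sub>C \<phi> x a (\<phi> y k n)"
          using \<phi>_mult[OF ky(3) aG(1) ky(2) n] by (simp add: True)
        also have "\<dots> = \<phi> x a (inverse (\<alpha> y a k) *\<^sub>C \<phi> y k n)"
          using clinear_betw_scale[OF \<phi>_linear[OF xG aG(1)] \<phi>n] by simp
        finally have "\<phi>i x a m = inverse (\<alpha> y a k) *\<^sub>C \<phi> y k n"
          using \<phi>i_left[OF xG aG(1)] complex_vector.subspace_scale[OF subspace[OF xG] \<phi>n] by simp
        moreover have "l (actS (basis (a, x)) (actS (basis p) s)) = \<alpha> y a k * l (actS (basis (a \<otimes> k, y)) s)"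
        proof -
          have "basis (a \<otimes> k, y) \<in> carrier D" using ak ky by (intro basis_D) simp
          then have "actS (basis_prod (a, x) p) s = \<alpha> y a k *\<^sub>C actS (basis (a \<otimes> k, y)) s"
            using clinear_betw_scale[OF S.act_linear_left[OF s]] by (simp add: ky basis_prod_def True)
          then show ?thesis by (simp only: bb[OF xG aG(1)] cfunctional_scale[OF l(1)])
        qed
        ultimately show ?thesis
          using \<alpha>_nonzero[OF ky(3) aG(1) ky(2)] clinear_betw_scale[OF \<phi>_linear n] ky
          by (simp add: n_def[symmetric] scaleC_scaleC)
      qed
      have "F (actS (basis p) s) x = (\<Sum>a\<in>T x. \<phi> y k (l (actS (basis (a \<otimes> k, y)) s) *\<^sub>C \<phi>i y (a \<otimes> k) m))"
        using xG summand_eq by (simp add: F_def)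
      also have "\<dots> = (\<Sum>a\<in>T y. \<phi> y k (l (actS (basis (a, y)) s) *\<^sub>C \<phi>i y a m))"
        by (rule sum.reindex_bij_betw[OF bij])
      also have "\<dots> = \<phi> y k (F s y)"
        using ky \<phi>im
        by (simp add: F_def clinear_betw_sum[OF \<phi>_linear subspace] complex_vector.subspace_scale[OF subspace])
      finally show ?thesis by (simp add: basis_op_def ky True summand_def)
    qed
  qed
  have hom: "F (actS d s) = act d (F s)" if d: "d \<in> carrier D" and s: "s \<in> S" for d s
  proof -
    have bs: "actS (basis p) s \<in> S" if "p \<in> G \<times> G" for p using cl[OF basis_D[OF that] s] .
    have "F (actS d s) = (\<Sum>p\<in>G \<times> G. F (d p *\<^sub>C actS (basis p) s))"
      unfolding module_action_expand[OF Sm d s]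
      by (rule clinear_betw_sum[OF F S.module_subspace])
        (rule complex_vector.subspace_scale[OF S.module_subspace bs])
    also have "\<dots> = (\<Sum>p\<in>G \<times> G. d p *\<^sub>C basis_op p (F s))"
      by (rule sum.cong[OF refl]) (simp only: clinear_betw_scale[OF F bs] hom_b s)
    finally show ?thesis by (simp add: act_eq)
  qed
  have "F s0 \<noteq> 0" using m(2) z(1) by (auto simp: F_def fun_eq_iff intro!: exI[of _ z])
  from simple_module_embedding[OF S algebra_module_W F _ s0(1) this, OF hom]
  show ?thesis by blast
qed

end

section \<open>The fixed-point subalgebra and its module\<close>

lemma clinear_betw_Sum_any:
  assumes f: "clinear_betw A B f" and A: "csubspace A" and c: "\<And>i. c i \<in> A" "finite {i. c i \<noteq> 0}"
  shows "f (Sum_any c) = Sum_any (\<lambda>i. f (c i))"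
proof -
  have "f (Sum_any c) = (\<Sum>i | c i \<noteq> 0. f (c i))"
    unfolding Sum_any.expand_set by (rule clinear_betw_sum[OF f A c(1)])
  also have "\<dots> = Sum_any (\<lambda>i. f (c i))"
    using clinear_betw_zero[OF f A] c(2) by (intro Sum_any.expand_superset[symmetric]) auto
  finally show ?thesis .
qed

lemma Sum_any_fun_apply:
  fixes c :: "'i \<Rightarrow> 'a \<Rightarrow> 'b::comm_monoid_add"
  assumes "finite {i. c i \<noteq> 0}"
  shows "Sum_any c x = Sum_any (\<lambda>i. c i x)"
proof -
  have "Sum_any (\<lambda>i. c i x) = (\<Sum>i | c i \<noteq> 0. c i x)"
    using assms by (intro Sum_any.expand_superset) auto
  then show ?thesis by (simp add: Sum_any.expand_set sum_fun_apply)
qed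

text \<open>Serves to show that the function-valued sums in the Jacobi identity have finite support,
  the condition for evaluating \<open>Sum_any\<close> componentwise. \<open>P\<close> is the
  truncated inner mode and \<open>Q\<close> the term of the sum that contains it.\<close>

lemma finite_nonzero_rat_shift:
  fixes K n :: rat
  assumes "\<And>m. m \<ge> K \<Longrightarrow> P m = 0" and "\<And>i. P (n + of_nat i) = 0 \<Longrightarrow> Q i = 0"
  shows "finite {i. Q i \<noteq> 0}"
proof -
  obtain N :: nat where N: "K - n \<le> of_nat N" using real_arch_simple by blast
  have "Q i = 0" if "\<not> i < N" for i
  proof -
    have "(of_nat N :: rat) \<le> of_nat i" using that by simp
    then have "n + of_nat i \<ge> K" using N by linarith
    then show ?thesis using assms by blast
  qed
  then have "{i. Q i \<noteq> 0} \<subseteq> {..<N}" by auto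
  then show ?thesis using finite_subset by blast
qed

section \<open>Direct sums of graded spaces\<close>

lemma tmodule_sum_simps [simp]:
  "carrier (tmodule_sum I M) = {f. (\<forall>i\<in>I. f i \<in> carrier (M i)) \<and> (\<forall>i. i \<notin> I \<longrightarrow> f i = 0)}"
  "tgrade (tmodule_sum I M) s = {f. (\<forall>i\<in>I. f i \<in> tgrade (M i) s) \<and> (\<forall>i. i \<notin> I \<longrightarrow> f i = 0)}"
  by (simp_all add: tmodule_sum_def)

lemma tmode_sum_apply:
  "tmode (tmodule_sum I M) v n f i = (if i \<in> I then tmode (M i) v n (f i) else 0)"
  by (simp add: tmodule_sum_def)

text \<open>Decompositions are assembled componentwise; finiteness of \<open>I\<close> keeps the
  support of the assembled family finite. For uniqueness, each component of a decomposition is again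
  a decomposition in \<open>C i\<close>.\<close>

lemma direct_sum_of_functions:
  fixes C :: "'i \<Rightarrow> 'm::complex_vector set" and U :: "'i \<Rightarrow> 's \<Rightarrow> 'm set"
  assumes I: "finite I" and ds: "\<And>i. i \<in> I \<Longrightarrow> direct_sum_of (C i) (U i)"
  shows "direct_sum_of {f. (\<forall>i\<in>I. f i \<in> C i) \<and> (\<forall>i. i \<notin> I \<longrightarrow> f i = 0)}
    (\<lambda>s. {f. (\<forall>i\<in>I. f i \<in> U i s) \<and> (\<forall>i. i \<notin> I \<longrightarrow> f i = 0)})"
proof -
  have sub: "csubspace {f. (\<forall>i\<in>I. f i \<in> A i) \<and> (\<forall>i. i \<notin> I \<longrightarrow> f i = 0)}"
    if "\<And>i. i \<in> I \<Longrightarrow> csubspace (A i)" for A :: "'i \<Rightarrow> 'm set"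
    using that by (auto simp: complex_vector.subspace_def scaleC_fun_def)
  have subs: "csubspace (C i)" "csubspace (U i s)" "U i s \<subseteq> C i" if "i \<in> I" for i s
    using ds[OF that] by (auto simp: direct_sum_of_def)
  have dec: "\<exists>!c. (\<forall>s. c s \<in> U i s) \<and> finite {s. c s \<noteq> 0} \<and> w = Sum_any c" if "i \<in> I" "w \<in> C i" for i w
    using ds[OF that(1)] that(2) by (simp add: direct_sum_of_def)
  have uniq: "c = c'" if "i \<in> I" "w \<in> C i"
    "(\<forall>s. c s \<in> U i s) \<and> finite {s. c s \<noteq> 0} \<and> w = Sum_any c"
    "(\<forall>s. c' s \<in> U i s) \<and> finite {s. c' s \<noteq> 0} \<and> w = Sum_any c'" for i w c c'
    using dec[OF that(1,2)] that(3,4) by (elim ex1E) metis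
  let ?U = "\<lambda>s. {f. (\<forall>i\<in>I. f i \<in> U i s) \<and> (\<forall>i. i \<notin> I \<longrightarrow> f i = 0)}"
  have "\<exists>!c. (\<forall>s. c s \<in> ?U s) \<and> finite {s. c s \<noteq> 0} \<and> f = Sum_any c"
    if f: "\<forall>i\<in>I. f i \<in> C i" "\<forall>i. i \<notin> I \<longrightarrow> f i = 0" for f
  proof -
    have "\<forall>i\<in>I. \<exists>c. (\<forall>s. c s \<in> U i s) \<and> finite {s. c s \<noteq> 0} \<and> f i = Sum_any c"
      using dec f(1) by blast
    then obtain c where c: "\<And>i s. i \<in> I \<Longrightarrow> c i s \<in> U i s" "\<And>i. i \<in> I \<Longrightarrow> finite {s. c i s \<noteq> 0}"
      "\<And>i. i \<in> I \<Longrightarrow> f i = Sum_any (c i)"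
      by metis
    define e where "e s i = (if i \<in> I then c i s else 0)" for s i
    have "{s. e s \<noteq> 0} \<subseteq> (\<Union>i\<in>I. {s. c i s \<noteq> 0})"
      by (auto simp: e_def fun_eq_iff split: if_splits)
    then have fin: "finite {s. e s \<noteq> 0}" using I c(2) finite_subset by blast
    have "f = Sum_any e"
    proof
      fix i show "f i = Sum_any e i"
        using c(3)[of i] f(2) by (cases "i \<in> I") (simp_all add: Sum_any_fun_apply[OF fin] e_def)
    qed
    moreover have "\<forall>s. e s \<in> ?U s" using c(1) by (simp add: e_def)
    ultimately have P: "(\<forall>s. e s \<in> ?U s) \<and> finite {s. e s \<noteq> 0} \<and> f = Sum_any e" using fin by blast
    moreover have "d = e" if d: "(\<forall>s. d s \<in> ?U s) \<and> finite {s. d s \<noteq> 0} \<and> f = Sum_any d" for d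
    proof -
      have "(\<lambda>s. d s i) = (\<lambda>s. e s i)" for i
      proof (cases "i \<in> I")
        case True
        have "(\<forall>s. h s i \<in> U i s) \<and> finite {s. h s i \<noteq> 0} \<and> f i = Sum_any (\<lambda>s. h s i)"
          if h: "(\<forall>s. h s \<in> ?U s) \<and> finite {s. h s \<noteq> 0} \<and> f = Sum_any h" for h
        proof -
          have "{s. h s i \<noteq> 0} \<subseteq> {s. h s \<noteq> 0}" by auto
          then have "finite {s. h s i \<noteq> 0}" using h finite_subset by blast
          then show ?thesis using h True Sum_any_fun_apply[of h i] by simp
        qed
        from uniq[OF True bspec[OF f(1) True] this[OF d] this[OF P]] show ?thesis .
      next
        case False
        then show ?thesis using d P by simp
      qed
      then show ?thesis by (simp add: fun_eq_iff)
    qed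
    ultimately show ?thesis by blast
  qed
  then show ?thesis
    using sub[of C] sub[of "\<lambda>i. U i _"] subs
    by (fastforce simp: direct_sum_of_def)
qed

lemma finite_dim_functions:
  fixes U :: "'i \<Rightarrow> 'm::complex_vector set"
  assumes I: "finite I" and fd: "\<And>i. i \<in> I \<Longrightarrow> finite_dim (U i)"
  shows "finite_dim {f. (\<forall>i\<in>I. f i \<in> U i) \<and> (\<forall>i. i \<notin> I \<longrightarrow> f i = 0)}" (is "finite_dim ?W")
proof -
  have "\<forall>i\<in>I. \<exists>B. finite B \<and> cspan B = U i" using fd by (simp add: finite_dim_def)
  then obtain B where B: "\<And>i. i \<in> I \<Longrightarrow> finite (B i)" "\<And>i. i \<in> I \<Longrightarrow> cspan (B i) = U i" by metis
  have U: "csubspace (U i)" if "i \<in> I" for i using B(2)[OF that] complex_vector.subspace_span by metis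
  define E where "E = (\<Union>i\<in>I. summand i ` B i)"
  have W: "csubspace ?W" using U by (auto simp: complex_vector.subspace_def scaleC_fun_def)
  have "E \<subseteq> ?W"
    using B complex_vector.span_base complex_vector.subspace_0[OF U]
    by (fastforce simp: E_def summand_def)
  then have "cspan E \<subseteq> ?W" using W by (rule complex_vector.span_minimal)
  moreover have "f \<in> cspan E" if f: "f \<in> ?W" for f
  proof -
    have "summand i m \<in> cspan E" if i: "i \<in> I" and m: "m \<in> U i" for i m
    proof -
      have "csubspace {m. summand i m \<in> cspan E}"
        unfolding complex_vector.subspace_def
      proof (intro conjI ballI allI)
        have "summand i 0 = (0 :: 'i \<Rightarrow> 'm)" by (simp add: summand_def fun_eq_iff)
        then show "0 \<in> {m. summand i m \<in> cspan E}" using complex_vector.span_zero[of E] by simp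
        fix x y c assume x: "x \<in> {m. summand i m \<in> cspan E}"
        have "summand i (c *\<^sub>C x) = c *\<^sub>C summand i x" by (simp add: summand_def fun_eq_iff scaleC_fun_def)
        then show "c *\<^sub>C x \<in> {m. summand i m \<in> cspan E}" using x complex_vector.span_scale by simp
        assume y: "y \<in> {m. summand i m \<in> cspan E}"
        have "summand i (x + y) = summand i x + summand i y" by (simp add: summand_def fun_eq_iff)
        then show "x + y \<in> {m. summand i m \<in> cspan E}" using x y complex_vector.span_add by simp
      qed
      moreover have "B i \<subseteq> {m. summand i m \<in> cspan E}"
        using i by (auto simp: E_def intro!: complex_vector.span_base)
      ultimately have "cspan (B i) \<subseteq> {m. summand i m \<in> cspan E}"
        by (intro complex_vector.span_minimal)
      then show ?thesis using B(2)[OF i] m by blast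
    qed
    moreover have "f = (\<Sum>i\<in>I. summand i (f i))"
      using f I by (auto simp: fun_eq_iff sum_fun_apply summand_def)
    ultimately show ?thesis
      using f complex_vector.span_sum[of I "\<lambda>i. summand i (f i)" E] by simp
  qed
  ultimately have "cspan E = ?W" by blast
  moreover have "finite E" using I B by (simp add: E_def)
  ultimately show ?thesis unfolding finite_dim_def by blast
qed

section \<open>Fixed vectors and their action on sums of twisted modules\<close>

context vertex_operator_algebra
begin

lemma fixed_voa_simps [simp]:
  "carrier (fixed_voa G V) = {v \<in> carrier V. \<forall>g\<in>G. g v = v}"
  "vgrade (fixed_voa G V) n = {v \<in> vgrade V n. \<forall>g\<in>G. g v = v}"
  "vmode (fixed_voa G V) = vmode V" "vac (fixed_voa G V) = vac V"
  "conf (fixed_voa G V) = conf V" "vrank (fixed_voa G V) = vrank V"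
  "vir (fixed_voa G V) = vir V"
  by (simp_all add: fixed_voa_def vir_def fun_eq_iff)

lemma fixed_by: "v \<in> carrier (fixed_voa G V) \<Longrightarrow> g \<in> G \<Longrightarrow> g v = v"
  by auto

text \<open>An automorphism fixes the Virasoro vector, so it commutes with L(0).\<close>

lemma Aut_grade:
  assumes "g \<in> carrier (voa_Aut V)" and "v \<in> vgrade V n"
  shows "g v \<in> vgrade V n"
proof -
  have v: "v \<in> carrier V" "vir V 0 v = of_int n *\<^sub>C v" using assms(2) by (simp_all add: grade_eq)
  have "vir V 0 (g v) = g (vir V 0 v)"
    using Aut_mode[OF assms(1) conf_closed v(1)] by (simp add: vir_def Aut_conf[OF assms(1)])
  then show ?thesis
    using v clinear_betw_scale[OF Aut_linear[OF assms(1)]] Aut_closed[OF assms(1)] by (simp add: grade_eq)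
qed

text \<open>The fixed vectors contain \<open>vac V\<close> and \<open>conf V\<close> and are closed
  under modes, so the identities restrict. The grading needs an argument: applying \<open>g\<close>
  to the decomposition of a fixed vector gives another decomposition of it, and uniqueness makes
  every component fixed.\<close>

lemma vertex_operator_algebra_fixed:
  assumes G: "G \<subseteq> carrier (voa_Aut V)"
  shows "vertex_operator_algebra (fixed_voa G V)"
proof -
  let ?F = "fixed_voa G V"
  note lin = Aut_linear[OF subsetD[OF G]]
  have sub_fix: "csubspace {v \<in> U. \<forall>g\<in>G. g v = v}" if "csubspace U" "U \<subseteq> carrier V" for U
    using that clinear_betw_zero[OF lin carrier_subspace]
    by (auto simp: complex_vector.subspace_def subset_eq clinear_betw_add[OF lin] clinear_betw_scale[OF lin])
  have gr: "csubspace (vgrade V n)" "vgrade V n \<subseteq> carrier V" for n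
    using grading by (auto simp: direct_sum_of_def)
  have mode_fix: "g (vmode V v n w) = vmode V v n w" if "g \<in> G" "v \<in> carrier ?F" "w \<in> carrier ?F" for g v n w
    using Aut_mode[OF subsetD[OF G that(1)], of v w n] fixed_by[OF that(2,1)] fixed_by[OF that(3,1)] that by simp
  have dec: "\<exists>!c. (\<forall>i. c i \<in> vgrade ?F i) \<and> finite {i. c i \<noteq> 0} \<and> w = Sum_any c"
    if w: "w \<in> carrier ?F" for w
  proof -
    have ex1: "\<exists>!c. (\<forall>i. c i \<in> vgrade V i) \<and> finite {i. c i \<noteq> 0} \<and> w = Sum_any c"
      using grading w by (simp add: direct_sum_of_def)
    then have uniq: "c = c'" if "(\<forall>i. c i \<in> vgrade V i) \<and> finite {i. c i \<noteq> 0} \<and> w = Sum_any c"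
      "(\<forall>i. c' i \<in> vgrade V i) \<and> finite {i. c' i \<noteq> 0} \<and> w = Sum_any c'" for c c'
      using that by (elim ex1E) metis
    from ex1 obtain c where c: "\<And>i. c i \<in> vgrade V i" "finite {i. c i \<noteq> 0}" "w = Sum_any c" by blast
    have "g (c i) = c i" if g: "g \<in> G" for g i
    proof -
      have "{i. g (c i) \<noteq> 0} \<subseteq> {i. c i \<noteq> 0}"
        using clinear_betw_zero[OF lin[OF g] carrier_subspace] by auto
      then have "finite {i. g (c i) \<noteq> 0}" using c(2) finite_subset by blast
      moreover have "w = Sum_any (\<lambda>i. g (c i))"
      proof -
        have "w = g w" using fixed_by[OF w g] by simp
        also have "\<dots> = Sum_any (\<lambda>i. g (c i))"
          unfolding c(3) using c gr by (intro clinear_betw_Sum_any[OF lin[OF g] carrier_subspace]) auto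
        finally show ?thesis .
      qed
      moreover have "\<forall>i. g (c i) \<in> vgrade V i"
        using Aut_grade[OF subsetD[OF G g] c(1)] by blast
      ultimately have "(\<lambda>i. g (c i)) = c" using c by (intro uniq) blast+
      then show ?thesis by (rule fun_cong)
    qed
    then have "(\<forall>i. c i \<in> vgrade ?F i) \<and> finite {i. c i \<noteq> 0} \<and> w = Sum_any c"
      using c by auto
    moreover have "e = c" if "(\<forall>i. e i \<in> vgrade ?F i) \<and> finite {i. e i \<noteq> 0} \<and> w = Sum_any e" for e
      by (rule uniq) (use that c in auto)
    ultimately show ?thesis by (rule ex1I)
  qed
  show ?thesis
  proof
    show "direct_sum_of (carrier ?F) (vgrade ?F)"
      using dec sub_fix[OF carrier_subspace] sub_fix[OF gr] subsetD[OF gr(2)]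
      by (auto simp: direct_sum_of_def)
    show "finite_dim (vgrade ?F n)" for n
      using finite_dim_subspace[OF grade_finite_dim sub_fix[OF gr]] by auto
    show "\<exists>K. \<forall>n<K. vgrade ?F n = {0}"
    proof -
      obtain K where "\<And>n. n < K \<Longrightarrow> vgrade V n = {0}" using grade_bounded_below by blast
      then have "\<forall>n<K. vgrade ?F n = {0}"
        using clinear_betw_zero[OF lin carrier_subspace] by auto
      then show ?thesis by blast
    qed
    show "clinear_betw (carrier ?F) (carrier ?F) (\<lambda>v. vmode ?F v n w)" if "w \<in> carrier ?F" for w n
      using that mode_fix mode_linear_left[of w n] by (auto simp: clinear_betw_def)
    show "clinear_betw (carrier ?F) (carrier ?F) (vmode ?F v n)" if "v \<in> carrier ?F" for v n
      using that mode_fix mode_linear[of v n] by (auto simp: clinear_betw_def)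
    show "\<exists>K. \<forall>n\<ge>K. vmode ?F u n v = 0" if "u \<in> carrier ?F" "v \<in> carrier ?F" for u v
      using that truncation by simp
    show "vac ?F \<in> carrier ?F" "conf ?F \<in> carrier ?F"
      using vac_closed conf_closed Aut_vac Aut_conf G by auto
    show "vmode ?F (vac ?F) n v = (if n = -1 then v else 0)" if "v \<in> carrier ?F" for v n
      using that vac_mode by simp
    show "vmode ?F v n (vac ?F) = 0" if "v \<in> carrier ?F" "n \<ge> 0" for v n
      using that creation_regular by simp
    show "vmode ?F v (-1) (vac ?F) = v" if "v \<in> carrier ?F" for v
      using that creation by simp
    show "vgrade ?F n = {v \<in> carrier ?F. vir ?F 0 v = of_int n *\<^sub>C v}" for n
      by (auto simp: grade_eq)
    show "vmode ?F (vir ?F (-1) v) n w = - of_int n *\<^sub>C vmode ?F v (n - 1) w"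
      if "v \<in> carrier ?F" "w \<in> carrier ?F" for v n w
      using that derivative by simp
    show "vir ?F m (vir ?F n v) - vir ?F n (vir ?F m v)
        = of_int (m - n) *\<^sub>C vir ?F (m + n) v
          + (if m + n = 0 then of_int (m ^ 3 - m) / 12 * of_rat (vrank ?F) else 0) *\<^sub>C v"
      if "v \<in> carrier ?F" for v m n
      unfolding fixed_voa_simps by (rule virasoro) (use that in simp)
    show "(\<Sum>i::nat. ((-1) ^ i * (of_int l gchoose i)) *\<^sub>C
            vmode ?F u (m + l - int i) (vmode ?F v (n + int i) w))
        - (\<Sum>i::nat. ((-1) powi l * (-1) ^ i * (of_int l gchoose i)) *\<^sub>C
            vmode ?F v (n + l - int i) (vmode ?F u (m + int i) w))
        = (\<Sum>i::nat. (of_int m gchoose i) *\<^sub>C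
            vmode ?F (vmode ?F u (l + int i) v) (m + n - int i) w)"
      if "u \<in> carrier ?F" "v \<in> carrier ?F" "w \<in> carrier ?F" for u v w l m n
      unfolding fixed_voa_simps by (rule jacobi) (use that in simp_all)
  qed
qed

text \<open>The reason why the sum of differently twisted modules is untwisted over the fixed
  vectors: for label 0 all modes have integral index, whatever the order of \<open>g\<close>, and
  the twisted Jacobi identity becomes the ordinary one.\<close>

lemma fixed_eigenspace:
  assumes "v \<in> carrier (fixed_voa G V)" and "g \<in> G"
  shows "v \<in> aut_eigenspace V g 0"
  using assms fixed_by[OF assms] by (simp add: aut_eigenspace_def scaleC_one)

lemma fixed_voa_module_sum:
  fixes M :: "('v \<Rightarrow> 'v) \<Rightarrow> ('v, 'm::complex_vector) tmodule"
  assumes finG: "finite G" and M: "\<And>g. g \<in> G \<Longrightarrow> twisted_module V g (M g)"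
  shows "voa_module (fixed_voa G V) (tmodule_sum G M)"
proof -
  let ?F = "fixed_voa G V" and ?S = "tmodule_sum G M"
  have wM: "weak_twisted_module V g (M g)" if "g \<in> G" for g
    using M[OF that] by (simp add: twisted_module_def)
  have "G \<subseteq> carrier (voa_Aut V)"
    using weak_twisted_module.aut[OF wM] by blast
  then interpret F: vertex_operator_algebra ?F by (rule vertex_operator_algebra_fixed)
  interpret A: group "voa_Aut ?F" by (rule F.group_Aut)
  have ord: "aut_order ?F \<one>\<^bsub>voa_Aut ?F\<^esub> = 1" by simp
  have FV: "v \<in> carrier V" if "v \<in> carrier ?F" for v using that by simp
  have Sg: "f g \<in> carrier (M g)" if "f \<in> carrier ?S" "g \<in> G" for f g using that by simp
  have lin: "clinear_betw (carrier ?S) (carrier ?S) (tmode ?S v n)" if v: "v \<in> carrier ?F" for v n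
    using weak_twisted_module.tmode_linear[OF wM FV[OF v]]
    by (auto simp: clinear_betw_def tmode_sum_apply scaleC_fun_def fun_eq_iff)
  have linl: "clinear_betw (carrier ?F) (carrier ?S) (\<lambda>v. tmode ?S v n w)" if w: "w \<in> carrier ?S" for w n
    using weak_twisted_module.tmode_linear_left[OF wM Sg[OF w]]
    by (auto simp: clinear_betw_def tmode_sum_apply scaleC_fun_def fun_eq_iff)
  have supp: "tmode ?S v n w = 0" if "v \<in> carrier ?F" "w \<in> carrier ?S" "n \<notin> \<int>" for v n w
    using weak_twisted_module.tmode_support_eigen[OF wM fixed_eigenspace[OF that(1)] Sg[OF that(2)]] that(3)
    by (simp add: fun_eq_iff tmode_sum_apply)
  have trunc: "\<exists>K. \<forall>n\<ge>K. tmode ?S v n w = 0" if "v \<in> carrier ?F" "w \<in> carrier ?S" for v w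
  proof -
    have "\<forall>g\<in>G. \<exists>K. \<forall>n\<ge>K. tmode (M g) v n (w g) = 0"
      using weak_twisted_module.ttruncation[OF wM FV[OF that(1)] Sg[OF that(2)]] by blast
    then obtain K where K: "\<And>g n. g \<in> G \<Longrightarrow> n \<ge> K g \<Longrightarrow> tmode (M g) v n (w g) = 0" by metis
    have "K g \<le> Max (insert 0 (K ` G))" if "g \<in> G" for g using that finG by simp
    then have "\<forall>n\<ge>Max (insert 0 (K ` G)). tmode ?S v n w = 0"
      using K by (auto simp: fun_eq_iff tmode_sum_apply) (meson order_trans)
    then show ?thesis by blast
  qed
  show ?thesis
  proof
    show "\<one>\<^bsub>voa_Aut ?F\<^esub> \<in> carrier (voa_Aut ?F)" by simp
    show "aut_order ?F \<one>\<^bsub>voa_Aut ?F\<^esub> > 0" by simp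
    show "direct_sum_of (carrier ?S) (tgrade ?S)"
      using direct_sum_of_functions[OF finG weak_twisted_module.tgrading[OF wM]]
      by (simp add: tmodule_sum_def)
    show "\<exists>K. \<forall>n<K. of_nat (aut_order ?F \<one>\<^bsub>voa_Aut ?F\<^esub>) * n \<in> \<int> \<longrightarrow> tgrade ?S (of_rat n + s) = {0}" for s
    proof -
      have "\<forall>g\<in>G. \<exists>K. \<forall>n<K. of_nat (aut_order V g) * n \<in> \<int> \<longrightarrow> tgrade (M g) (of_rat n + s) = {0}"
        using weak_twisted_module.tgrade_bounded_below[OF wM] by blast
      then obtain K where K: "\<And>g n. g \<in> G \<Longrightarrow> n < K g \<Longrightarrow> of_nat (aut_order V g) * n \<in> \<int> \<Longrightarrow>
          tgrade (M g) (of_rat n + s) = {0}" by metis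
      \<comment> \<open>For the identity automorphism only integral \<open>n\<close> matter, and an
        integer lies in (1/N)Z for the order N of each \<open>g\<close>, so the bounds of all
        summands apply together.\<close>
      have "tgrade ?S (of_rat n + s) = {0}" if n: "n < Min (insert 0 (K ` G))" "n \<in> \<int>" for n
      proof -
        have "tgrade (M g) (of_rat n + s) = {0}" if g: "g \<in> G" for g
          using K[OF g] n finG g by (simp add: Ints_mult)
        then show ?thesis by (auto simp: fun_eq_iff, metis)
      qed
      then show ?thesis unfolding ord by (intro exI[of _ "Min (insert 0 (K ` G))"]) simp
    qed
    show "clinear_betw (carrier ?F) (carrier ?S) (\<lambda>v. tmode ?S v n w)" if "w \<in> carrier ?S" for w n
      using linl that .
    show "clinear_betw (carrier ?S) (carrier ?S) (tmode ?S v n)" if "v \<in> carrier ?F" for v n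
      using lin that .
    show "tmode ?S v n w = 0" if "v \<in> carrier ?F" "w \<in> carrier ?S"
      "of_nat (aut_order ?F \<one>\<^bsub>voa_Aut ?F\<^esub>) * n \<notin> \<int>" for v n w
      using supp that by simp
    show "tmode ?S v n w = 0" if "v \<in> aut_eigenspace ?F \<one>\<^bsub>voa_Aut ?F\<^esub> j" "w \<in> carrier ?S"
      "n - of_int j / of_nat (aut_order ?F \<one>\<^bsub>voa_Aut ?F\<^esub>) \<notin> \<int>" for v j n w
    proof (rule supp)
      show "v \<in> carrier ?F" using that(1) by (simp add: aut_eigenspace_def)
      show "n \<notin> \<int>" using that(3) Ints_diff[of n "of_int j"] by auto
    qed (fact that(2))
    show "\<exists>K. \<forall>n\<ge>K. tmode ?S v n w = 0" if "v \<in> carrier ?F" "w \<in> carrier ?S" for v w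
      using trunc that .
    show "tmode ?S (vac ?F) n w = (if n = -1 then w else 0)" if w: "w \<in> carrier ?S" for n w
      using weak_twisted_module.tvac_mode[OF wM Sg[OF w]] w by (auto simp: fun_eq_iff tmode_sum_apply)
    show "tvir ?F ?S p (tvir ?F ?S q w) - tvir ?F ?S q (tvir ?F ?S p w)
        = of_int (p - q) *\<^sub>C tvir ?F ?S (p + q) w
          + (if p + q = 0 then of_int (p ^ 3 - p) / 12 * of_rat (vrank ?F) else 0) *\<^sub>C w"
      if w: "w \<in> carrier ?S" for p q w
    proof
      fix g
      show "(tvir ?F ?S p (tvir ?F ?S q w) - tvir ?F ?S q (tvir ?F ?S p w)) g
        = (of_int (p - q) *\<^sub>C tvir ?F ?S (p + q) w
          + (if p + q = 0 then of_int (p ^ 3 - p) / 12 * of_rat (vrank ?F) else 0) *\<^sub>C w) g"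
        using weak_twisted_module.tvirasoro[OF wM Sg[OF w], of g p q] w
        by (cases "g \<in> G") (simp_all add: tvir_def tmode_sum_apply scaleC_fun_def)
    qed
    show "tvir ?F ?S 0 w = s *\<^sub>C w" if w: "w \<in> tgrade ?S s" for s w
      using weak_twisted_module.tgrade_eigen[OF wM] w
      by (auto simp: fun_eq_iff tvir_def tmode_sum_apply scaleC_fun_def)
    show "tmode ?S (vir ?F (-1) v) n w = - of_rat n *\<^sub>C tmode ?S v (n - 1) w"
      if "v \<in> carrier ?F" "w \<in> carrier ?S" for v n w
      using weak_twisted_module.tderivative[OF wM FV[OF that(1)] Sg[OF that(2)]]
      by (auto simp: fun_eq_iff tmode_sum_apply scaleC_fun_def)
    show "finite_dim (tgrade ?S s)" for s
      using finite_dim_functions[OF finG twisted_module.tgrade_finite_dim[OF M]] by simp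
    show "(\<Sum>i::nat. ((-1) ^ i * (of_int l gchoose i)) *\<^sub>C
            tmode ?S u (m + of_int l - of_nat i) (tmode ?S v (n + of_nat i) w))
        - (\<Sum>i::nat. ((-1) powi l * (-1) ^ i * (of_int l gchoose i)) *\<^sub>C
            tmode ?S v (n + of_int l - of_nat i) (tmode ?S u (m + of_nat i) w))
        = (\<Sum>i::nat. (of_rat m gchoose i) *\<^sub>C
            tmode ?S (vmode ?F u (l + int i) v) (m + n - of_nat i) w)"
      (is "Sum_any ?A - Sum_any ?B = Sum_any ?C")
      if "u \<in> aut_eigenspace ?F \<one>\<^bsub>voa_Aut ?F\<^esub> k" "v \<in> carrier ?F" "w \<in> carrier ?S"
        "m - of_int k / of_nat (aut_order ?F \<one>\<^bsub>voa_Aut ?F\<^esub>) \<in> \<int>" for u k v w m l n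
    proof
      have u: "u \<in> carrier ?F" using that(1) by (simp add: aut_eigenspace_def)
      note v = that(2) and w = that(3)
      have "m - of_int k \<in> \<int>" using that(4) by (simp only: ord of_nat_1 div_by_1)
      then have m: "m \<in> \<int>" using Ints_add[of "m - of_int k" "of_int k"] by simp
      have S: "csubspace (carrier ?S)"
        using direct_sum_of_functions[OF finG weak_twisted_module.tgrading[OF wM]]
        by (simp add: direct_sum_of_def)
      note z = clinear_betw_zero[OF lin S]
      obtain Ku Kv where Ku: "\<And>n. n \<ge> Ku \<Longrightarrow> tmode ?S u n w = 0"
        and Kv: "\<And>n. n \<ge> Kv \<Longrightarrow> tmode ?S v n w = 0"
        using trunc[OF u w] trunc[OF v w] by blast
      have finA: "finite {i. ?A i \<noteq> 0}"
        by (rule finite_nonzero_rat_shift[of Kv "\<lambda>q. tmode ?S v q w" n ?A])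
          (simp add: Kv, simp only: z[OF u] complex_vector.scale_zero_right)
      have finB: "finite {i. ?B i \<noteq> 0}"
        by (rule finite_nonzero_rat_shift[of Ku "\<lambda>q. tmode ?S u q w" m ?B])
          (simp add: Ku, simp only: z[OF v] complex_vector.scale_zero_right)
      obtain K where K: "\<And>n. n \<ge> K \<Longrightarrow> vmode V u n v = 0" using truncation[OF FV[OF u] FV[OF v]] by blast
      have "?C i = 0" if "\<not> i < nat (K - l)" for i
        using K[of "l + int i"] that clinear_betw_zero[OF linl[OF w] F.carrier_subspace] by simp
      then have "{i. ?C i \<noteq> 0} \<subseteq> {..<nat (K - l)}" by auto
      then have finC: "finite {i. ?C i \<noteq> 0}" using finite_subset by blast
      fix g
      show "(Sum_any ?A - Sum_any ?B) g = Sum_any ?C g"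
      proof (cases "g \<in> G")
        case True
        \<comment> \<open>Whatever integer \<open>k\<close> labels \<open>u\<close> over the
          identity automorphism, \<open>u\<close> has label 0 for \<open>g\<close>, and
          \<open>m\<close> is integral. Thus the twisted identity of \<open>M g\<close>
          applies.\<close>
        have "m - of_int 0 / of_nat (aut_order V g) \<in> \<int>" using m by simp
        from weak_twisted_module.tjacobi[OF wM[OF True] fixed_eigenspace[OF u True] FV[OF v] Sg[OF w True] this, of l n]
        show ?thesis
          unfolding minus_apply Sum_any_fun_apply[OF finA] Sum_any_fun_apply[OF finB]
            Sum_any_fun_apply[OF finC]
          unfolding scaleC_fun_apply tmode_sum_apply fixed_voa_simps
          using True by simp
      next
        case False
        then show ?thesis
          unfolding minus_apply Sum_any_fun_apply[OF finA] Sum_any_fun_apply[OF finB]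
            Sum_any_fun_apply[OF finC]
          unfolding scaleC_fun_apply tmode_sum_apply
          by simp
      qed
    qed
  qed
qed

end

section \<open>Twisted modules permuted by a finite group\<close>

text \<open>The isomorphisms are part of the data because \<alpha>, and with it the algebra, depends
  on their choice.\<close>

locale twisted_family = simple_voa V
  for V :: "'v::complex_vector voa" +
  fixes G :: "('v \<Rightarrow> 'v) set" and M :: "('v \<Rightarrow> 'v) \<Rightarrow> ('v, 'm::complex_vector) tmodule"
    and \<phi> :: "('v \<Rightarrow> 'v) \<Rightarrow> ('v \<Rightarrow> 'v) \<Rightarrow> 'm \<Rightarrow> 'm"
  assumes G_subgroup: "subgroup G (voa_Aut V)" and G_finite: "finite G"
    and M_simple: "g \<in> G \<Longrightarrow> simple_twisted_module V g (M g)"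
    and \<phi>_iso: "g \<in> G \<Longrightarrow> h \<in> G \<Longrightarrow>
      clinear_iso (carrier (M g)) (carrier (M (conjugate (voa_Aut V) h g))) (\<phi> g h)"
    and \<phi>_mode: "g \<in> G \<Longrightarrow> h \<in> G \<Longrightarrow> v \<in> carrier V \<Longrightarrow> m \<in> carrier (M g) \<Longrightarrow>
      \<phi> g h (tmode (M g) v n m) = tmode (M (conjugate (voa_Aut V) h g)) (h v) n (\<phi> g h m)"
begin

abbreviation "K \<equiv> voa_Aut V"
abbreviation "cj \<equiv> conjugate (voa_Aut V)"

lemma G_Aut: "g \<in> G \<Longrightarrow> g \<in> carrier K"
  by (rule subgroup.mem_carrier[OF G_subgroup])

lemma G_closed: "g \<in> G \<Longrightarrow> v \<in> carrier V \<Longrightarrow> g v \<in> carrier V"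
  using Aut_closed[OF G_Aut] .

lemma cj_closed: "a \<in> G \<Longrightarrow> x \<in> G \<Longrightarrow> cj a x \<in> G"
  by (rule conjugate_closed_subgroup[OF group_Aut G_subgroup])

lemma M_simple_voa: "g \<in> G \<Longrightarrow> simple_twisted_module_simple_voa V g (M g)"
  by (simp add: simple_twisted_module_simple_voa_def simple_voa_axioms M_simple)

lemma M_twisted: "g \<in> G \<Longrightarrow> twisted_module V g (M g)"
  and M_weak: "g \<in> G \<Longrightarrow> weak_twisted_module V g (M g)"
  using M_simple by (simp_all add: simple_twisted_module_def twisted_module_def)

lemma M_subspace: "g \<in> G \<Longrightarrow> csubspace (carrier (M g))"
  by (rule weak_twisted_module.tcarrier_subspace[OF M_weak])

lemma M_mode: "g \<in> G \<Longrightarrow> v \<in> carrier V \<Longrightarrow> m \<in> carrier (M g) \<Longrightarrow> tmode (M g) v n m \<in> carrier (M g)"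
  by (rule weak_twisted_module.tmode_closed[OF M_weak])

lemma M_nonzero:
  assumes "g \<in> G" obtains m where "m \<in> carrier (M g)" "m \<noteq> 0"
  using simple_twisted_module.tnonzero[OF M_simple[OF assms]] complex_vector.subspace_0[OF M_subspace[OF assms]]
  by blast

section \<open>Intertwiners, their inverses and the cocycle\<close>

definition \<phi>i :: "('v \<Rightarrow> 'v) \<Rightarrow> ('v \<Rightarrow> 'v) \<Rightarrow> 'm \<Rightarrow> 'm"
  where "\<phi>i x a = inv_into (carrier (M x)) (\<phi> x a)"

context
  fixes x a assumes xa: "x \<in> G" "a \<in> G"
begin

lemma \<phi>_linear: "clinear_betw (carrier (M x)) (carrier (M (cj a x))) (\<phi> x a)"
  and \<phi>_bij: "bij_betw (\<phi> x a) (carrier (M x)) (carrier (M (cj a x)))"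
  using \<phi>_iso[OF xa] by (simp_all add: clinear_iso_def)

lemma \<phi>_closed: "m \<in> carrier (M x) \<Longrightarrow> \<phi> x a m \<in> carrier (M (cj a x))"
  using clinear_betw_mem[OF \<phi>_linear] .

lemma \<phi>i_linear: "clinear_betw (carrier (M (cj a x))) (carrier (M x)) (\<phi>i x a)"
  using clinear_iso_inv[OF \<phi>_iso[OF xa] M_subspace[OF xa(1)]] by (simp add: clinear_iso_def \<phi>i_def)

lemma \<phi>i_closed: "m \<in> carrier (M (cj a x)) \<Longrightarrow> \<phi>i x a m \<in> carrier (M x)"
  using clinear_betw_mem[OF \<phi>i_linear] .

lemma \<phi>i_left: "m \<in> carrier (M x) \<Longrightarrow> \<phi>i x a (\<phi> x a m) = m"
  unfolding \<phi>i_def by (rule bij_betw_inv_into_left[OF \<phi>_bij])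

lemma \<phi>i_right: "m \<in> carrier (M (cj a x)) \<Longrightarrow> \<phi> x a (\<phi>i x a m) = m"
  unfolding \<phi>i_def by (rule bij_betw_inv_into_right[OF \<phi>_bij])

lemma \<phi>_nonzero: "m \<in> carrier (M x) \<Longrightarrow> m \<noteq> 0 \<Longrightarrow> \<phi> x a m \<noteq> 0"
  using \<phi>i_left[of m] clinear_betw_zero[OF \<phi>i_linear M_subspace[OF cj_closed[OF xa(2,1)]]] by auto

text \<open>With the inverse of \<open>a\<close> applied to \<open>v\<close> in place of
  \<open>v\<close>, this says that the inverse operator twists modes by the inverse of
  \<open>a\<close>.\<close>

lemma \<phi>i_mode:
  assumes v: "v \<in> carrier V" and m: "m \<in> carrier (M (cj a x))"
  shows "\<phi>i x a (tmode (M (cj a x)) (a v) n m) = tmode (M x) v n (\<phi>i x a m)"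
  using \<phi>_mode[OF xa v \<phi>i_closed[OF m], of n] \<phi>i_left[OF M_mode[OF xa(1) v \<phi>i_closed[OF m]], of n]
  by (simp add: \<phi>i_right[OF m])

end

text \<open>The composite of \<phi>(k) and \<phi>(h) has the same source and target as \<phi>(hk)
  and also twists modes by hk. Followed by the inverse of \<phi>(hk) it commutes with all modes on
  \<open>M g\<close>, so it is a scalar by Schur's lemma. A nonzero vector shows that the scalar is
  nonzero and unique.\<close>

lemma cocycle_exists:
  assumes G: "g \<in> G" "h \<in> G" "k \<in> G"
  shows "\<exists>!c. c \<noteq> 0 \<and>
    (\<forall>m\<in>carrier (M g). \<phi> g (h \<otimes>\<^bsub>K\<^esub> k) m = inverse c *\<^sub>C \<phi> (cj k g) h (\<phi> g k m))"
proof -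
  let ?x = "cj k g" and ?hk = "h \<otimes>\<^bsub>K\<^esub> k"
  let ?f = "\<lambda>m. \<phi> ?x h (\<phi> g k m)"
  have hk: "?hk \<in> G" using G_subgroup G by (simp add: subgroup.m_closed)
  have x: "?x \<in> G" using cj_closed G by blast
  have cj: "cj ?hk g = cj h ?x" using conjugate_mult[OF group_Aut G_Aut G_Aut G_Aut] G by blast
  have f: "clinear_betw (carrier (M g)) (carrier (M (cj ?hk g))) ?f"
    unfolding cj by (rule clinear_betw_comp[OF \<phi>_linear[OF G(1,3)] \<phi>_linear[OF x G(2)]])
  have f_mode: "?f (tmode (M g) v n m) = tmode (M (cj ?hk g)) (?hk v) n (?f m)"
    if "v \<in> carrier V" "m \<in> carrier (M g)" for v n m
    using that G x \<phi>_closed[OF G(1,3)]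
    by (simp add: \<phi>_mode G_closed cj Aut_mult[OF G_Aut G_Aut])
  have f_nz: "?f m \<noteq> 0" if "m \<in> carrier (M g)" "m \<noteq> 0" for m
    using that \<phi>_nonzero[OF G(1,3)] \<phi>_nonzero[OF x G(2)] \<phi>_closed[OF G(1,3)] by blast
  have "\<phi>i g ?hk (?f (tmode (M g) v n m)) = tmode (M g) v n (\<phi>i g ?hk (?f m))"
    if "v \<in> carrier V" "m \<in> carrier (M g)" for v n m
    using \<phi>i_mode[OF G(1) hk that(1) clinear_betw_mem[OF f that(2)]] f_mode[OF that] by simp
  then obtain c where c: "\<And>m. m \<in> carrier (M g) \<Longrightarrow> \<phi>i g ?hk (?f m) = c *\<^sub>C m"
    using simple_twisted_module.schur[OF M_simple[OF G(1)] clinear_betw_comp[OF f \<phi>i_linear[OF G(1) hk]]]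
    by blast
  have fc: "?f m = c *\<^sub>C \<phi> g ?hk m" if m: "m \<in> carrier (M g)" for m
    using \<phi>i_right[OF G(1) hk clinear_betw_mem[OF f m]] c[OF m] clinear_betw_scale[OF \<phi>_linear[OF G(1) hk] m]
    by simp
  obtain m0 where m0: "m0 \<in> carrier (M g)" "m0 \<noteq> 0" using M_nonzero[OF G(1)] .
  have c0: "c \<noteq> 0" using fc[OF m0(1)] f_nz[OF m0] by auto
  show ?thesis
  proof (rule ex1I)
    show "c \<noteq> 0 \<and> (\<forall>m\<in>carrier (M g). \<phi> g ?hk m = inverse c *\<^sub>C ?f m)"
      using c0 by (simp add: fc scaleC_scaleC scaleC_one)
    fix d assume d: "d \<noteq> 0 \<and> (\<forall>m\<in>carrier (M g). \<phi> g ?hk m = inverse d *\<^sub>C ?f m)"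
    have "\<phi> g ?hk m0 = inverse d *\<^sub>C ?f m0" using d m0(1) by blast
    moreover have "\<phi> g ?hk m0 = inverse c *\<^sub>C ?f m0"
      using c0 by (simp add: fc[OF m0(1)] scaleC_scaleC scaleC_one)
    ultimately have "inverse d *\<^sub>C ?f m0 = inverse c *\<^sub>C ?f m0" by (rule subst)
    then have "inverse d = inverse c" using f_nz[OF m0] by simp
    then show "d = c" by simp
  qed
qed

abbreviation "\<alpha> \<equiv> intertwiner_cocycle K M \<phi>"

lemma cocycle:
  assumes "g \<in> G" "h \<in> G" "k \<in> G"
  shows "\<alpha> g h k \<noteq> 0"
    and "m \<in> carrier (M g) \<Longrightarrow> \<phi> g (h \<otimes>\<^bsub>K\<^esub> k) m = inverse (\<alpha> g h k) *\<^sub>C \<phi> (cj k g) h (\<phi> g k m)"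
proof -
  have "\<alpha> g h k \<noteq> 0 \<and>
      (\<forall>m\<in>carrier (M g). \<phi> g (h \<otimes>\<^bsub>K\<^esub> k) m = inverse (\<alpha> g h k) *\<^sub>C \<phi> (cj k g) h (\<phi> g k m))"
    unfolding intertwiner_cocycle_def by (rule theI'[OF cocycle_exists[OF assms]])
  then show "\<alpha> g h k \<noteq> 0"
    and "m \<in> carrier (M g) \<Longrightarrow> \<phi> g (h \<otimes>\<^bsub>K\<^esub> k) m = inverse (\<alpha> g h k) *\<^sub>C \<phi> (cj k g) h (\<phi> g k m)"
    by blast+
qed

lemma intertwiners_independent:
  assumes x: "x \<in> G" and z: "z \<in> G"
    and rel: "\<And>m. m \<in> carrier (M x) \<Longrightarrow> (\<Sum>a | a \<in> G \<and> cj a x = z. c a *\<^sub>C \<phi> x a m) = 0"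
    and a: "a \<in> G" "cj a x = z"
  shows "c a = 0"
proof -
  interpret Z: simple_twisted_module_simple_voa V z "M z" by (rule M_simple_voa[OF z])
  show ?thesis
  proof (rule Z.twisted_intertwiners_independent[where I = "{a. a \<in> G \<and> cj a x = z}" and \<sigma> = "\<lambda>a. a"
        and C = "carrier (M x)" and act = "tmode (M x)" and \<psi> = "\<phi> x" and c = c and i = a])
    show "finite {a. a \<in> G \<and> cj a x = z}" using G_finite by simp
    show "\<exists>m\<in>carrier (M x). \<phi> x i m \<noteq> 0" if "i \<in> {a. a \<in> G \<and> cj a x = z}" for i
      using M_nonzero[OF x] \<phi>_nonzero[OF x] that by (metis mem_Collect_eq)
    show "i = j" if "i \<in> {a. a \<in> G \<and> cj a x = z}" "j \<in> {a. a \<in> G \<and> cj a x = z}"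
      "\<And>v. v \<in> carrier V \<Longrightarrow> i v = j v" for i j
      using Aut_ext[of i j] G_Aut that by blast
    show "\<phi> x i (tmode (M x) v n m) = tmode (M z) (i v) n (\<phi> x i m)"
      if "i \<in> {a. a \<in> G \<and> cj a x = z}" "v \<in> carrier V" "m \<in> carrier (M x)" for i v n m
      using \<phi>_mode[OF x _ that(2,3)] that(1) by auto
    show "\<phi> x i m \<in> carrier (M z)" if "i \<in> {a. a \<in> G \<and> cj a x = z}" "m \<in> carrier (M x)" for i m
      using \<phi>_closed[OF x _ that(2)] that(1) by auto
    show "(\<Sum>i\<in>{a. a \<in> G \<and> cj a x = z}. c i *\<^sub>C \<phi> x i m) = 0" if "m \<in> carrier (M x)" for m
      using rel[OF that] .
  qed (use a x in \<open>auto intro: M_mode G_closed\<close>)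
qed

text \<open>Here the relation takes place in \<open>M x\<close> and the twists are the inverses of
  the indices, which still separate them because inversion in the group is injective.\<close>

lemma inverse_intertwiners_independent:
  assumes x: "x \<in> G" and z: "z \<in> G"
    and rel: "\<And>m. m \<in> carrier (M z) \<Longrightarrow> (\<Sum>a | a \<in> G \<and> cj a x = z. c a *\<^sub>C \<phi>i x a m) = 0"
    and a: "a \<in> G" "cj a x = z"
  shows "c a = 0"
proof -
  interpret A: group K by (rule group_Aut)
  interpret X: simple_twisted_module_simple_voa V x "M x" by (rule M_simple_voa[OF x])
  have inv: "inv\<^bsub>K\<^esub> i \<in> G" if "i \<in> G" for i using that G_subgroup by (simp add: subgroup.m_inv_closed)
  have inv2: "i ((inv\<^bsub>K\<^esub> i) v) = v" if "i \<in> G" "v \<in> carrier V" for i v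
    using Aut_inv[of "inv\<^bsub>K\<^esub> i" v] inv that G_Aut by simp
  show ?thesis
  proof (rule X.twisted_intertwiners_independent[where I = "{a. a \<in> G \<and> cj a x = z}" and \<sigma> = "\<lambda>a. inv\<^bsub>K\<^esub> a"
        and C = "carrier (M z)" and act = "tmode (M z)" and \<psi> = "\<phi>i x" and c = c and i = a])
    show "(\<Sum>i\<in>{a. a \<in> G \<and> cj a x = z}. c i *\<^sub>C \<phi>i x i m) = 0" if "m \<in> carrier (M z)" for m
      using rel[OF that] .
    show "finite {a. a \<in> G \<and> cj a x = z}" using G_finite by simp
    show "\<exists>m\<in>carrier (M z). \<phi>i x i m \<noteq> 0" if i: "i \<in> {a. a \<in> G \<and> cj a x = z}" for i
    proof -
      obtain m where m: "m \<in> carrier (M x)" "m \<noteq> 0" using M_nonzero[OF x] .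
      have "\<phi>i x i (\<phi> x i m) \<noteq> 0" using \<phi>i_left[OF x _ m(1), of i] m(2) i by simp
      moreover have "\<phi> x i m \<in> carrier (M z)" using \<phi>_closed[OF x _ m(1), of i] i by auto
      ultimately show ?thesis by blast
    qed
    show "i = j" if ij: "i \<in> {a. a \<in> G \<and> cj a x = z}" "j \<in> {a. a \<in> G \<and> cj a x = z}"
      "\<And>v. v \<in> carrier V \<Longrightarrow> (inv\<^bsub>K\<^esub> i) v = (inv\<^bsub>K\<^esub> j) v" for i j
    proof -
      have "inv\<^bsub>K\<^esub> i = inv\<^bsub>K\<^esub> j" using ij inv G_Aut by (intro Aut_ext) auto
      then show ?thesis using ij G_Aut A.inv_inv by (metis mem_Collect_eq)
    qed
    show "\<phi>i x i (tmode (M z) v n m) = tmode (M x) ((inv\<^bsub>K\<^esub> i) v) n (\<phi>i x i m)"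
      if i: "i \<in> {a. a \<in> G \<and> cj a x = z}" and v: "v \<in> carrier V" and m: "m \<in> carrier (M z)" for i v n m
    proof -
      have iG: "i \<in> G" and iz: "cj i x = z" using i by auto
      show ?thesis
        using \<phi>i_mode[OF x iG G_closed[OF inv[OF iG] v], of m n] m inv2[OF iG v] by (simp add: iz)
    qed
    show "\<phi>i x i m \<in> carrier (M x)" if "i \<in> {a. a \<in> G \<and> cj a x = z}" "m \<in> carrier (M z)" for i m
      using \<phi>i_closed[OF x, of i m] that by auto
  qed (use a z inv in \<open>auto intro: M_mode G_closed\<close>)
qed

sublocale proj: projective_family K G "\<lambda>g. carrier (M g)" \<phi> \<alpha>
proof (intro projective_family.intro projective_family_axioms.intro)
  show "group K" by (rule group_Aut)
  show "subgroup G K" "finite G" by (fact G_subgroup G_finite)+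
  show "csubspace (carrier (M g))" if "g \<in> G" for g
    using M_subspace that .
  show "clinear_iso (carrier (M g)) (carrier (M (cj h g))) (\<phi> g h)" if "g \<in> G" "h \<in> G" for g h
    using \<phi>_iso that .
  show "\<alpha> g h k \<noteq> 0" if "g \<in> G" "h \<in> G" "k \<in> G" for g h k
    using cocycle(1) that .
  show "\<phi> g (h \<otimes>\<^bsub>K\<^esub> k) m = inverse (\<alpha> g h k) *\<^sub>C \<phi> (cj k g) h (\<phi> g k m)"
    if "g \<in> G" "h \<in> G" "k \<in> G" "m \<in> carrier (M g)" for g h k m
    using cocycle(2) that .
  show "\<forall>a\<in>G. cj a x = z \<longrightarrow> c a = 0" if "x \<in> G" "z \<in> G"
    "\<forall>m\<in>carrier (M x). (\<Sum>a | a \<in> G \<and> cj a x = z. c a *\<^sub>C \<phi> x a m) = 0" for x z c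
    using intertwiners_independent[of x z c] that by blast
  show "\<forall>a\<in>G. cj a x = z \<longrightarrow> c a = 0" if "x \<in> G" "z \<in> G"
    "\<forall>m\<in>carrier (M z).
      (\<Sum>a | a \<in> G \<and> cj a x = z. c a *\<^sub>C inv_into (carrier (M x)) (\<phi> x a) m) = 0" for x z c
    using inverse_intertwiners_independent[of x z c] that unfolding \<phi>i_def by blast
qed

lemma W_eq: "proj.W = carrier (tmodule_sum G M)"
  by (simp add: proj.W_def)

text \<open>Moving \<phi>_x(a) past a mode of \<open>v\<close> replaces \<open>v\<close> by a(v),
  which equals \<open>v\<close> for an invariant vector. Linearity extends this from basis elements
  to all of \<open>D\<close>.\<close>

lemma actions_commute:
  assumes v: "v \<in> carrier (fixed_voa G V)" and f: "f \<in> carrier (tmodule_sum G M)"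
  shows "proj.act d (tmode (tmodule_sum G M) v n f) = tmode (tmodule_sum G M) v n (proj.act d f)"
proof -
  let ?S = "tmodule_sum G M"
  have vV: "v \<in> carrier V" using v by simp
  interpret F: vertex_operator_algebra "fixed_voa G V"
    by (rule vertex_operator_algebra_fixed) (use G_Aut in blast)
  interpret S: twisted_module "fixed_voa G V" "\<one>\<^bsub>voa_Aut (fixed_voa G V)\<^esub>" ?S
    by (rule fixed_voa_module_sum[OF G_finite M_twisted])
  note lin = S.tmode_linear[OF v]
  have oprS: "proj.basis_op p f \<in> carrier ?S" if "p \<in> G \<times> G" for p
    using clinear_betw_mem[OF proj.basis_op_linear[OF that]] f unfolding W_eq .
  have "proj.basis_op p (tmode ?S v n f) = tmode ?S v n (proj.basis_op p f)" if p: "p \<in> G \<times> G" for p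
  proof -
    obtain a x where ax: "p = (a, x)" "a \<in> G" "x \<in> G" using p by auto
    have fx: "f x \<in> carrier (M x)" using f ax by simp
    have "tmode (M i) v n 0 = 0" if "i \<in> G" for i
      by (rule weak_twisted_module.tmode_zero_right[OF M_weak[OF that] vV])
    then have "proj.basis_op p (tmode ?S v n f) i = tmode ?S v n (proj.basis_op p f) i" for i
      using \<phi>_mode[OF ax(3,2) vV fx, of n] fixed_by[OF v ax(2)] ax cj_closed[OF ax(2,3)]
      by (simp add: proj.basis_op_def summand_def tmode_sum_apply)
    then show ?thesis by (rule ext)
  qed
  moreover have "tmode ?S v n (proj.act d f) = (\<Sum>p\<in>G \<times> G. d p *\<^sub>C tmode ?S v n (proj.basis_op p f))"
    unfolding proj.act_eq using oprS
    by (subst clinear_betw_sum[OF lin S.tcarrier_subspace])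
      (auto simp del: tmodule_sum_simps simp: clinear_betw_scale[OF lin]
        complex_vector.subspace_scale[OF S.tcarrier_subspace] intro!: sum.cong)
  ultimately show ?thesis by (simp add: proj.act_eq)
qed

end

theorem theorem4p1:
  fixes V :: "'v::complex_vector voa"
    and G :: "('v \<Rightarrow> 'v) set"
    and M :: "('v \<Rightarrow> 'v) \<Rightarrow> ('v, 'm::complex_vector) tmodule"
    and \<phi> :: "('v \<Rightarrow> 'v) \<Rightarrow> ('v \<Rightarrow> 'v) \<Rightarrow> 'm \<Rightarrow> 'm"
    and D :: "(('v \<Rightarrow> 'v) \<times> ('v \<Rightarrow> 'v) \<Rightarrow> complex) monoid"
    and Vstar :: "('v, ('v \<Rightarrow> 'v) \<Rightarrow> 'm) tmodule"
    and act :: "(('v \<Rightarrow> 'v) \<times> ('v \<Rightarrow> 'v) \<Rightarrow> complex) \<Rightarrow> (('v \<Rightarrow> 'v) \<Rightarrow> 'm) \<Rightarrow> ('v \<Rightarrow> 'v) \<Rightarrow> 'm"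
  assumes "simple_voa V"
    and "subgroup G (voa_Aut V)" and "finite G"
    and "\<And>g. g \<in> G \<Longrightarrow> simple_twisted_module V g (M g)"
    and "\<And>g h. \<lbrakk>g \<in> G; h \<in> G\<rbrakk> \<Longrightarrow>
          \<exists>f. tmodule_iso V (M g \<circ>\<^sub>M h) (M (inv\<^bsub>voa_Aut V\<^esub> h \<otimes>\<^bsub>voa_Aut V\<^esub> g \<otimes>\<^bsub>voa_Aut V\<^esub> h)) f"
    and "\<And>g h. \<lbrakk>g \<in> G; h \<in> G\<rbrakk> \<Longrightarrow>
          clinear_iso (carrier (M g)) (carrier (M (conjugate (voa_Aut V) h g))) (\<phi> g h) \<and>
          (\<forall>v\<in>carrier V. \<forall>n. \<forall>m\<in>carrier (M g).
            \<phi> g h (tmode (M g) v n m) = tmode (M (conjugate (voa_Aut V) h g)) (h v) n (\<phi> g h m))"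
  defines "D \<equiv> quantum_double (voa_Aut V) G (intertwiner_cocycle (voa_Aut V) M \<phi>)"
    and "Vstar \<equiv> tmodule_sum G M"
    and "act \<equiv> qd_action (voa_Aut V) G \<phi>"
  shows "(algebra_module D (carrier Vstar) act \<and>
          (\<forall>a\<in>G. \<forall>x\<in>G. \<forall>g\<in>G. \<forall>m\<in>carrier (M g).
            act (qd_basis a x) (summand g m) =
              (if x = g then summand (conjugate (voa_Aut V) a x) (\<phi> x a m) else 0)))
       \<and> (\<forall>(S :: 's::complex_vector set) actS. simple_algebra_module D S actS \<longrightarrow>
            (\<exists>U f. algebra_submodule D (carrier Vstar) act U \<and> algebra_module_iso D S actS U act f))
       \<and> (voa_module (fixed_voa G V) Vstar \<and>
          (\<forall>d\<in>carrier D. \<forall>v\<in>carrier (fixed_voa G V). \<forall>n. \<forall>f\<in>carrier Vstar.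
            act d (tmode Vstar v n f) = tmode Vstar v n (act d f)))"
proof -
  interpret twisted_family V G M \<phi>
    using assms by (simp add: twisted_family_def twisted_family_axioms_def)
  \<comment> \<open>For \<open>x\<close> different from \<open>g\<close> the vector has coordinate 0
    at \<open>x\<close>, and the linear map \<phi>_x(a) sends it to 0.\<close>
  have "act (qd_basis a x) (summand g m) = (if x = g then summand (conjugate (voa_Aut V) a x) (\<phi> x a m) else 0)"
    if "a \<in> G" "x \<in> G" "g \<in> G" "m \<in> carrier (M g)" for a x g m
    using proj.act_basis[of "(a, x)" "summand g m"] that proj.\<phi>_zero[of x a]
    by (cases "x = g") (auto simp: act_def proj.basis_op_def summand_def intro!: ext)
  then show ?thesis
    using proj.algebra_module_W proj.simple_module_occurs fixed_voa_module_sum[OF G_finite M_twisted] actions_commute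
    unfolding D_def Vstar_def act_def W_eq by blast
qed

end
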